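(* The following conditions are equivalent: (i) $\min\mathcal{I}_G=0$, where the minimum is taken over isometric immersions of $G_{2\times2}$ in $\mathbb{R}^3$ of regularity $W^{2,2}$, i.e. over $y\in W^{2,2}(\Omega,\mathbb{R}^3)$ with $(\nabla y)^T\nabla y=G_{2\times2}$ a.e. in $\Omega$. (ii) There exists a $W^{2,2}$ isometric immersion $y:\Omega\to\mathbb{R}^3$ of $G_{2\times2}$ such that $$\mathrm{sym}\big((\nabla y)^T\nabla\vec b\big)=0\qquad\text{a.e. in }\Omega,$$ where $\vec b:\Omega\to\mathbb{R}^3$ is uniquely defined by the requirement that the matrix field $Q$ with columns $Qe_1=\partial_1y$, $Qe_2=\partial_2y$, $Qe_3=\vec b$ satisfies $\det Q>0$ and $Q^TQ=G$. (iii) There exists a $W^{2,2}$ isometric immersion of $G_{2\times2}$ in $\mathbb{R}^3$ whose second fundamental form $\Pi$ is given by the Christoffel symbols of $G$: $$\Pi_{11}=-\frac1{\sqrt{G^{33}}}\Gamma^3_{11},\qquad \Pi_{22}=-\frac1{\sqrt{G^{33}}}\Gamma^3_{22},\qquad \Pi_{12}=-\frac1{\sqrt{G^{33}}}\Gamma^3_{12}.$$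
   Context: $\Omega\subset\mathbb{R}^2$ is an open, bounded, smooth and simply connected set. $G:\bar\Omega\to\mathbb{R}^{3\times3}$ is a smooth field of symmetric positive definite matrices, regarded as a Riemannian metric on $\Omega\times\mathbb{R}$ independent of $x_3$ (so $\partial_3G=0$); $A=\sqrt G$. For $F\in\mathbb{R}^{3\times3}$, $F_{2\times2}$ is its principal (upper-left) $2\times2$ block, and $\mathrm{sym}\,F=\frac12(F+F^T)$. With $[G^{ij}]=G^{-1}$, the Christoffel symbols of $G$ are $\Gamma^i_{kl}=\frac12\sum_{m=1}^3G^{im}(\partial_lG_{mk}+\partial_kG_{ml}-\partial_mG_{kl})$. $W:\mathbb{R}^{3\times3}\to[0,+\infty]$ is $\mathcal{C}^2$ in a neighborhood of $SO(3)$ and there is $c>0$ such that for all $F\in\mathbb{R}^{3\times3}$, $R\in SO(3)$: $W(R)=0$, $W(RF)=W(F)$, $W(F)\ge c\,\mathrm{dist}^2(F,SO(3))$. Put $\mathcal{Q}_3(F)=D^2W(\mathrm{Id})(F,F)$ and $\mathcal{Q}_2(x',F_{2\times2})=\min\{\mathcal{Q}_3(A(x')^{-1}\tilde FA(x')^{-1});\ \tilde F\in\mathbb{R}^{3\times3},\ \tilde F_{2\times2}=F_{2\times2}\}$. For a $W^{2,2}$ isometric immersion $y$ of $G_{2\times2}$, let $\vec N=\frac{\partial_1y\times\partial_2y}{|\partial_1y\times\partial_2y|}$; its second fundamental form is $\Pi=(\nabla y)^T\nabla\vec N$, i.e. $\Pi_{ij}=\langle\partial_iy,\partial_j\vec N\rangle$.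 Let $\vec b=(\nabla y)(G_{2\times2})^{-1}\begin{bmatrix}G_{13}\\ G_{23}\end{bmatrix}+\frac{\sqrt{\det G}}{\sqrt{\det G_{2\times2}}}\vec N$ (this coincides with the $\vec b$ described in (ii)). Then $$\mathcal{I}_G(y)=\frac1{24}\int_\Omega\mathcal{Q}_2\big(x',(\nabla y)^T\nabla\vec b\big)\,\mathrm{d}x'.$$ *)

theory Defs
  imports "HOL-Analysis.Analysis"
begin

section \<open>Classical smoothness\<close>

text \<open>Iterated Frechet differentiability; meaningful on open sets \<open>S\<close>.\<close>

primrec Ck_on :: "nat \<Rightarrow> 'a::euclidean_space set \<Rightarrow> ('a \<Rightarrow> 'b::real_normed_vector) \<Rightarrow> bool" where
  "Ck_on 0 S f \<longleftrightarrow> continuous_on S f"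
| "Ck_on (Suc k) S f \<longleftrightarrow> (\<forall>x\<in>S. f differentiable (at x)) \<and>
     (\<forall>v. Ck_on k S (\<lambda>x. frechet_derivative f (at x) v))"

definition smooth_on_open :: "'a::euclidean_space set \<Rightarrow> ('a \<Rightarrow> 'b::real_normed_vector) \<Rightarrow> bool" where
  "smooth_on_open S f \<longleftrightarrow> open S \<and> (\<forall>k. Ck_on k S f)"

text \<open>Smoothness on an arbitrary set (here: the closure of a domain): the restriction of a smooth
  function defined on a neighbourhood.\<close>

definition smooth_on_set :: "'a::euclidean_space set \<Rightarrow> ('a \<Rightarrow> 'b::real_normed_vector) \<Rightarrow> bool" where
  "smooth_on_set S f \<longleftrightarrow> (\<exists>U g. S \<subseteq> U \<and> smooth_on_open U g \<and> (\<forall>x\<in>S. g x = f x))"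

text \<open>Near each boundary point, \<open>\<Omega>\<close> is the strict sublevel set of a smooth function with
  nonvanishing gradient.\<close>

definition smooth_boundary :: "'a::euclidean_space set \<Rightarrow> bool" where
  "smooth_boundary \<Omega> \<longleftrightarrow>
     (\<forall>p\<in>frontier \<Omega>. \<exists>U (\<phi> :: 'a \<Rightarrow> real). p \<in> U \<and> smooth_on_open U \<phi> \<and>
        (\<forall>x\<in>U. \<exists>v. frechet_derivative \<phi> (at x) v \<noteq> 0) \<and>
        \<Omega> \<inter> U = {x\<in>U. \<phi> x < 0})"

definition partial_deriv :: "'n \<Rightarrow> (real^'n \<Rightarrow> 'b::real_normed_vector) \<Rightarrow> real^'n \<Rightarrow> 'b" where
  "partial_deriv i f x = frechet_derivative f (at x) (axis i 1)"

definition second_deriv :: "('a::real_normed_vector \<Rightarrow> 'b::real_normed_vector) \<Rightarrow> 'a \<Rightarrow> 'a \<Rightarrow> 'a \<Rightarrow> 'b" where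
  "second_deriv f x u v = frechet_derivative (\<lambda>z. frechet_derivative f (at z) u) (at x) v"

section \<open>Weak derivatives and Sobolev spaces\<close>

definition locally_L1 :: "(real^'n) set \<Rightarrow> (real^'n \<Rightarrow> 'b::euclidean_space) \<Rightarrow> bool" where
  "locally_L1 \<Omega> f \<longleftrightarrow> (\<forall>K. compact K \<and> K \<subseteq> \<Omega> \<longrightarrow> f absolutely_integrable_on K)"

definition test_function :: "(real^'n) set \<Rightarrow> (real^'n \<Rightarrow> real) \<Rightarrow> bool" where
  "test_function \<Omega> \<phi> \<longleftrightarrow> smooth_on_open UNIV \<phi> \<and>
     compact (closure {x. \<phi> x \<noteq> 0}) \<and> closure {x. \<phi> x \<noteq> 0} \<subseteq> \<Omega>"

definition has_weak_partial ::
    "(real^'n) set \<Rightarrow> 'n \<Rightarrow> (real^'n \<Rightarrow> 'b::euclidean_space) \<Rightarrow> (real^'n \<Rightarrow> 'b) \<Rightarrow> bool" where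
  "has_weak_partial \<Omega> i f g \<longleftrightarrow> locally_L1 \<Omega> f \<and> locally_L1 \<Omega> g \<and>
     (\<forall>\<phi>. test_function \<Omega> \<phi> \<longrightarrow>
        (LINT x|lebesgue_on \<Omega>. partial_deriv i \<phi> x *\<^sub>R f x) =
        - (LINT x|lebesgue_on \<Omega>. \<phi> x *\<^sub>R g x))"

text \<open>A weak derivative is determined only almost everywhere. The function below picks a
  representative; everything built from it is used only under ``almost everywhere'' or an integral.\<close>

definition weak_partial ::
    "(real^'n) set \<Rightarrow> 'n \<Rightarrow> (real^'n \<Rightarrow> 'b::euclidean_space) \<Rightarrow> real^'n \<Rightarrow> 'b" where
  "weak_partial \<Omega> i f = (SOME g. has_weak_partial \<Omega> i f g)"

text \<open>The matrix whose \<open>j\<close>-th column is the \<open>j\<close>-th weak partial derivative.\<close>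

definition weak_grad :: "(real^'n) set \<Rightarrow> (real^'n \<Rightarrow> real^'m) \<Rightarrow> real^'n \<Rightarrow> real^'n^'m" where
  "weak_grad \<Omega> f x = (\<chi> k j. weak_partial \<Omega> j f x $ k)"

definition L2_on :: "(real^'n) set \<Rightarrow> (real^'n \<Rightarrow> 'b::euclidean_space) \<Rightarrow> bool" where
  "L2_on \<Omega> f \<longleftrightarrow> f \<in> borel_measurable (lebesgue_on \<Omega>) \<and>
     integrable (lebesgue_on \<Omega>) (\<lambda>x. (norm (f x))\<^sup>2)"

text \<open>The Sobolev space \<open>W\<close> with exponents \<open>k, 2\<close>.\<close>

primrec sobolev2 :: "nat \<Rightarrow> (real^'n) set \<Rightarrow> (real^'n \<Rightarrow> 'b::euclidean_space) \<Rightarrow> bool" where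
  "sobolev2 0 \<Omega> f \<longleftrightarrow> L2_on \<Omega> f"
| "sobolev2 (Suc k) \<Omega> f \<longleftrightarrow> L2_on \<Omega> f \<and> (\<forall>i. \<exists>g. has_weak_partial \<Omega> i f g \<and> sobolev2 k \<Omega> g)"

section \<open>Matrices\<close>

definition spd :: "real^'n^'n \<Rightarrow> bool" where
  "spd M \<longleftrightarrow> transpose M = M \<and> (\<forall>v. v \<noteq> 0 \<longrightarrow> v \<bullet> (M *v v) > 0)"

definition mat_sqrt :: "real^'n^'n \<Rightarrow> real^'n^'n" where
  "mat_sqrt M = (THE A. spd A \<and> A ** A = M)"

definition sym_part :: "real^'n^'n \<Rightarrow> real^'n^'n" where
  "sym_part F = (1/2) *\<^sub>R (F + transpose F)"

definition block22 :: "real^3^3 \<Rightarrow> real^2^2" where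
  "block22 F = vector [vector [F$1$1, F$1$2], vector [F$2$1, F$2$2]]"

definition cols3 :: "real^3 \<Rightarrow> real^3 \<Rightarrow> real^3 \<Rightarrow> real^3^3" where
  "cols3 a b c = transpose (vector [a, b, c])"

definition SO3 :: "(real^3^3) set" where
  "SO3 = {R. rotation_matrix R}"

section \<open>Christoffel symbols of a metric independent of the third variable\<close>

text \<open>\<open>G\<close> is a function of \<open>(x\<^sub>1, x\<^sub>2)\<close> only, so \<open>\<partial>\<^sub>3 G = 0\<close>.\<close>

definition metric_deriv :: "(real^2 \<Rightarrow> real^3^3) \<Rightarrow> 3 \<Rightarrow> 3 \<Rightarrow> 3 \<Rightarrow> real^2 \<Rightarrow> real" where
  "metric_deriv G l m k x =
     (if l = 1 then partial_deriv 1 (\<lambda>z. G z $ m $ k) x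
      else if l = 2 then partial_deriv 2 (\<lambda>z. G z $ m $ k) x
      else 0)"

definition christoffel :: "(real^2 \<Rightarrow> real^3^3) \<Rightarrow> 3 \<Rightarrow> 3 \<Rightarrow> 3 \<Rightarrow> real^2 \<Rightarrow> real" where
  "christoffel G i k l x =
     1/2 * (\<Sum>m\<in>UNIV. matrix_inv (G x) $ i $ m *
       (metric_deriv G l m k x + metric_deriv G k m l x - metric_deriv G m k l x))"

section \<open>Isometric immersions\<close>

definition isometric_immersion :: "(real^2) set \<Rightarrow> (real^2 \<Rightarrow> real^3^3) \<Rightarrow> (real^2 \<Rightarrow> real^3) \<Rightarrow> bool" where
  "isometric_immersion \<Omega> G y \<longleftrightarrow> sobolev2 2 \<Omega> y \<and>
     (AE x in lebesgue_on \<Omega>. transpose (weak_grad \<Omega> y x) ** weak_grad \<Omega> y x = block22 (G x))"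

definition unit_normal :: "(real^2) set \<Rightarrow> (real^2 \<Rightarrow> real^3) \<Rightarrow> real^2 \<Rightarrow> real^3" where
  "unit_normal \<Omega> y x =
     (let n = cross3 (weak_partial \<Omega> 1 y x) (weak_partial \<Omega> 2 y x) in n /\<^sub>R norm n)"

definition second_form :: "(real^2) set \<Rightarrow> (real^2 \<Rightarrow> real^3) \<Rightarrow> real^2 \<Rightarrow> real^2^2" where
  "second_form \<Omega> y x = transpose (weak_grad \<Omega> y x) ** weak_grad \<Omega> (unit_normal \<Omega> y) x"

text \<open>The Cosserat vector: by its explicit formula, and as the unique vector completing \<open>\<nabla>y\<close> to a
  positively oriented frame \<open>Q\<close> with \<open>Q\<^sup>T Q = G\<close>. The description is evaluated pointwise; the
  vector exists uniquely at every point where \<open>(\<nabla>y)\<^sup>T \<nabla>y\<close> equals the principal block of \<open>G\<close>.\<close>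

definition cosserat :: "(real^2) set \<Rightarrow> (real^2 \<Rightarrow> real^3^3) \<Rightarrow> (real^2 \<Rightarrow> real^3) \<Rightarrow> real^2 \<Rightarrow> real^3" where
  "cosserat \<Omega> G y x =
     weak_grad \<Omega> y x *v (matrix_inv (block22 (G x)) *v vector [G x $ 1 $ 3, G x $ 2 $ 3])
     + (sqrt (det (G x)) / sqrt (det (block22 (G x)))) *\<^sub>R unit_normal \<Omega> y x"

definition frame_vector :: "(real^2) set \<Rightarrow> (real^2 \<Rightarrow> real^3^3) \<Rightarrow> (real^2 \<Rightarrow> real^3) \<Rightarrow> real^2 \<Rightarrow> real^3" where
  "frame_vector \<Omega> G y x =
     (THE b. let Q = cols3 (weak_partial \<Omega> 1 y x) (weak_partial \<Omega> 2 y x) b in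
        det Q > 0 \<and> transpose Q ** Q = G x)"

section \<open>The bending energy\<close>

definition Q3 :: "(real^3^3 \<Rightarrow> ennreal) \<Rightarrow> real^3^3 \<Rightarrow> real" where
  "Q3 W F = second_deriv (\<lambda>X. enn2real (W X)) (mat 1) F F"

text \<open>\<open>LEAST\<close> on the reals denotes the attained minimum.\<close>

definition Q2 :: "(real^3^3 \<Rightarrow> ennreal) \<Rightarrow> (real^2 \<Rightarrow> real^3^3) \<Rightarrow> real^2 \<Rightarrow> real^2^2 \<Rightarrow> real" where
  "Q2 W G x F = (LEAST q. \<exists>F'. block22 F' = F \<and>
     q = Q3 W (matrix_inv (mat_sqrt (G x)) ** F' ** matrix_inv (mat_sqrt (G x))))"

text \<open>The integrand is nonnegative, as \<open>Q3 W\<close> is the Hessian of \<open>W \<ge> 0\<close> at a zero of \<open>W\<close>. The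
  integral over \<open>[0, \<infinity>]\<close> avoids the default value \<open>0\<close> of a non-convergent Bochner integral.\<close>

definition bending_energy ::
    "(real^2) set \<Rightarrow> (real^3^3 \<Rightarrow> ennreal) \<Rightarrow> (real^2 \<Rightarrow> real^3^3) \<Rightarrow> (real^2 \<Rightarrow> real^3) \<Rightarrow> ennreal" where
  "bending_energy \<Omega> W G y =
     (1/24) * (\<integral>\<^sup>+ x. ennreal (Q2 W G x (transpose (weak_grad \<Omega> y x) ** weak_grad \<Omega> (cosserat \<Omega> G y) x))
                \<partial>lebesgue_on \<Omega>)"

end

theory Submission
  imports Defs
begin

text \<open>
  All three conditions can be compared for one fixed immersion \<open>y\<close>. Along an isometric immersion the
  gradient is bounded, so the unit normal \<open>N\<close> and the Cosserat vector
  \<open>b = a\<^sub>1 \<partial>\<^sub>1y + a\<^sub>2 \<partial>\<^sub>2y + \<beta>N\<close> are again bounded and weakly differentiable, and the identities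
  \<open>\<langle>\<partial>\<^sub>iy, \<partial>\<^sub>ky\<rangle> = G\<^sub>i\<^sub>k\<close>, \<open>\<langle>N, \<partial>\<^sub>iy\<rangle> = 0\<close>, \<open>\<langle>b, \<partial>\<^sub>iy\<rangle> = G\<^sub>i\<^sub>3\<close> may be differentiated by the product rule.
  With the symmetry of weak second derivatives this yields
  \<open>sym ((\<nabla>y)\<^sup>T \<nabla>b)\<^sub>i\<^sub>j = \<Gamma>\<^sup>3\<^sub>i\<^sub>j / G\<^sup>3\<^sup>3 + \<Pi>\<^sub>i\<^sub>j / sqrt G\<^sup>3\<^sup>3\<close>, hence (ii) \<open>\<longleftrightarrow>\<close> (iii).

  For (i) \<open>\<longleftrightarrow>\<close> (ii), the Hessian of \<open>W\<close> at the identity vanishes on skew matrices, because the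
  differential of \<open>W\<close> vanishes along all of \<open>SO(3)\<close>, and dominates \<open>|sym F|\<^sup>2\<close> by the growth
  condition. So \<open>Q2 (x, F)\<close> is an attained minimum, it vanishes if \<open>sym F = 0\<close>, and it is bounded
  below by a multiple of \<open>|sym F|\<^sup>2\<close>.
\<close>

section \<open>Smooth bump functions\<close>

text \<open>The immersion has only weak derivatives, so the analytic obstacle is the product rule
  for locally bounded functions whose weak derivatives are merely locally integrable. It is reached
  through difference quotients: a bounded function with weak derivative \<open>p\<close> differs
  from its translate by the integral of \<open>p\<close> along the connecting segment. No chain rule
  for weak derivatives occurs. The length of the cross product of the two tangent vectors is almost
  everywhere the square root of the determinant of the block of \<open>G\<close>, a classical C^1
  function. Hence the normal and the Cosserat vector agree almost everywhere with polynomials in the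
  tangent vectors that have C^1 coefficients. The factor in (iii) comes from block inversion: with
  \<beta> = \<open>ncoef G\<close>, the entry G^33 of the inverse metric is 1/\<beta>^2, the
  reciprocal of a Schur complement. The lower bound for \<open>Q2\<close> carries the constant
  2c/(trace G)^2: undoing the conjugation by A^-1, where A is the root of \<open>G\<close>, costs
  |A|^2 = trace G. This constant is bounded away from 0 on compact sets only, so vanishing energy is
  exploited box by box.\<close>

lemma Ck_on_SucD: "Ck_on (Suc k) S f \<Longrightarrow> Ck_on k S f"
proof (induction k arbitrary: f)
  case 0
  then show ?case
    by (auto intro!: continuous_at_imp_continuous_on differentiable_imp_continuous_within)
qed auto

text \<open>Openness turns agreement on \<open>S\<close> into agreement near each of its points,
  which passes to all iterated derivatives.\<close>

lemma Ck_on_transform: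
  assumes "open S" "\<And>x. x \<in> S \<Longrightarrow> f x = g x" "Ck_on k S f"
  shows "Ck_on k S g"
  using assms(2,3)
proof (induction k arbitrary: f g)
  case 0
  then show ?case by (simp cong: continuous_on_cong)
next
  case (Suc k)
  have "g differentiable at x" if "x \<in> S" for x
    using Suc.prems that assms(1) by (metis Ck_on.simps(2) differentiable_def has_derivative_transform_within_open)
  moreover have "Ck_on k S (\<lambda>x. frechet_derivative g (at x) v)" for v
  proof (rule Suc.IH)
    show "Ck_on k S (\<lambda>x. frechet_derivative f (at x) v)" using Suc.prems by simp
    show "frechet_derivative f (at x) v = frechet_derivative g (at x) v" if "x \<in> S" for x
      using frechet_derivative_transform_within_open[OF _ assms(1) that, of f g] Suc.prems that
      by simp
  qed
  ultimately show ?case by simp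
qed

lemma Ck_on_const: "Ck_on k S (\<lambda>x. c)"
  by (induction k arbitrary: c) (auto simp: frechet_derivative_const)

lemma Ck_on_subset: "Ck_on k S f \<Longrightarrow> T \<subseteq> S \<Longrightarrow> Ck_on k T f"
  by (induction k arbitrary: f) (auto intro: continuous_on_subset)

lemma Ck_on_add:
  assumes "open S" "Ck_on k S f" "Ck_on k S g"
  shows "Ck_on k S (\<lambda>x. f x + g x)"
  using assms(2,3)
proof (induction k arbitrary: f g)
  case 0
  then show ?case by (simp add: continuous_on_add)
next
  case (Suc k)
  have "Ck_on k S (\<lambda>x. frechet_derivative (\<lambda>x. f x + g x) (at x) v)" for v
  proof (rule Ck_on_transform[OF assms(1)])
    show "Ck_on k S (\<lambda>x. frechet_derivative f (at x) v + frechet_derivative g (at x) v)"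
      using Suc by simp
    show "frechet_derivative f (at x) v + frechet_derivative g (at x) v =
        frechet_derivative (\<lambda>x. f x + g x) (at x) v" if "x \<in> S" for x
    proof -
      have "f differentiable at x" "g differentiable at x" using Suc.prems that by auto
      from has_derivative_add[OF this[THEN frechet_derivative_works[THEN iffD1]]]
      show ?thesis by (metis (no_types, lifting) frechet_derivative_at)
    qed
  qed
  then show ?case using Suc.prems by (auto intro!: differentiable_add)
qed

lemma Ck_on_mult:
  fixes f g :: "'a::euclidean_space \<Rightarrow> real"
  assumes "open S" "Ck_on k S f" "Ck_on k S g"
  shows "Ck_on k S (\<lambda>x. f x * g x)"
  using assms(2,3)
proof (induction k arbitrary: f g)
  case 0
  then show ?case by (simp add: continuous_on_mult)
next
  case (Suc k)
  have "Ck_on k S (\<lambda>x. frechet_derivative (\<lambda>x. f x * g x) (at x) v)" for v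
  proof (rule Ck_on_transform[OF assms(1)])
    show "Ck_on k S (\<lambda>x. f x * frechet_derivative g (at x) v
        + frechet_derivative f (at x) v * g x)"
      using Suc.prems by (intro Ck_on_add[OF assms(1)] Suc.IH) (auto dest: Ck_on_SucD simp del: Ck_on.simps(2) , auto)
    show "f x * frechet_derivative g (at x) v + frechet_derivative f (at x) v * g x =
        frechet_derivative (\<lambda>x. f x * g x) (at x) v" if "x \<in> S" for x
    proof -
      have "f differentiable at x" "g differentiable at x" using Suc.prems that by auto
      from has_derivative_mult[OF this[THEN frechet_derivative_works[THEN iffD1]]]
      show ?thesis by (metis (no_types, lifting) frechet_derivative_at)
    qed
  qed
  then show ?case using Suc.prems by (auto intro!: differentiable_mult)
qed

lemma Ck_on_prod:
  fixes f :: "'i \<Rightarrow> 'a::euclidean_space \<Rightarrow> real"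
  assumes "open S" "\<And>i. i \<in> I \<Longrightarrow> Ck_on k S (f i)"
  shows "Ck_on k S (\<lambda>x. \<Prod>i\<in>I. f i x)"
  using assms(2)
  by (induction I rule: infinite_finite_induct)
    (auto simp: Ck_on_const intro!: Ck_on_mult[OF assms(1)])

text \<open>The successive derivatives are supplied as a sequence \<open>U\<close>, so the induction
  only shifts the index: a directional derivative of U n (L x + a) is a constant times U (Suc n) (L
  x + a).\<close>

lemma Ck_on_compose_affine:
  fixes U :: "nat \<Rightarrow> real \<Rightarrow> real" and L :: "'a::euclidean_space \<Rightarrow> real"
  assumes "\<And>n t. (U n has_real_derivative U (Suc n) t) (at t)" and "bounded_linear L"
  shows "Ck_on k UNIV (\<lambda>x. U n (L x + a))"
proof (induction k arbitrary: n)
  case 0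
  interpret bounded_linear L by fact
  have "continuous_on UNIV (U n)"
    using assms(1) by (auto intro!: continuous_at_imp_continuous_on DERIV_isCont)
  then show ?case
    using continuous_on_compose2[of UNIV "U n" UNIV "\<lambda>x. L x + a"] assms(2)
    by (simp add: continuous_intros linear_continuous_on)
next
  case (Suc k)
  have D: "((\<lambda>x. U n (L x + a)) has_derivative (\<lambda>v. L v * U (Suc n) (L x + a))) (at x)" for x
    using has_derivative_compose[of "\<lambda>x. L x + a" L x UNIV "U n" "(*) (U (Suc n) (L x + a))"]
      assms(1)[of n "L x + a", unfolded has_field_derivative_def]
      bounded_linear_imp_has_derivative[OF assms(2), THEN has_derivative_add_const]
    by (simp add: mult.commute[of _ "U (Suc n) (L x + a)"])
  have "Ck_on k UNIV (\<lambda>x. frechet_derivative (\<lambda>x. U n (L x + a)) (at x) v)" for v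
    by (subst frechet_derivative_at[OF D, symmetric]) (intro Ck_on_mult Ck_on_const Suc open_UNIV)
  then show ?case using D by (auto simp: differentiable_def)
qed

text \<open>The functions \<open>p (1/t) exp (-1/t)\<close>, extended by \<open>0\<close> to \<open>t \<le> 0\<close>, form a class closed under
  differentiation; for \<open>p = 1\<close> this is the standard smooth cutoff.\<close>

definition flat_exp :: "real poly \<Rightarrow> real \<Rightarrow> real" where
  "flat_exp p t = (if t > 0 then poly p (1/t) * exp (- (1/t)) else 0)"

lemma poly_exp_tendsto_0: "((\<lambda>s::real. poly p s * exp (- s)) \<longlongrightarrow> 0) at_top"
proof -
  have "((\<lambda>s::real. \<Sum>i\<le>degree p. coeff p i * (s ^ i / exp s)) \<longlongrightarrow> 0) at_top"
    by (intro tendsto_null_sum tendsto_mult_right_zero tendsto_power_div_exp_0)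
  then show ?thesis
    by (simp add: poly_altdef sum_distrib_right exp_minus divide_inverse mult.assoc)
qed

text \<open>The substitution s = 1/t turns the right-hand limit into the decay of a polynomial
  against exp(-s) at infinity.\<close>

lemma flat_exp_tendsto_0: "(flat_exp p \<longlongrightarrow> 0) (at 0)"
proof -
  have "((\<lambda>t. poly p (1/t) * exp (- (1/t))) \<longlongrightarrow> 0) (at_right 0)"
    using filterlim_compose[OF poly_exp_tendsto_0 filterlim_inverse_at_top_right]
    by (simp add: field_simps)
  then have "(flat_exp p \<longlongrightarrow> 0) (at_right 0)"
    by (rule Lim_transform_eventually)
      (auto simp: flat_exp_def eventually_at_right_less intro!: eventually_mono[OF eventually_at_right_less])
  moreover have "(flat_exp p \<longlongrightarrow> 0) (at_left 0)"
    by (rule Lim_transform_eventually[OF tendsto_const])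
      (auto simp: flat_exp_def eventually_at_filter)
  ultimately show ?thesis by (simp add: filterlim_split_at_real)
qed

text \<open>For t > 0 and s = 1/t, differentiating p(s) exp(-s) in t gives s^2 (p(s) - p'(s))
  exp(-s); the factor s^2 is the polynomial \<open>[:0,0,1:]\<close>.\<close>

lemma flat_exp_has_derivative:
  "(flat_exp p has_real_derivative flat_exp ([:0,0,1:] * (p - pderiv p)) t) (at t)"
proof -
  consider "t > 0" | "t < 0" | "t = 0" by linarith
  then show ?thesis
  proof cases
    case 1
    have "((\<lambda>t. poly p (1/t) * exp (- (1/t))) has_real_derivative
        flat_exp ([:0,0,1:] * (p - pderiv p)) t) (at t)"
      using 1 by (auto intro!: derivative_eq_intros poly_DERIV[THEN DERIV_chain2] simp: flat_exp_def field_simps power2_eq_square)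
    then show ?thesis
      by (rule has_field_derivative_transform_within_open[where S = "{0<..}"])
        (use 1 in \<open>auto simp: flat_exp_def\<close>)
  next
    case 2
    have "((\<lambda>t. 0) has_real_derivative flat_exp ([:0,0,1:] * (p - pderiv p)) t) (at t)"
      using 2 by (simp add: flat_exp_def)
    then show ?thesis
      by (rule has_field_derivative_transform_within_open[where S = "{..<0}"])
        (use 2 in \<open>auto simp: flat_exp_def\<close>)
  next
    case 3
    \<comment> \<open>At the origin, dividing by h multiplies the polynomial by s = 1/h, so the
      difference quotient is again in the class and tends to 0.\<close>
    have "(\<lambda>h. (flat_exp p (0 + h) - flat_exp p 0) / h) = flat_exp ([:0,1:] * p)"
      by (auto simp: fun_eq_iff flat_exp_def field_simps)
    then show ?thesis using flat_exp_tendsto_0[of "[:0,1:] * p"] 3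
      by (simp add: DERIV_def) (simp add: flat_exp_def)
  qed
qed

text \<open>One one-sided cutoff for each face of the box. The dilation by \<open>m\<close> steepens
  them, so that the limit for large \<open>m\<close> is the indicator of the open box.\<close>

definition bump :: "nat \<Rightarrow> real^'n \<Rightarrow> real^'n \<Rightarrow> real^'n \<Rightarrow> real" where
  "bump m a b x = (\<Prod>i\<in>UNIV. flat_exp 1 (real m * x $ i - real m * a $ i) *
     flat_exp 1 (real m * b $ i - real m * x $ i))"

lemma bump_smooth: "smooth_on_open UNIV (bump m a b)"
proof -
  \<comment> \<open>\<open>U n\<close> is the n-th derivative of the basic cutoff, produced by
    iterating the polynomial operator of \<open>flat_exp_has_derivative\<close>.\<close>
  define U where "U = (\<lambda>n. flat_exp (((\<lambda>p. [:0,0,1:] * (p - pderiv p)) ^^ n) 1))"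
  have U: "(U n has_real_derivative U (Suc n) t) (at t)" for n t
    unfolding U_def by (simp only: funpow.simps o_apply flat_exp_has_derivative)
  have U0: "flat_exp 1 = U 0" by (simp add: U_def)
  have "Ck_on k UNIV (bump m a b)" for k
  proof -
    have 1: "Ck_on k UNIV (\<lambda>x. flat_exp 1 (real m * x $ i - real m * a $ i))" for i
      using Ck_on_compose_affine[of U, OF U, of "\<lambda>x. real m * x $ i" k 0 "- (real m * a $ i)"]
      by (simp add: U0 bounded_linear_vec_nth bounded_linear_const_mult)
    have 2: "Ck_on k UNIV (\<lambda>x. flat_exp 1 (real m * b $ i - real m * x $ i))" for i
      using Ck_on_compose_affine[of U, OF U, of "\<lambda>x. - (real m * x $ i)" k 0 "real m * b $ i"]
      by (simp add: U0 bounded_linear_vec_nth bounded_linear_const_mult bounded_linear_minus)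
    show ?thesis unfolding bump_def
      by (intro Ck_on_prod Ck_on_mult 1 2 open_UNIV)
  qed
  then show ?thesis by (simp add: smooth_on_open_def)
qed

lemma bump_outside: "x \<notin> cbox a b \<Longrightarrow> bump m a b x = 0"
proof -
  assume "x \<notin> cbox a b"
  then obtain i where "x $ i \<le> a $ i \<or> b $ i \<le> x $ i"
    by (auto simp: mem_box_cart not_le intro: less_imp_le)
  then have "flat_exp 1 (real m * x $ i - real m * a $ i) * flat_exp 1 (real m * b $ i - real m * x $ i) = 0"
    using mult_left_mono[of "x $ i" "a $ i" "real m"] mult_left_mono[of "b $ i" "x $ i" "real m"]
    by (auto simp: flat_exp_def)
  then show ?thesis unfolding bump_def by (intro prod_zero) auto
qed

lemma bump_bounds: "0 \<le> bump m a b x" "bump m a b x \<le> 1"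
proof -
  have "0 \<le> flat_exp 1 t" "flat_exp 1 t \<le> 1" for t
    by (auto simp: flat_exp_def)
  then show "0 \<le> bump m a b x" "bump m a b x \<le> 1"
    unfolding bump_def by (auto intro!: prod_nonneg prod_le_1 mult_le_one)
qed

lemma bump_tendsto: "(\<lambda>m. bump m a b x) \<longlonglongrightarrow> indicator (box a b) x"
proof -
  have 1: "(\<lambda>m. flat_exp 1 (real m * s)) \<longlonglongrightarrow> 1" if "s > 0" for s
  proof -
    have "(\<lambda>m. exp (- ((1/s) * (1 / real m)))) \<longlonglongrightarrow> exp (- ((1/s) * 0))"
      by (intro tendsto_intros lim_1_over_n)
    then have "(\<lambda>m. exp (- ((1/s) * (1 / real m)))) \<longlonglongrightarrow> 1" by simp
    then show ?thesis
      by (rule Lim_transform_eventually)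
        (use that in \<open>auto simp: flat_exp_def field_simps intro!: eventually_mono[OF eventually_gt_at_top[of 0]]\<close>)
  qed
  have 0: "(\<lambda>m. flat_exp 1 (real m * s)) \<longlonglongrightarrow> 0" if "s \<le> 0" for s
  proof -
    have "flat_exp 1 (real m * s) = 0" for m
      using mult_nonneg_nonpos[of "real m" s] that by (simp add: flat_exp_def)
    then show ?thesis by simp
  qed
  have lim: "(\<lambda>m. flat_exp 1 (real m * s)) \<longlonglongrightarrow> (if s > 0 then 1 else 0)" for s
    using 1[of s] 0[of s] by (auto simp: not_less)
  have "(\<lambda>m. bump m a b x) \<longlonglongrightarrow> (\<Prod>i\<in>UNIV. (if x$i - a$i > 0 then 1 else 0) * (if b$i - x$i > 0 then 1 else 0))"
    unfolding bump_def right_diff_distrib[symmetric] by (intro tendsto_intros lim)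
  also have "(\<Prod>i\<in>UNIV. (if x$i - a$i > 0 then 1 else 0) * (if b$i - x$i > 0 then 1 else 0)) = (indicator (box a b) x :: real)"
    by (auto simp: indicator_def mem_box_cart intro!: prod_zero prod.neutral)
  finally show ?thesis .
qed

section \<open>The fundamental lemma of the calculus of variations\<close>

lemma test_function_bump:
  assumes "cbox a b \<subseteq> \<Omega>"
  shows "test_function \<Omega> (bump m a b)"
proof -
  have "{x. bump m a b x \<noteq> 0} \<subseteq> cbox a b"
    using bump_outside by blast
  then have "closure {x. bump m a b x \<noteq> 0} \<subseteq> cbox a b"
    by (rule closure_minimal) (rule closed_cbox)
  moreover from this have "compact (closure {x. bump m a b x \<noteq> 0})"
    using bounded_subset[OF bounded_cbox] by (simp add: compact_eq_bounded_closed)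
  ultimately show ?thesis
    using assms bump_smooth unfolding test_function_def by auto
qed

lemma smooth_on_open_continuous: "smooth_on_open S f \<Longrightarrow> continuous_on S f"
  by (metis Ck_on.simps(1) smooth_on_open_def)

lemma test_function_continuous: "test_function \<Omega> \<phi> \<Longrightarrow> continuous_on UNIV \<phi>"
  by (simp add: test_function_def smooth_on_open_continuous)

lemma test_function_eq_0: "test_function \<Omega> \<phi> \<Longrightarrow> x \<notin> \<Omega> \<Longrightarrow> \<phi> x = 0"
  unfolding test_function_def using closure_subset[of "{x. \<phi> x \<noteq> 0}"] by auto

lemma LINT_restrict_support:
  fixes f :: "'a::euclidean_space \<Rightarrow> 'b::{banach, second_countable_topology}"
  assumes "S \<in> sets lebesgue" "T \<in> sets lebesgue" "S \<subseteq> T" "\<And>x. x \<in> T - S \<Longrightarrow> f x = 0"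
  shows "(LINT x|lebesgue_on T. f x) = (LINT x|lebesgue_on S. f x)"
  by (subst (1 2) integral_restrict_space)
    (use assms in \<open>auto simp: indicator_def intro!: Bochner_Integration.integral_cong\<close>)

lemma AE_lebesgue_on_iff:
  assumes "S \<in> sets lebesgue"
  shows "(AE x in lebesgue_on S. P x) \<longleftrightarrow> negligible {x \<in> S. \<not> P x}"
proof -
  have "(AE x in lebesgue_on S. P x) \<longleftrightarrow> (AE x in lebesgue. x \<in> S \<longrightarrow> P x)"
    using assms by (subst AE_restrict_space_iff) auto
  also have "\<dots> \<longleftrightarrow> {x \<in> S. \<not> P x} \<in> null_sets lebesgue"
    by (simp add: completion.AE_iff_null_sets)
  finally show ?thesis by (simp add: negligible_iff_null_sets)
qed

text \<open>An open set is a countable union of closed boxes, and countably many null sets have a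
  null union. This reduces almost-everywhere claims to compact pieces.\<close>

lemma AE_on_cboxes_imp_AE:
  fixes P :: "'a::euclidean_space \<Rightarrow> bool"
  assumes "open \<Omega>" "\<And>a b. cbox a b \<subseteq> \<Omega> \<Longrightarrow> AE x in lebesgue_on (cbox a b). P x"
  shows "AE x in lebesgue_on \<Omega>. P x"
proof -
  obtain D where D: "countable D" "\<And>X. X \<in> D \<Longrightarrow> \<exists>a b. X = cbox a b" "\<Union>D = \<Omega>"
    using open_countable_Union_open_cbox[OF assms(1)] by metis
  have "{x \<in> \<Omega>. \<not> P x} = (\<Union>X\<in>D. {x \<in> X. \<not> P x})" using D(3) by auto
  also have "negligible \<dots>"
  proof (rule negligible_countable_Union[of "(\<lambda>X. {x \<in> X. \<not> P x}) ` D"])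
    show "countable ((\<lambda>X. {x \<in> X. \<not> P x}) ` D)" using D(1) by simp
    show "negligible t" if "t \<in> (\<lambda>X. {x \<in> X. \<not> P x}) ` D" for t
    proof -
      from that obtain X where X: "X \<in> D" "t = {x \<in> X. \<not> P x}" by auto
      obtain a b where ab: "X = cbox a b" using D(2)[OF X(1)] by blast
      have "cbox a b \<subseteq> \<Omega>" using D(3) X(1) ab by blast
      from assms(2)[OF this] show ?thesis by (subst (asm) AE_lebesgue_on_iff) (auto simp: X(2) ab)
    qed
  qed
  finally show ?thesis using assms(1) by (subst AE_lebesgue_on_iff) auto
qed

text \<open>Test with the bumps of the box and let them increase to its indicator; |g| dominates,
  and the boundary of the box is negligible.\<close>

lemma weak_zero_imp_integral_cbox_zero:
  fixes g :: "real^'n \<Rightarrow> real"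
  assumes "open \<Omega>" and g: "locally_L1 \<Omega> g"
    and zero: "\<And>\<phi>. test_function \<Omega> \<phi> \<Longrightarrow> (LINT x|lebesgue_on \<Omega>. \<phi> x * g x) = 0"
    and sub: "cbox a b \<subseteq> \<Omega>"
  shows "integral (cbox a b) g = 0"
proof -
  let ?M = "lebesgue_on (cbox a b)"
  have gi: "g absolutely_integrable_on cbox a b"
    using g sub by (auto simp: locally_L1_def)
  then have int: "integrable ?M g"
    by (simp add: integrable_restrict_space set_integrable_def)
  have [measurable]: "g \<in> borel_measurable ?M" using int by auto
  have m[measurable]: "bump m a b \<in> borel_measurable ?M" for m
    using test_function_continuous[OF test_function_bump[OF sub, of m]]
    by (intro continuous_imp_measurable_on_sets_lebesgue) (auto intro: continuous_on_subset)
  have "(\<lambda>m. LINT x|?M. bump m a b x * g x) \<longlonglongrightarrow> (LINT x|?M. indicator (box a b) x * g x)"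
  proof (rule integral_dominated_convergence[where w="\<lambda>x. \<bar>g x\<bar>"])
    show "(\<lambda>x. indicator (box a b) x * g x) \<in> borel_measurable ?M"
      by (intro borel_measurable_times borel_measurable_indicator) (use box_subset_cbox[of a b] in \<open>auto simp: sets_restrict_space intro!: image_eqI[of _ _ "box a b"]\<close>)
    show "AE x in ?M. (\<lambda>m. bump m a b x * g x) \<longlonglongrightarrow> indicator (box a b) x * g x"
      by (intro AE_I2 tendsto_intros bump_tendsto)
    show "AE x in ?M. norm (bump m a b x * g x) \<le> \<bar>g x\<bar>" for m
      using bump_bounds[of m a b] by (auto simp: abs_mult intro!: mult_left_le_one_le)
  qed (use int in auto)
  moreover have "(LINT x|?M. bump m a b x * g x) = 0" for m
  proof -
    have "(LINT x|lebesgue_on \<Omega>. bump m a b x * g x) = (LINT x|?M. bump m a b x * g x)"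
      using assms(1) sub bump_outside[of _ a b m] by (intro LINT_restrict_support) auto
    then show ?thesis using zero[OF test_function_bump[OF sub]] by simp
  qed
  ultimately have "(LINT x|?M. indicator (box a b) x * g x) = 0"
    by (simp add: LIMSEQ_const_iff)
  moreover have "(LINT x|?M. indicator (box a b) x * g x) = (LINT x|?M. g x)"
  proof (rule integral_cong_AE)
    show "(\<lambda>x. indicator (box a b) x * g x) \<in> borel_measurable ?M"
      by (intro borel_measurable_times borel_measurable_indicator) (use box_subset_cbox[of a b] in \<open>auto simp: sets_restrict_space intro!: image_eqI[of _ _ "box a b"]\<close>)
    have "{x \<in> cbox a b. indicator (box a b) x * g x \<noteq> g x} \<subseteq> cbox a b - box a b"
      by (auto simp: indicator_def)
    then show "AE x in ?M. indicator (box a b) x * g x = g x"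
      by (subst AE_lebesgue_on_iff) (auto intro: negligible_subset[OF negligible_frontier_interval])
  qed auto
  ultimately show ?thesis
    using lebesgue_integral_eq_integral[OF int] by simp
qed

text \<open>By Lebesgue differentiation, almost every value of \<open>g\<close> is the limit of
  averages over shrinking cubes with a corner at the point, and these averages all vanish.\<close>

lemma fundamental_lemma_cv:
  fixes g :: "real^'n \<Rightarrow> real"
  assumes "open \<Omega>" and g: "locally_L1 \<Omega> g"
    and zero: "\<And>\<phi>. test_function \<Omega> \<phi> \<Longrightarrow> (LINT x|lebesgue_on \<Omega>. \<phi> x * g x) = 0"
  shows "AE x in lebesgue_on \<Omega>. g x = 0"
proof (rule AE_on_cboxes_imp_AE[OF assms(1)])
  fix a b assume sub: "cbox a b \<subseteq> \<Omega>"
  \<comment> \<open>The differentiation theorem asks for integrability on every box, hence the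
    extension by zero.\<close>
  define f where "f = (\<lambda>x. if x \<in> cbox a b then g x else 0)"
  have gi: "g integrable_on cbox a b"
    using g sub set_lebesgue_integral_eq_integral(1)[of "cbox a b" g] by (simp add: locally_L1_def)
  have "f integrable_on cbox c d" for c d
  proof -
    have "f integrable_on UNIV" using gi by (simp add: f_def integrable_restrict_UNIV)
    then show ?thesis by (rule integrable_on_subcbox) auto
  qed
  then obtain N where N: "negligible N" and
    lim: "\<And>x e. \<lbrakk>x \<notin> N; 0 < e\<rbrakk> \<Longrightarrow> \<exists>d>0. \<forall>h. 0 < h \<and> h < d \<longrightarrow>
        norm (integral (cbox x (x + h *\<^sub>R One)) f /\<^sub>R h ^ DIM(real^'n) - f x) < e"
    using integrable_ccontinuous_explicit[of f] by blast
  have "g x = 0" if x: "x \<in> box a b" "x \<notin> N" for x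
  proof (rule ccontr)
    assume "g x \<noteq> 0"
    then obtain d where d: "d > 0" "\<And>h. 0 < h \<Longrightarrow> h < d \<Longrightarrow>
        norm (integral (cbox x (x + h *\<^sub>R One)) f /\<^sub>R h ^ DIM(real^'n) - f x) < \<bar>g x\<bar>"
      using lim[of x "\<bar>g x\<bar>"] x by auto
    have "((\<lambda>h. x + h *\<^sub>R One) \<longlongrightarrow> x + 0 *\<^sub>R One) (at_right 0)"
      by (intro tendsto_intros)
    then have "\<forall>\<^sub>F h in at_right 0. x + h *\<^sub>R One \<in> box a b"
      using x by (auto elim!: topological_tendstoD)
    moreover have "\<forall>\<^sub>F h in at_right 0. h < d \<and> (h::real) > 0"
      using d(1) eventually_at_right_less[of 0] eventually_at_right[of 0 d] by (auto simp: eventually_conj_iff)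
    ultimately obtain h where h: "x + h *\<^sub>R One \<in> box a b" "h < d" "h > 0"
      using eventually_happens[OF eventually_conj, of _ "at_right (0::real)"]
      by (metis (mono_tags, lifting) trivial_limit_at_right_real)
    have ss: "cbox x (x + h *\<^sub>R One) \<subseteq> cbox a b"
      using x h(1) by (auto simp: mem_box) (meson less_le order_trans)+
    have "integral (cbox x (x + h *\<^sub>R One)) f = integral (cbox x (x + h *\<^sub>R One)) g"
      using ss by (intro integral_cong) (auto simp: f_def)
    also have "\<dots> = 0"
      using ss sub by (intro weak_zero_imp_integral_cbox_zero[OF assms]) auto
    finally show False using d(2)[of h] h x box_subset_cbox[of a b] by (auto simp: f_def)
  qed
  then have "{x \<in> cbox a b. g x \<noteq> 0} \<subseteq> N \<union> (cbox a b - box a b)" by auto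
  then have "negligible {x \<in> cbox a b. g x \<noteq> 0}"
    using N negligible_frontier_interval negligible_Un negligible_subset by metis
  then show "AE x in lebesgue_on (cbox a b). g x = 0" by (subst AE_lebesgue_on_iff) auto
qed

section \<open>Continuity of translations in L^1\<close>

lemma lborel_translate:
  fixes f :: "'a::euclidean_space \<Rightarrow> real"
  assumes "integrable lborel f"
  shows "integrable lborel (\<lambda>x. f (x + c))" "(LINT x|lborel. f (x + c)) = (LINT x|lborel. f x)"
proof -
  have 1: "integrable (distr lborel borel ((+) c)) f" using assms by (simp add: lborel_distr_plus)
  then show "integrable lborel (\<lambda>x. f (x + c))"
    by (subst (asm) integrable_distr_eq) (use assms in \<open>auto simp: add.commute\<close>)
  have "(LINT x|distr lborel borel ((+) c). f x) = (LINT x|lborel. f (c + x))"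
    using assms by (intro integral_distr) auto
  then show "(LINT x|lborel. f (x + c)) = (LINT x|lborel. f x)"
    by (simp add: lborel_distr_plus add.commute)
qed

text \<open>Cutting \<open>f\<close> off in support (\<open>ct\<close>) and in value
  (\<open>cl\<close>) changes it little in L^1. With the level \<open>M\<close> fixed, the same
  cutoffs applied to continuous functions converging to \<open>f\<close> almost everywhere share the
  integrable majorant \<open>w\<close>, so dominated convergence applies a second time.\<close>

lemma L1_approx_continuous:
  fixes f :: "'a::euclidean_space \<Rightarrow> real"
  assumes "integrable lborel f" "\<epsilon> > 0"
  obtains k R B where "continuous_on UNIV k" "\<And>x. norm x \<ge> R \<Longrightarrow> k x = 0" "\<And>x. \<bar>k x\<bar> \<le> B"
    "integrable lborel k" "(LINT x|lborel. \<bar>f x - k x\<bar>) < \<epsilon>"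
proof -
  define ct where "ct = (\<lambda>(M::nat) (x::'a). max 0 (min 1 (real M + 1 - norm x)))"
  define cl where "cl = (\<lambda>(M::nat) (t::real). max (- real M) (min (real M) t))"
  have ct: "0 \<le> ct M x" "ct M x \<le> 1" "norm x \<ge> real M + 1 \<Longrightarrow> ct M x = 0" for M x
    by (auto simp: ct_def)
  have ctc: "continuous_on UNIV (ct M)" for M
    unfolding ct_def by (intro continuous_intros)
  have cl: "\<bar>cl M t\<bar> \<le> real M" "\<bar>cl M t\<bar> \<le> \<bar>t\<bar>" for M t by (auto simp: cl_def)
  have clc: "continuous_on UNIV (cl M)" for M unfolding cl_def by (intro continuous_intros)
  have [measurable]: "f \<in> borel_measurable borel" using assms by auto
  have [measurable]: "ct M \<in> borel_measurable borel" "cl M \<in> borel_measurable borel" for M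
    using ctc clc by (auto intro: borel_measurable_continuous_onI)
  define F where "F = (\<lambda>M x. ct M x * cl M (f x))"
  have [measurable]: "F M \<in> borel_measurable borel" for M unfolding F_def by measurable
  have Fb: "\<bar>F M x\<bar> \<le> \<bar>f x\<bar>" for M x
    using mult_mono[OF ct(2) cl(2)[of M "f x"], of M x] ct(1)[of M x] by (simp add: F_def abs_mult)
  have "(\<lambda>M. LINT x|lborel. \<bar>f x - F M x\<bar>) \<longlonglongrightarrow> integral\<^sup>L lborel (\<lambda>x::'a. 0::real)"
  proof (rule integral_dominated_convergence[where w="\<lambda>x::'a. 2 * \<bar>f x\<bar>"])
    show "AE x in lborel. (\<lambda>M. \<bar>f x - F M x\<bar>) \<longlonglongrightarrow> 0"
    proof (rule AE_I2)
      fix x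
      obtain n :: nat where n: "real n \<ge> norm x" "real n \<ge> \<bar>f x\<bar>" using real_arch_simple[of "max (norm x) \<bar>f x\<bar>"] by auto
      have "\<forall>\<^sub>F M in sequentially. \<bar>f x - F M x\<bar> = 0"
        using eventually_ge_at_top[of n] by eventually_elim (use n in \<open>auto simp: F_def ct_def cl_def\<close>)
      then show "(\<lambda>M. \<bar>f x - F M x\<bar>) \<longlonglongrightarrow> 0" by (simp add: tendsto_eventually)
    qed
    show "AE x in lborel. norm \<bar>f x - F M x\<bar> \<le> 2 * \<bar>f x\<bar>" for M
    proof (rule AE_I2)
      show "norm \<bar>f x - F M x\<bar> \<le> 2 * \<bar>f x\<bar>" for x
        using Fb[of M x] by simp
    qed
  qed (use assms in auto)
  then have "\<forall>\<^sub>F M in sequentially. (LINT x|lborel. \<bar>f x - F M x\<bar>) < \<epsilon> / 2"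
    using assms(2) order_tendstoD(2)[of _ 0 _ "\<epsilon>/2"] by simp
  then obtain M where M: "(LINT x|lborel. \<bar>f x - F M x\<bar>) < \<epsilon> / 2"
    by (auto simp: eventually_sequentially)
  \<comment> \<open>By definition \<open>measurable_on\<close> provides continuous functions
    converging to \<open>f\<close> off a negligible set.\<close>
  have "f measurable_on UNIV"
    by (intro lebesgue_measurable_imp_measurable_on_real measurable_completion) auto
  then obtain N g where N: "negligible N" and g: "\<And>n. continuous_on UNIV (g n)"
    "\<And>x. x \<notin> N \<Longrightarrow> (\<lambda>n. g n x) \<longlonglongrightarrow> f x" unfolding measurable_on_def by auto
  define K where "K = (\<lambda>n x. ct M x * cl M (g n x))"
  have Kc: "continuous_on UNIV (K n)" for n
    unfolding K_def by (intro continuous_intros ctc continuous_on_compose2[OF clc g(1)]) auto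
  then have [measurable]: "K n \<in> borel_measurable borel" for n
    by (intro borel_measurable_continuous_onI)
  define w where "w = (\<lambda>x::'a. real M * indicator (cball 0 (real M + 1)) x)"
  have w: "integrable lborel w"
    unfolding w_def by (intro integrable_mult_right) (auto intro!: integrable_real_indicator emeasure_lborel_cball_finite)
  have bound: "\<bar>ct M x * cl M t\<bar> \<le> w x" for x t
    using mult_mono[OF ct(2) cl(1)[of M t], of M x] ct[where M=M and x=x] 
    by (auto simp: w_def abs_mult indicator_def)
  have Ki: "integrable lborel (K n)" for n
  proof (rule Bochner_Integration.integrable_bound[OF w])
    show "AE x in lborel. norm (K n x) \<le> norm (w x)"
    proof (rule AE_I2)
      show "norm (K n x) \<le> norm (w x)" for x
        using bound[of x "g n x"] by (simp add: K_def)
    qed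
  qed simp
  have Fi: "integrable lborel (F M)"
    by (rule Bochner_Integration.integrable_bound[OF assms(1)]) (use Fb in auto)
  have "(\<lambda>n. LINT x|lborel. \<bar>F M x - K n x\<bar>) \<longlonglongrightarrow> integral\<^sup>L lborel (\<lambda>x::'a. 0::real)"
  proof (rule integral_dominated_convergence[where w="\<lambda>x. 2 * w x"])
    have "N \<in> null_sets lebesgue" using N by (simp add: negligible_iff_null_sets)
    then have "AE x in lebesgue. x \<notin> N" by (rule AE_not_in)
    then have "AE x in lborel. x \<notin> N" by (simp add: AE_completion_iff)
    then show "AE x in lborel. (\<lambda>n. \<bar>F M x - K n x\<bar>) \<longlonglongrightarrow> 0"
    proof (eventually_elim)
      case (elim x)
      have "isCont (cl M) (f x)" using clc by (simp add: continuous_on_eq_continuous_at)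
      then have "(\<lambda>n. cl M (g n x)) \<longlonglongrightarrow> cl M (f x)"
        using g(2)[OF elim] by (rule isCont_tendsto_compose)
      then have "(\<lambda>n. \<bar>F M x - K n x\<bar>) \<longlonglongrightarrow> \<bar>F M x - ct M x * cl M (f x)\<bar>"
        unfolding K_def by (intro tendsto_intros)
      then show ?case by (simp add: F_def)
    qed
    show "AE x in lborel. norm \<bar>F M x - K n x\<bar> \<le> 2 * w x" for n
    proof (rule AE_I2)
      show "norm \<bar>F M x - K n x\<bar> \<le> 2 * w x" for x
        using bound[of x "f x"] bound[of x "g n x"] by (simp add: F_def K_def)
    qed
  qed (use w in auto)
  then have "\<forall>\<^sub>F n in sequentially. (LINT x|lborel. \<bar>F M x - K n x\<bar>) < \<epsilon> / 2"
    using assms(2) order_tendstoD(2)[of _ 0 _ "\<epsilon>/2"] by simp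
  then obtain n where n: "(LINT x|lborel. \<bar>F M x - K n x\<bar>) < \<epsilon> / 2"
    by (auto simp: eventually_sequentially)
  have "(LINT x|lborel. \<bar>f x - K n x\<bar>) \<le> (LINT x|lborel. \<bar>f x - F M x\<bar> + \<bar>F M x - K n x\<bar>)"
    using assms Fi Ki by (intro integral_mono) auto
  also have "\<dots> = (LINT x|lborel. \<bar>f x - F M x\<bar>) + (LINT x|lborel. \<bar>F M x - K n x\<bar>)"
    using assms Fi Ki by (intro Bochner_Integration.integral_add) auto
  also have "\<dots> < \<epsilon>" using M n by simp
  finally have "(LINT x|lborel. \<bar>f x - K n x\<bar>) < \<epsilon>" .
  moreover have "\<bar>K n x\<bar> \<le> real M" for x
    using bound[of x "g n x"] by (cases "norm x \<le> real M + 1") (auto simp: K_def w_def indicator_def split: if_splits)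
  moreover have "norm x \<ge> real M + 1 \<Longrightarrow> K n x = 0" for x using ct(3) by (simp add: K_def)
  ultimately show ?thesis by (intro that[of "K n" "real M + 1" "real M"] Kc Ki) auto
qed

text \<open>A three-term estimate: two terms compare \<open>f\<close> with a continuous function of
  bounded support and are equal by translation invariance, the third is the claim for that
  function.\<close>

lemma L1_translation_tendsto:
  fixes f :: "'a::euclidean_space \<Rightarrow> real"
  assumes "integrable lborel f"
  shows "((\<lambda>c. LINT x|lborel. \<bar>f (x + c) - f x\<bar>) \<longlongrightarrow> 0) (at 0)"
proof (rule tendstoI)
  fix \<epsilon> :: real assume "\<epsilon> > 0"
  then obtain k R B where k: "continuous_on UNIV k" "\<And>x. norm x \<ge> R \<Longrightarrow> k x = 0" "\<And>x. \<bar>k x\<bar> \<le> B"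
    "integrable lborel k" "(LINT x|lborel. \<bar>f x - k x\<bar>) < \<epsilon> / 3"
    by (elim L1_approx_continuous[OF assms, of "\<epsilon>/3", OF divide_pos_pos]) auto
  define w where "w = (\<lambda>x::'a. 2 * B * indicator (cball 0 (R + 1)) x)"
  have w: "integrable lborel w"
    unfolding w_def by (intro integrable_mult_right) (auto intro!: integrable_real_indicator emeasure_lborel_cball_finite)
  have B: "B \<ge> 0" using k(3)[of 0] by simp
  have [measurable]: "k \<in> borel_measurable borel" using k(1) by (rule borel_measurable_continuous_onI)
  have "((\<lambda>c. LINT x|lborel. \<bar>k (x + c) - k x\<bar>) \<longlongrightarrow> integral\<^sup>L lborel (\<lambda>x::'a. 0::real)) (at 0)"
    unfolding tendsto_at_iff_sequentially
  proof (intro allI impI)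
    fix c :: "nat \<Rightarrow> 'a" assume "\<forall>i. c i \<in> UNIV - {0}" and c: "c \<longlonglongrightarrow> 0"
    \<comment> \<open>Only a tail is dominated: shifts shorter than 1 keep the support of each
      translate inside the ball of radius \<open>R + 1\<close> that carries
      \<open>w\<close>.\<close>
    obtain n0 where n0: "\<And>n. n \<ge> n0 \<Longrightarrow> norm (c n) < 1"
      using c[unfolded LIMSEQ_iff, rule_format, of 1] by auto
    have "(\<lambda>n. LINT x|lborel. \<bar>k (x + c (n + n0)) - k x\<bar>) \<longlonglongrightarrow> integral\<^sup>L lborel (\<lambda>x::'a. 0::real)"
    proof (rule integral_dominated_convergence[where w="w"])
      show "AE x in lborel. (\<lambda>n. \<bar>k (x + c (n + n0)) - k x\<bar>) \<longlonglongrightarrow> 0"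
      proof (rule AE_I2)
        fix x
        have "isCont k (x + 0)" using k(1) by (simp add: continuous_on_eq_continuous_at)
        moreover have "(\<lambda>n. x + c (n + n0)) \<longlonglongrightarrow> x + 0"
          by (intro tendsto_intros LIMSEQ_ignore_initial_segment c)
        ultimately have "(\<lambda>n. k (x + c (n + n0))) \<longlonglongrightarrow> k (x + 0)"
          by (rule isCont_tendsto_compose)
        from tendsto_rabs[OF tendsto_diff[OF this tendsto_const[of "k x"]]]
        show "(\<lambda>n. \<bar>k (x + c (n + n0)) - k x\<bar>) \<longlonglongrightarrow> 0" by simp
      qed
      show "AE x in lborel. norm \<bar>k (x + c (n + n0)) - k x\<bar> \<le> w x" for n
      proof (rule AE_I2)
        fix x
        have "norm (c (n + n0)) < 1" using n0 by simp
        then have "norm x > R + 1 \<Longrightarrow> norm (x + c (n + n0)) \<ge> R"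
          using norm_diff_ineq[of x "c (n + n0)"] by linarith
        then show "norm \<bar>k (x + c (n + n0)) - k x\<bar> \<le> w x"
          using k(2)[of x] k(2)[of "x + c (n + n0)"] k(3)[of x] k(3)[of "x + c (n + n0)"]
          by (cases "norm x > R + 1") (auto simp: w_def indicator_def)
      qed
    qed (use w in auto)
    then show "((\<lambda>c. LINT x|lborel. \<bar>k (x + c) - k x\<bar>) \<circ> c) \<longlonglongrightarrow> integral\<^sup>L lborel (\<lambda>x::'a. 0::real)"
      unfolding o_def by (rule LIMSEQ_offset)
  qed
  then have "\<forall>\<^sub>F c in at 0. (LINT x|lborel. \<bar>k (x + c) - k x\<bar>) < \<epsilon> / 3"
    using order_tendstoD(2)[of _ 0 _ "\<epsilon>/3"] \<open>\<epsilon> > 0\<close> by simp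
  then show "\<forall>\<^sub>F c in at 0. dist (LINT x|lborel. \<bar>f (x + c) - f x\<bar>) 0 < \<epsilon>"
  proof eventually_elim
    case (elim c)
    have i: "integrable lborel (\<lambda>x. f (x + c))" "integrable lborel (\<lambda>x. k (x + c))"
      using lborel_translate(1) assms k(4) by blast+
    have "(LINT x|lborel. \<bar>f (x + c) - f x\<bar>) \<le>
        (LINT x|lborel. (\<bar>f (x + c) - k (x + c)\<bar> + \<bar>f x - k x\<bar>) + \<bar>k (x + c) - k x\<bar>)"
      using i assms k(4) by (intro integral_mono) auto
    also have "\<dots> = (LINT x|lborel. \<bar>f (x + c) - k (x + c)\<bar>) + (LINT x|lborel. \<bar>f x - k x\<bar>)
         + (LINT x|lborel. \<bar>k (x + c) - k x\<bar>)"
      using i assms k(4) by (subst Bochner_Integration.integral_add, (auto)[2])+ simp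
    also have "(LINT x|lborel. \<bar>f (x + c) - k (x + c)\<bar>) = (LINT x|lborel. \<bar>f x - k x\<bar>)"
      using lborel_translate(2)[of "\<lambda>x. \<bar>f x - k x\<bar>" c] assms k(4) by auto
    finally have "(LINT x|lborel. \<bar>f (x + c) - f x\<bar>) < \<epsilon>" using elim k(5) by linarith
    moreover have "(LINT x|lborel. \<bar>f (x + c) - f x\<bar>) \<ge> 0" by simp
    ultimately show ?case by simp
  qed
qed

section \<open>The product rule for weak derivatives\<close>

lemma test_function_Ck: "test_function V \<phi> \<Longrightarrow> Ck_on k UNIV \<phi>"
  by (simp add: test_function_def smooth_on_open_def)

lemma test_function_differentiable: "test_function V \<phi> \<Longrightarrow> \<phi> differentiable (at x)"
  using test_function_Ck[of V \<phi> "Suc 0"] by simp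

lemma test_function_mono: "test_function V \<phi> \<Longrightarrow> V \<subseteq> W \<Longrightarrow> test_function W \<phi>"
  by (auto simp: test_function_def)

lemma partial_deriv_eq_0_outside:
  assumes "x \<notin> closure {x. \<phi> x \<noteq> 0}"
  shows "frechet_derivative \<phi> (at x) v = 0"
proof -
  have "(\<phi> has_derivative (\<lambda>v. 0)) (at x)"
    by (rule has_derivative_transform_within_open[of "\<lambda>x. 0" _ _ _ "- closure {x. \<phi> x \<noteq> 0}"])
      (use assms closure_subset[of "{x. \<phi> x \<noteq> 0}"] in auto)
  then show ?thesis by (metis frechet_derivative_at)
qed

lemma test_function_partial_deriv:
  assumes "test_function V \<phi>" shows "test_function V (partial_deriv i \<phi>)"
proof -
  have "Ck_on k UNIV (partial_deriv i \<phi>)" for k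
    using test_function_Ck[OF assms, of "Suc k"] unfolding partial_deriv_def by auto
  moreover have "closure {x. partial_deriv i \<phi> x \<noteq> 0} \<subseteq> closure {x. \<phi> x \<noteq> 0}"
    by (rule closure_minimal) (use partial_deriv_eq_0_outside in \<open>auto simp: partial_deriv_def\<close>)
  ultimately show ?thesis
    using assms compact_Int_closed[of "closure {x. \<phi> x \<noteq> 0}" "closure {x. partial_deriv i \<phi> x \<noteq> 0}"]
    by (auto simp: test_function_def smooth_on_open_def Int_absorb1)
qed

lemma Ck_on_translate:
  "Ck_on k UNIV \<phi> \<Longrightarrow> Ck_on k UNIV (\<lambda>x. \<phi> (x - c))"
  "\<phi> differentiable (at (x - c)) \<Longrightarrow>
    frechet_derivative (\<lambda>x. \<phi> (x - c)) (at x) = frechet_derivative \<phi> (at (x - c))"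
proof -
  have D: "((\<lambda>x. \<phi> (x - c)) has_derivative frechet_derivative \<phi> (at (x - c))) (at x)"
    if "\<phi> differentiable (at (x - c))" for \<phi> :: "'a \<Rightarrow> 'b" and x
    by (rule has_derivative_compose[of "\<lambda>x. x - c" "\<lambda>v. v" x UNIV \<phi>, OF _ frechet_derivative_works[THEN iffD1, OF that]])
      (auto intro!: derivative_eq_intros)
  show "\<phi> differentiable (at (x - c)) \<Longrightarrow>
    frechet_derivative (\<lambda>x. \<phi> (x - c)) (at x) = frechet_derivative \<phi> (at (x - c))"
    using D frechet_derivative_at by metis
  show "Ck_on k UNIV \<phi> \<Longrightarrow> Ck_on k UNIV (\<lambda>x. \<phi> (x - c))"
  proof (induction k arbitrary: \<phi>)
    case 0
    then show ?case by (auto intro!: continuous_intros elim!: continuous_on_compose2)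
  next
    case (Suc k)
    have "frechet_derivative (\<lambda>x. \<phi> (x - c)) (at x) = frechet_derivative \<phi> (at (x - c))" for x
      using D[of \<phi> x] Suc.prems frechet_derivative_at by (metis Ck_on.simps(2) UNIV_I)
    moreover have "(\<lambda>x. \<phi> (x - c)) differentiable (at x)" for x
      using D[of \<phi> x] Suc.prems by (auto simp: differentiable_def)
    moreover have "Ck_on k UNIV (\<lambda>x. frechet_derivative \<phi> (at (x - c)) v)" for v
      by (rule Suc.IH) (use Suc.prems in simp)
    ultimately show ?case by simp
  qed
qed

lemma partial_deriv_translate:
  assumes "test_function V \<phi>"
  shows "partial_deriv i (\<lambda>x. \<phi> (x - c)) x = partial_deriv i \<phi> (x - c)"
  unfolding partial_deriv_def
  using Ck_on_translate(2)[OF test_function_differentiable[OF assms]] by simp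

lemma test_function_translate:
  assumes "test_function V \<phi>" and sub: "\<And>x. x \<in> V \<Longrightarrow> x + c \<in> W"
  shows "test_function W (\<lambda>x. \<phi> (x - c))"
proof -
  have eq: "{x. \<phi> (x - c) \<noteq> 0} = (\<lambda>x. c + x) ` {x. \<phi> x \<noteq> 0}"
    by (auto intro!: image_eqI[of _ _ "x - c" for x])
  have cl: "closure {x. \<phi> (x - c) \<noteq> 0} = (\<lambda>x. c + x) ` closure {x. \<phi> x \<noteq> 0}"
    unfolding eq by (rule closure_translation)
  have K: "compact (closure {x. \<phi> x \<noteq> 0})" "closure {x. \<phi> x \<noteq> 0} \<subseteq> V"
    using assms by (auto simp: test_function_def)
  have "smooth_on_open UNIV (\<lambda>x. \<phi> (x - c))"
    using Ck_on_translate(1)[OF test_function_Ck[OF assms(1)]] by (simp add: smooth_on_open_def)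
  moreover have "(\<lambda>x. c + x) ` closure {x. \<phi> x \<noteq> 0} \<subseteq> W"
    using K(2) sub by (auto simp: add.commute[of c])
  ultimately show ?thesis
    unfolding test_function_def cl using compact_translation[OF K(1), of c] by blast
qed

lemma test_function_bounded:
  fixes \<phi> :: "real^'n \<Rightarrow> real"
  assumes "test_function V \<phi>"
  obtains B where "B > 0" "\<And>x. \<bar>\<phi> x\<bar> \<le> B"
proof -
  let ?K = "closure {x. \<phi> x \<noteq> 0}"
  have "bounded (\<phi> ` ?K)"
    using assms test_function_continuous[OF assms]
    by (intro compact_imp_bounded compact_continuous_image) (auto simp: test_function_def intro: continuous_on_subset)
  then obtain B where B: "B > 0" "\<And>x. x \<in> ?K \<Longrightarrow> \<bar>\<phi> x\<bar> \<le> B"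
    by (auto simp: bounded_pos)
  have "\<bar>\<phi> x\<bar> \<le> B" for x
    using B closure_subset[of "{x. \<phi> x \<noteq> 0}"] by (cases "\<phi> x = 0") auto
  then show ?thesis using B(1) that by auto
qed

lemma test_function_borel [measurable_dest]:
  "test_function V \<phi> \<Longrightarrow> \<phi> \<in> borel_measurable borel"
  by (simp add: test_function_continuous borel_measurable_continuous_onI)

lemma integrable_bounded_times:
  fixes f :: "'a \<Rightarrow> real"
  assumes "integrable M f" "\<psi> \<in> borel_measurable M" "\<And>x. \<bar>\<psi> x\<bar> \<le> B"
  shows "integrable M (\<lambda>x. \<psi> x * f x)"
proof (rule Bochner_Integration.integrable_bound[of _ "\<lambda>x. B * f x"])
  show "AE x in M. norm (\<psi> x * f x) \<le> norm (B * f x)"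
  proof (rule AE_I2)
    fix x
    have "0 \<le> B" using assms(3)[of x] by linarith
    then show "norm (\<psi> x * f x) \<le> norm (B * f x)"
      using assms(3)[of x] by (simp add: abs_mult mult_right_mono)
  qed
qed (use assms in auto)

lemma test_function_integrable:
  fixes \<phi> :: "real^'n \<Rightarrow> real"
  assumes "test_function V \<phi>"
  shows "integrable lborel \<phi>"
proof -
  let ?K = "closure {x. \<phi> x \<noteq> 0}"
  have "emeasure lborel ?K < \<infinity>"
    using assms by (intro emeasure_compact_finite) (simp add: test_function_def)
  then have "integrable lborel (indicat_real ?K)"
    by (intro integrable_real_indicator) auto
  moreover obtain B where "\<And>x. \<bar>\<phi> x\<bar> \<le> B" using test_function_bounded[OF assms] by blast
  ultimately have "integrable lborel (\<lambda>x. \<phi> x * indicat_real ?K x)"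
    using test_function_borel[OF assms] by (intro integrable_bounded_times) auto
  moreover have "\<phi> x * indicat_real ?K x = \<phi> x" for x
    using closure_subset[of "{x. \<phi> x \<noteq> 0}"] by (auto simp: indicator_def)
  ultimately show ?thesis by simp
qed

lemma has_line_derivative:
  assumes "f differentiable (at (x + t *\<^sub>R axis i 1))"
  shows "((\<lambda>t. f (x + t *\<^sub>R axis i 1)) has_real_derivative
    partial_deriv i f (x + t *\<^sub>R axis i 1)) (at t)"
proof -
  let ?e = "axis i 1"
  have D: "(f has_derivative frechet_derivative f (at (x + t *\<^sub>R ?e))) (at (x + t *\<^sub>R ?e))"
    using assms frechet_derivative_works by blast
  then interpret bounded_linear "frechet_derivative f (at (x + t *\<^sub>R ?e))"
    by (rule has_derivative_bounded_linear)
  have "((\<lambda>t. f (x + t *\<^sub>R ?e)) has_derivative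
      (\<lambda>s. frechet_derivative f (at (x + t *\<^sub>R ?e)) (s *\<^sub>R ?e))) (at t)"
    by (rule has_derivative_compose[of "\<lambda>t. x + t *\<^sub>R ?e" "\<lambda>s. s *\<^sub>R ?e" t UNIV f, OF _ D])
      (auto intro!: derivative_eq_intros)
  then show ?thesis
    by (simp add: has_field_derivative_def partial_deriv_def scaleR mult_commute_abs)
qed

lemma test_function_line_derivative:
  assumes "test_function V \<phi>"
  shows "((\<lambda>t. \<phi> (x + t *\<^sub>R axis i 1)) has_real_derivative
    partial_deriv i \<phi> (x + t *\<^sub>R axis i 1)) (at t)"
  by (rule has_line_derivative[OF test_function_differentiable[OF assms]])

text \<open>\<open>P\<close> integrates \<open>p\<close> along the segment from x to x + he; it is
  the candidate for the increment of a function with weak derivative \<open>p\<close>. Integrability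
  on the product holds because translation invariance bounds the inner L^1 norm by the same constant
  for every s in the interval.\<close>

lemma translate_Fubini:
  fixes p \<psi> :: "'a::euclidean_space \<Rightarrow> real" and e :: 'a and h :: real
  assumes p: "integrable lborel p" and \<psi>[measurable]: "\<psi> \<in> borel_measurable borel"
    and B: "\<And>x. \<bar>\<psi> x\<bar> \<le> B"
  defines "P \<equiv> \<lambda>x. LINT s|lborel. indicat_real {0..h} s * p (x + s *\<^sub>R e)"
  shows "integrable lborel (\<lambda>x. \<psi> x * P x)"
    and "integrable lborel (\<lambda>s. indicat_real {0..h} s * (LINT x|lborel. \<psi> x * p (x + s *\<^sub>R e)))"
    and "(LINT x|lborel. \<psi> x * P x) =
      (LINT s|lborel. indicat_real {0..h} s * (LINT x|lborel. \<psi> x * p (x + s *\<^sub>R e)))"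
proof -
  have [measurable]: "p \<in> borel_measurable borel" using p by auto
  define F where "F = (\<lambda>s x. indicat_real {0..h} s * (\<psi> x * p (x + s *\<^sub>R e)))"
  have Fs: "integrable lborel (F s)" for s
    unfolding F_def by (intro integrable_mult_right integrable_bounded_times[OF lborel_translate(1)[OF p] _ B]) auto
  have bound: "(LINT x|lborel. \<bar>F s x\<bar>) \<le> indicat_real {0..h} s * (B * (LINT x|lborel. \<bar>p x\<bar>))" for s
  proof -
    have "(LINT x|lborel. \<bar>F s x\<bar>) \<le> (LINT x|lborel. indicat_real {0..h} s * (B * \<bar>p (x + s *\<^sub>R e)\<bar>))"
    proof (rule integral_mono)
      show "integrable lborel (\<lambda>x. \<bar>F s x\<bar>)" using Fs by auto
      show "integrable lborel (\<lambda>x. indicat_real {0..h} s * (B * \<bar>p (x + s *\<^sub>R e)\<bar>))"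
        by (intro integrable_mult_right integrable_abs lborel_translate(1)[OF p])
      show "\<bar>F s x\<bar> \<le> indicat_real {0..h} s * (B * \<bar>p (x + s *\<^sub>R e)\<bar>)" for x
        using B[of x] by (auto simp: F_def abs_mult intro!: mult_left_mono mult_right_mono)
    qed
    also have "\<dots> = indicat_real {0..h} s * (B * (LINT x|lborel. \<bar>p x\<bar>))"
      using lborel_translate(2)[OF integrable_abs[OF p]] by simp
    finally show ?thesis .
  qed
  have int: "integrable (lborel \<Otimes>\<^sub>M lborel) (case_prod F)"
  proof (rule lborel_pair.Fubini_integrable)
    show "case_prod F \<in> borel_measurable (lborel \<Otimes>\<^sub>M lborel)"
      unfolding F_def by measurable
    have m: "(\<lambda>s. LINT x|lborel. norm (case_prod F (s, x))) \<in> borel_measurable lborel"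
      unfolding F_def by measurable
    have "integrable lborel (\<lambda>s. indicat_real {0..h} s * (B * (LINT x|lborel. \<bar>p x\<bar>)))"
      by (intro integrable_mult_left) (auto intro!: integrable_real_indicator simp: emeasure_lborel_Icc_eq)
    then show "integrable lborel (\<lambda>s. LINT x|lborel. norm (case_prod F (s, x)))"
      by (rule Bochner_Integration.integrable_bound[OF _ m]) (use bound in \<open>auto intro!: AE_I2 order_trans[OF _ abs_ge_self]\<close>)
    show "AE s in lborel. integrable lborel (\<lambda>x. case_prod F (s, x))"
      using Fs by simp
  qed
  have 1: "(LINT x|lborel. F s x) = indicat_real {0..h} s * (LINT x|lborel. \<psi> x * p (x + s *\<^sub>R e))" for s
    by (simp add: F_def)
  have 2: "(LINT s|lborel. F s x) = \<psi> x * P x" for x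
  proof -
    have "F s x = \<psi> x * (indicat_real {0..h} s * p (x + s *\<^sub>R e))" for s by (simp add: F_def mult_ac)
    then show ?thesis by (simp add: P_def)
  qed
  show "integrable lborel (\<lambda>x. \<psi> x * P x)"
    using lborel_pair.integrable_snd[OF int] by (simp add: 2)
  show "integrable lborel (\<lambda>s. indicat_real {0..h} s * (LINT x|lborel. \<psi> x * p (x + s *\<^sub>R e)))"
    using lborel_pair.integrable_fst[OF int] by (simp add: 1)
  show "(LINT x|lborel. \<psi> x * P x) =
      (LINT s|lborel. indicat_real {0..h} s * (LINT x|lborel. \<psi> x * p (x + s *\<^sub>R e)))"
    using lborel_pair.Fubini_integral[OF int] by (simp add: 1 2)
qed

text \<open>Weak derivatives of functions integrable over the whole space, tested on \<open>V\<close> only: a locally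
  integrable function on \<open>\<Omega>\<close> is replaced by a Borel function that agrees with it near \<open>V\<close>.\<close>

definition lweak :: "(real^'n) set \<Rightarrow> 'n \<Rightarrow> (real^'n \<Rightarrow> real) \<Rightarrow> (real^'n \<Rightarrow> real) \<Rightarrow> bool" where
  "lweak V i f p \<longleftrightarrow> (\<forall>\<phi>. test_function V \<phi> \<longrightarrow>
     (LINT x|lborel. partial_deriv i \<phi> x * f x) = - (LINT x|lborel. \<phi> x * p x))"

lemma integrable_lborel_imp_locally_L1:
  fixes g :: "real^'n \<Rightarrow> real"
  assumes "integrable lborel g" shows "locally_L1 V g"
proof -
  have "integrable lebesgue g" using assms by (simp add: integrable_completion)
  then have "g absolutely_integrable_on UNIV" by (simp add: set_integrable_def)
  then have "g absolutely_integrable_on K" if "compact K" for K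
    by (rule set_integrable_subset) (use lmeasurable_compact[OF that] in \<open>auto simp: fmeasurableD\<close>)
  then show ?thesis by (simp add: locally_L1_def)
qed

lemma LINT_lborel_eq_restrict:
  fixes f :: "real^'n \<Rightarrow> real"
  assumes "f \<in> borel_measurable borel" "S \<in> sets lebesgue" "\<And>x. x \<notin> S \<Longrightarrow> f x = 0"
  shows "(LINT x|lborel. f x) = (LINT x|lebesgue_on S. f x)"
proof -
  have "(LINT x|lborel. f x) = (LINT x|lebesgue. f x)"
    using assms(1) by (simp add: integral_completion)
  also have "\<dots> = (LINT x|lebesgue_on S. f x)"
    using LINT_restrict_support[of S UNIV f] assms by (simp add: lebesgue_on_UNIV_eq)
  finally show ?thesis .
qed

lemma lborel_fundamental_lemma:
  fixes g :: "real^'n \<Rightarrow> real"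
  assumes "open V" "integrable lborel g"
    and "\<And>\<phi>. test_function V \<phi> \<Longrightarrow> (LINT x|lborel. \<phi> x * g x) = 0"
  shows "AE x in lborel. x \<in> V \<longrightarrow> g x = 0"
proof -
  have "AE x in lebesgue_on V. g x = 0"
  proof (rule fundamental_lemma_cv[OF assms(1) integrable_lborel_imp_locally_L1[OF assms(2)]])
    fix \<phi> assume \<phi>: "test_function V \<phi>"
    have "(LINT x|lborel. \<phi> x * g x) = (LINT x|lebesgue_on V. \<phi> x * g x)"
      using assms(1,2) test_function_borel[OF \<phi>] test_function_eq_0[OF \<phi>]
      by (intro LINT_lborel_eq_restrict) auto
    with assms(3)[OF \<phi>] show "(LINT x|lebesgue_on V. \<phi> x * g x) = 0" by simp
  qed
  then have "AE x in lebesgue. x \<in> V \<longrightarrow> g x = 0"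
    using assms(1) by (subst (asm) AE_restrict_space_iff) auto
  then show ?thesis by (simp add: AE_completion_iff)
qed

text \<open>The fundamental theorem of calculus in weak form. Tested against \<psi>, the increment
  moves onto \<psi>, where the classical theorem holds; Fubini, the definition of the weak
  derivative and Fubini again bring \<open>p\<close> back.\<close>

lemma lweak_difference_eq_average:
  fixes f p :: "real^'n \<Rightarrow> real"
  assumes "open V'" and fp: "integrable lborel f" "integrable lborel p" and fM: "\<And>x. \<bar>f x\<bar> \<le> M"
    and w: "lweak V i f p" and "0 \<le> h"
    and sub: "\<And>x s. x \<in> V' \<Longrightarrow> 0 \<le> s \<Longrightarrow> s \<le> h \<Longrightarrow> x + s *\<^sub>R axis i 1 \<in> V"
  shows "AE x in lborel. x \<in> V' \<longrightarrow>
    f (x + h *\<^sub>R axis i 1) - f x = (LINT s|lborel. indicat_real {0..h} s * p (x + s *\<^sub>R axis i 1))"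
proof -
  let ?e = "axis i 1"
  define P where "P = (\<lambda>x. LINT s|lborel. indicat_real {0..h} s * p (x + s *\<^sub>R ?e))"
  have [measurable]: "f \<in> borel_measurable borel" "p \<in> borel_measurable borel" using fp by auto
  have P: "integrable lborel P"
    using translate_Fubini(1)[OF fp(2), of "\<lambda>_. 1" 1 h ?e] by (simp add: P_def)
  have fh: "integrable lborel (\<lambda>x. f (x + h *\<^sub>R ?e))" by (rule lborel_translate(1)[OF fp(1)])
  have "AE x in lborel. x \<in> V' \<longrightarrow> f (x + h *\<^sub>R ?e) - f x - P x = 0"
  proof (rule lborel_fundamental_lemma[OF assms(1)])
    show "integrable lborel (\<lambda>x. f (x + h *\<^sub>R ?e) - f x - P x)" using P fh fp by auto
    fix \<psi> assume \<psi>: "test_function V' \<psi>"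
    note [measurable] = test_function_borel[OF \<psi>]
    note \<psi>' = test_function_partial_deriv[OF \<psi>, of i]
    obtain B where B: "\<And>x. \<bar>\<psi> x\<bar> \<le> B" using test_function_bounded[OF \<psi>] by blast
    have i1: "integrable lborel (\<lambda>x. \<psi> x * f x)" "integrable lborel (\<lambda>x. \<psi> x * P x)"
      "integrable lborel (\<lambda>x. \<psi> x * f (x + h *\<^sub>R ?e))"
      by (rule integrable_bounded_times[OF fp(1) _ B], simp, rule integrable_bounded_times[OF P _ B], simp,
        rule integrable_bounded_times[OF fh _ B], simp)
    have i2: "integrable lborel (\<lambda>x. \<psi> (x - h *\<^sub>R ?e) * f x)"
      by (rule integrable_bounded_times[OF fp(1) _ B]) measurable
    have ftc: "\<psi> (x - h *\<^sub>R ?e) - \<psi> x = - (LINT s|lborel. indicat_real {0..h} s * partial_deriv i \<psi> (x + s *\<^sub>R (- ?e)))" for x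
    proof -
      have "(LINT s|lborel. - partial_deriv i \<psi> (x + (- s) *\<^sub>R ?e) * indicat_real {0..h} s) =
          \<psi> (x + (- h) *\<^sub>R ?e) - \<psi> (x + (- 0) *\<^sub>R ?e)"
      proof (rule integral_FTC_Icc_real[OF \<open>0 \<le> h\<close>])
        fix s :: real
        show "((\<lambda>s. \<psi> (x + (- s) *\<^sub>R ?e)) has_real_derivative - partial_deriv i \<psi> (x + (- s) *\<^sub>R ?e)) (at s)"
          using DERIV_chain2[OF test_function_line_derivative[OF \<psi>, of x i "- s"] DERIV_minus[OF DERIV_ident]] by simp
        have 1: "isCont (partial_deriv i \<psi>) (x + (- s) *\<^sub>R ?e)"
          using test_function_continuous[OF \<psi>'] by (simp add: continuous_on_eq_continuous_at)
        have 2: "isCont (\<lambda>s. x + (- s) *\<^sub>R ?e) s" by (intro continuous_intros)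
        show "isCont (\<lambda>s. - partial_deriv i \<psi> (x + (- s) *\<^sub>R ?e)) s"
          by (rule isCont_minus[OF isCont_o2[OF 2 1]])
      qed
      then show ?thesis by (simp add: mult.commute)
    qed
    have "(LINT x|lborel. \<psi> x * (f (x + h *\<^sub>R ?e) - f x - P x)) =
      (LINT x|lborel. \<psi> x * f (x + h *\<^sub>R ?e)) - (LINT x|lborel. \<psi> x * f x) - (LINT x|lborel. \<psi> x * P x)"
      using i1 by (simp add: right_diff_distrib)
    also have "(LINT x|lborel. \<psi> x * f (x + h *\<^sub>R ?e)) = (LINT x|lborel. \<psi> (x - h *\<^sub>R ?e) * f x)"
      using lborel_translate(2)[OF i2, of "h *\<^sub>R ?e"] by simp
    also have "(LINT x|lborel. \<psi> (x - h *\<^sub>R ?e) * f x) - (LINT x|lborel. \<psi> x * f x) =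
        - (LINT x|lborel. f x * (LINT s|lborel. indicat_real {0..h} s * partial_deriv i \<psi> (x + s *\<^sub>R (- ?e))))"
    proof -
      have "(LINT x|lborel. \<psi> (x - h *\<^sub>R ?e) * f x) - (LINT x|lborel. \<psi> x * f x) =
          (LINT x|lborel. f x * (\<psi> (x - h *\<^sub>R ?e) - \<psi> x))"
        using i1 i2 by (simp add: algebra_simps)
      then show ?thesis unfolding ftc by simp
    qed
    \<comment> \<open>In this exchange the bounded function \<open>f\<close> is the weight and the
      derivative of \<psi> is the integrable factor.\<close>
    also have "\<dots> = - (LINT s|lborel. indicat_real {0..h} s *
        (LINT x|lborel. f x * partial_deriv i \<psi> (x + s *\<^sub>R (- ?e))))"
      by (subst translate_Fubini(3)[OF test_function_integrable[OF \<psi>'] _ fM]) auto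
    also have "\<dots> = - (LINT s|lborel. indicat_real {0..h} s * - (LINT x|lborel. \<psi> x * p (x + s *\<^sub>R ?e)))"
    proof -
      have "(LINT x|lborel. f x * partial_deriv i \<psi> (x + s *\<^sub>R (- ?e))) = - (LINT x|lborel. \<psi> x * p (x + s *\<^sub>R ?e))"
        if s: "s \<in> {0..h}" for s
      proof -
        \<comment> \<open>Translating a support in \<open>V'\<close> by at most \<open>h\<close>
          keeps it in \<open>V\<close>, so the weak derivative of \<open>f\<close> may be tested
          with the translate.\<close>
        have t: "test_function V (\<lambda>x. \<psi> (x - s *\<^sub>R ?e))"
          by (rule test_function_translate[OF \<psi>]) (use sub s in auto)
        have "(LINT x|lborel. partial_deriv i (\<lambda>x. \<psi> (x - s *\<^sub>R ?e)) x * f x) =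
            - (LINT x|lborel. \<psi> (x - s *\<^sub>R ?e) * p x)"
          using w t unfolding lweak_def by blast
        also have "(LINT x|lborel. \<psi> (x - s *\<^sub>R ?e) * p x) = (LINT x|lborel. \<psi> x * p (x + s *\<^sub>R ?e))"
          using lborel_translate(2)[of "\<lambda>x. \<psi> (x - s *\<^sub>R ?e) * p x" "s *\<^sub>R ?e"]
            integrable_bounded_times[OF fp(2), of "\<lambda>x. \<psi> (x - s *\<^sub>R ?e)" B] B by simp
        finally show ?thesis by (simp add: partial_deriv_translate[OF \<psi>] mult.commute)
      qed
      then have "indicat_real {0..h} s * (LINT x|lborel. f x * partial_deriv i \<psi> (x + s *\<^sub>R (- ?e))) =
          indicat_real {0..h} s * - (LINT x|lborel. \<psi> x * p (x + s *\<^sub>R ?e))" for s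
        by (cases "s \<in> {0..h}") auto
      then show ?thesis by simp
    qed
    also have "\<dots> = (LINT x|lborel. \<psi> x * P x)"
      unfolding P_def by (subst translate_Fubini(3)[OF fp(2) _ B]) auto
    finally show "(LINT x|lborel. \<psi> x * (f (x + h *\<^sub>R ?e) - f x - P x)) = 0" by simp
  qed
  then show ?thesis by (rule AE_mp) (auto simp: P_def intro!: AE_I2)
qed

lemma LINT_interval_average_bound:
  fixes A :: "real \<Rightarrow> real"
  assumes "0 < h" and A: "integrable lborel (\<lambda>s. indicat_real {0..h} s * A s)"
    and bound: "\<And>s. 0 \<le> s \<Longrightarrow> s \<le> h \<Longrightarrow> \<bar>A s - L\<bar> \<le> \<epsilon>"
  shows "\<bar>(LINT s|lborel. indicat_real {0..h} s * A s) / h - L\<bar> \<le> \<epsilon>"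
proof -
  have i: "integrable lborel (\<lambda>s. indicat_real {0..h} s * c)" for c
    by (intro integrable_mult_left) (auto intro!: integrable_real_indicator simp: emeasure_lborel_Icc_eq)
  have c: "(LINT s|lborel. indicat_real {0..h} s * c) = h * c" for c
    using assms(1) by simp
  have "(LINT s|lborel. indicat_real {0..h} s * A s) \<le> (LINT s|lborel. indicat_real {0..h} s * (L + \<epsilon>))"
    using bound by (intro integral_mono A i) (fastforce simp: indicator_def abs_le_iff)
  moreover have "(LINT s|lborel. indicat_real {0..h} s * (L - \<epsilon>)) \<le> (LINT s|lborel. indicat_real {0..h} s * A s)"
    using bound by (intro integral_mono A i) (fastforce simp: indicator_def abs_le_iff)
  ultimately have "h * (L - \<epsilon>) \<le> (LINT s|lborel. indicat_real {0..h} s * A s)"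
    "(LINT s|lborel. indicat_real {0..h} s * A s) \<le> h * (L + \<epsilon>)"
    unfolding c by auto
  then show ?thesis using assms(1)
    by (simp add: abs_le_iff field_simps)
qed

lemma test_function_Lipschitz:
  assumes "test_function V \<phi>"
  obtains L where "L > 0" "\<And>x t. \<bar>\<phi> (x - t *\<^sub>R axis i 1) - \<phi> x\<bar> \<le> L * \<bar>t\<bar>"
proof -
  obtain L where L: "L > 0" "\<And>x. \<bar>partial_deriv i \<phi> x\<bar> \<le> L"
    using test_function_bounded[OF test_function_partial_deriv[OF assms]] by blast
  have "\<bar>\<phi> (x - t *\<^sub>R axis i 1) - \<phi> x\<bar> \<le> L * \<bar>t\<bar>" for x t
    using field_differentiable_bound[of UNIV "\<lambda>t. \<phi> (x + t *\<^sub>R axis i 1)"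
        "\<lambda>t. partial_deriv i \<phi> (x + t *\<^sub>R axis i 1)" L "- t" 0]
      test_function_line_derivative[OF assms] L(2) by simp
  with L(1) show ?thesis using that by blast
qed

text \<open>The Lipschitz constant \<open>L\<close> of \<phi> makes L |F| an integrable majorant of
  all the difference quotients.\<close>

lemma difference_quotient_LINT_tendsto:
  fixes F :: "real^'n \<Rightarrow> real"
  assumes \<phi>: "test_function V \<phi>" and F: "integrable lborel F"
    and h: "\<And>n. h n > 0" "h \<longlonglongrightarrow> 0"
  shows "(\<lambda>n. (LINT x|lborel. F x * (\<phi> (x - h n *\<^sub>R axis i 1) - \<phi> x)) / h n)
    \<longlonglongrightarrow> - (LINT x|lborel. partial_deriv i \<phi> x * F x)"
proof -
  let ?e = "axis i 1"
  note \<phi>' = test_function_partial_deriv[OF \<phi>, of i]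
  note [measurable] = test_function_borel[OF \<phi>] test_function_borel[OF \<phi>']
  obtain L where L: "L > 0" and lip: "\<And>x t. \<bar>\<phi> (x - t *\<^sub>R ?e) - \<phi> x\<bar> \<le> L * \<bar>t\<bar>"
    using test_function_Lipschitz[OF \<phi>] by blast
  have [measurable]: "F \<in> borel_measurable borel" using F by auto
  have "(\<lambda>n. LINT x|lborel. F x * ((\<phi> (x - h n *\<^sub>R ?e) - \<phi> x) / h n)) \<longlonglongrightarrow>
      (LINT x|lborel. F x * - partial_deriv i \<phi> x)"
  proof (rule integral_dominated_convergence[where w="\<lambda>x. \<bar>F x\<bar> * L"])
    show "AE x in lborel. (\<lambda>n. F x * ((\<phi> (x - h n *\<^sub>R ?e) - \<phi> x) / h n)) \<longlonglongrightarrow> F x * - partial_deriv i \<phi> x"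
    proof (intro AE_I2 tendsto_mult tendsto_const)
      fix x
      have "((\<lambda>t. (\<phi> (x + t *\<^sub>R ?e) - \<phi> x) / t) \<longlongrightarrow> partial_deriv i \<phi> x) (at 0)"
        using test_function_line_derivative[OF \<phi>, of x i 0] by (simp add: DERIV_def)
      moreover have "filterlim (\<lambda>n. - h n) (at 0) sequentially"
        using h by (auto simp: filterlim_at less_imp_neq[symmetric] intro: tendsto_eq_intros)
      ultimately have "(\<lambda>n. (\<phi> (x + (- h n) *\<^sub>R ?e) - \<phi> x) / (- h n)) \<longlonglongrightarrow> partial_deriv i \<phi> x"
        by (rule filterlim_compose)
      from tendsto_minus[OF this]
      show "(\<lambda>n. (\<phi> (x - h n *\<^sub>R ?e) - \<phi> x) / h n) \<longlonglongrightarrow> - partial_deriv i \<phi> x"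
        by (simp add: minus_divide_left)
    qed
    show "AE x in lborel. norm (F x * ((\<phi> (x - h n *\<^sub>R ?e) - \<phi> x) / h n)) \<le> \<bar>F x\<bar> * L" for n
    proof (rule AE_I2)
      show "norm (F x * ((\<phi> (x - h n *\<^sub>R ?e) - \<phi> x) / h n)) \<le> \<bar>F x\<bar> * L" for x
      proof -
        have "\<bar>(\<phi> (x - h n *\<^sub>R ?e) - \<phi> x) / h n\<bar> \<le> L"
          using lip[of x "h n"] h(1)[of n] by (simp add: field_simps)
        then show ?thesis unfolding real_norm_def abs_mult by (rule mult_left_mono) simp
      qed
    qed
  qed (use F in \<open>auto\<close>)
  then show ?thesis by (simp add: mult.commute)
qed

text \<open>The discrete product rule
  \<open>fg(x + he) - fg(x) = g(x) (f(x + he) - f(x)) + f(x + he) (g(x + he) - g(x))\<close> passes to the limit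
  because the differences are averages of \<open>p\<close> and \<open>q\<close>, and translations are continuous in \<open>L\<^sup>1\<close>.\<close>

lemma lweak_mult:
  fixes f g p q :: "real^'n \<Rightarrow> real"
  assumes "open V" and f: "integrable lborel f" "integrable lborel p" "\<And>x. \<bar>f x\<bar> \<le> M" "lweak V i f p"
    and g: "integrable lborel g" "integrable lborel q" "\<And>x. \<bar>g x\<bar> \<le> M" "lweak V i g q"
  shows "lweak V i (\<lambda>x. f x * g x) (\<lambda>x. p x * g x + f x * q x)"
  unfolding lweak_def
proof (intro allI impI)
  fix \<phi> assume \<phi>: "test_function V \<phi>"
  let ?e = "axis i 1 :: real^'n"
  define K where "K = closure {x. \<phi> x \<noteq> 0}"
  have K: "compact K" "K \<subseteq> V" "\<And>x. x \<notin> K \<Longrightarrow> \<phi> x = 0"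
    using \<phi> closure_subset[of "{x. \<phi> x \<noteq> 0}"] by (auto simp: test_function_def K_def)
  note \<phi>' = test_function_partial_deriv[OF \<phi>, of i]
  note [measurable] = test_function_borel[OF \<phi>] test_function_borel[OF \<phi>']
  have [measurable]: "f \<in> borel_measurable borel" "g \<in> borel_measurable borel"
    "p \<in> borel_measurable borel" "q \<in> borel_measurable borel" using f g by auto
  obtain C where C: "C > 0" "\<And>x. \<bar>\<phi> x\<bar> \<le> C" using test_function_bounded[OF \<phi>] by blast
  obtain L where L: "L > 0" "\<And>x t. \<bar>\<phi> (x - t *\<^sub>R ?e) - \<phi> x\<bar> \<le> L * \<bar>t\<bar>"
    using test_function_Lipschitz[OF \<phi>] by blast
  have M: "M \<ge> 0" using f(3)[of 0] by linarith
  obtain r where r: "r > 0" "(\<Union>x\<in>K. ball x r) \<subseteq> V"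
    using compact_subset_open_imp_ball_epsilon_subset[OF K(1) assms(1) K(2)] by blast
  \<comment> \<open>Half the radius for the neighbourhood and a third for the shifts: r/2 + r/3 < r
    keeps every shifted point in \<open>V\<close>.\<close>
  define V' where "V' = (\<Union>x\<in>K. ball x (r / 2))"
  have V': "open V'" "K \<subseteq> V'" using r(1) by (auto simp: V'_def)
  have sub: "x + s *\<^sub>R ?e \<in> V" if "x \<in> V'" "0 \<le> s" "s \<le> r / 3" for x s
  proof -
    from that obtain y where y: "y \<in> K" "dist y x < r / 2" by (auto simp: V'_def)
    have "dist y (x + s *\<^sub>R ?e) \<le> dist y x + dist x (x + s *\<^sub>R ?e)" by (rule dist_triangle)
    also have "dist x (x + s *\<^sub>R ?e) = s" using that by (simp add: dist_norm)
    finally show ?thesis using y that r by (auto intro!: subsetD[OF r(2)])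
  qed
  \<comment> \<open>The L^1 modulus of continuity of \<open>p\<close> under translation in the
    chosen direction.\<close>
  define \<omega> where "\<omega> = (\<lambda>(p :: real^'n \<Rightarrow> real) s. LINT x|lborel. \<bar>p (x + s *\<^sub>R ?e) - p x\<bar>)"
  have \<omega>: "(\<omega> p \<longlongrightarrow> 0) (at 0)" if "integrable lborel p" for p
  proof -
    have "filterlim (\<lambda>s. s *\<^sub>R ?e) (at 0) (at (0::real))"
      unfolding filterlim_at by (auto simp: eventually_at_filter intro!: tendsto_eq_intros)
    then show ?thesis unfolding \<omega>_def
      by (rule filterlim_compose[OF L1_translation_tendsto[OF that]])
  qed
  define A where "A = (\<lambda>s. LINT x|lborel. \<phi> x * g x * p (x + s *\<^sub>R ?e))"
  define B where "B = (\<lambda>h s. LINT x|lborel. \<phi> x * f (x + h *\<^sub>R ?e) * q (x + s *\<^sub>R ?e))"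
  define A0 where "A0 = (LINT x|lborel. \<phi> x * g x * p x)"
  define B0 where "B0 = (LINT x|lborel. \<phi> x * f x * q x)"
  define Q where "Q = (LINT x|lborel. \<bar>q x\<bar>)"
  have CM: "\<bar>\<phi> x * g y\<bar> \<le> C * M" "\<bar>\<phi> x * f y\<bar> \<le> C * M" for x y
    using C(1) C(2)[of x] f(3)[of y] g(3)[of y] by (auto simp: abs_mult intro!: mult_mono)
  have A_bound: "\<bar>A s - A0\<bar> \<le> C * M * \<omega> p s" for s
  proof -
    have i: "integrable lborel (\<lambda>x. \<phi> x * g x * p x)" "integrable lborel (\<lambda>x. \<phi> x * g x * p (x + s *\<^sub>R ?e))"
      by (rule integrable_bounded_times[OF f(2) _ CM(1)], simp,
          rule integrable_bounded_times[OF lborel_translate(1)[OF f(2)] _ CM(1)], simp)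
    have d: "integrable lborel (\<lambda>x. p (x + s *\<^sub>R ?e) - p x)"
      using lborel_translate(1)[OF f(2)] f(2) by auto
    have "A s - A0 = (LINT x|lborel. \<phi> x * g x * (p (x + s *\<^sub>R ?e) - p x))"
      using i by (simp add: A_def A0_def right_diff_distrib)
    also have "\<bar>\<dots>\<bar> \<le> (LINT x|lborel. \<bar>\<phi> x * g x * (p (x + s *\<^sub>R ?e) - p x)\<bar>)"
      by (rule integral_abs_bound)
    also have "\<dots> \<le> (LINT x|lborel. (C * M) * \<bar>p (x + s *\<^sub>R ?e) - p x\<bar>)"
    proof (rule integral_mono)
      show "integrable lborel (\<lambda>x. \<bar>\<phi> x * g x * (p (x + s *\<^sub>R ?e) - p x)\<bar>)"
        by (rule integrable_abs, rule integrable_bounded_times[OF d _ CM(1)]) simp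
      show "\<bar>\<phi> x * g x * (p (x + s *\<^sub>R ?e) - p x)\<bar> \<le> (C * M) * \<bar>p (x + s *\<^sub>R ?e) - p x\<bar>" for x
        unfolding abs_mult[of "\<phi> x * g x"] by (rule mult_right_mono[OF CM(1)]) simp
    qed (use d in auto)
    finally show ?thesis by (simp add: \<omega>_def)
  qed
  have B_bound: "\<bar>B h s - B0\<bar> \<le> C * M * \<omega> q (s - h) + L * h * M * Q" if h: "h > 0" for h s
  proof -
    have i1: "integrable lborel (\<lambda>x. \<phi> (x - h *\<^sub>R ?e) * f x * q (x + (s - h) *\<^sub>R ?e))"
      by (rule integrable_bounded_times[OF lborel_translate(1)[OF g(2)] _ CM(2)]) simp
    have i2: "integrable lborel (\<lambda>x. \<phi> x * f x * q x)"
      by (rule integrable_bounded_times[OF g(2) _ CM(2)]) simp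
    have d: "integrable lborel (\<lambda>x. q (x + (s - h) *\<^sub>R ?e) - q x)"
      using lborel_translate(1)[OF g(2)] g(2) by auto
    \<comment> \<open>Shifting the variable by -h takes the translation off \<open>f\<close> and
      puts it on \<phi> and \<open>q\<close>. The error is then controlled by the Lipschitz constant
      of \<phi> and the modulus of \<open>q\<close>, with \<open>f\<close> used only through its
      bound.\<close>
    have "B h s = (LINT x|lborel. \<phi> (x - h *\<^sub>R ?e) * f x * q (x + (s - h) *\<^sub>R ?e))"
      using lborel_translate(2)[OF i1, of "h *\<^sub>R ?e"] by (simp add: B_def algebra_simps)
    then have "\<bar>B h s - B0\<bar> =
        \<bar>LINT x|lborel. \<phi> (x - h *\<^sub>R ?e) * f x * q (x + (s - h) *\<^sub>R ?e) - \<phi> x * f x * q x\<bar>"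
      using i1 i2 by (simp add: B0_def)
    also have "\<dots> \<le> (LINT x|lborel. \<bar>\<phi> (x - h *\<^sub>R ?e) * f x * q (x + (s - h) *\<^sub>R ?e) - \<phi> x * f x * q x\<bar>)"
      by (rule integral_abs_bound)
    also have "\<dots> \<le> (LINT x|lborel. (C * M) * \<bar>q (x + (s - h) *\<^sub>R ?e) - q x\<bar> + (L * h * M) * \<bar>q x\<bar>)"
    proof (rule integral_mono)
      show "\<bar>\<phi> (x - h *\<^sub>R ?e) * f x * q (x + (s - h) *\<^sub>R ?e) - \<phi> x * f x * q x\<bar> \<le>
        (C * M) * \<bar>q (x + (s - h) *\<^sub>R ?e) - q x\<bar> + (L * h * M) * \<bar>q x\<bar>" for x
      proof -
        have "\<phi> (x - h *\<^sub>R ?e) * f x * q (x + (s - h) *\<^sub>R ?e) - \<phi> x * f x * q x =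
          \<phi> (x - h *\<^sub>R ?e) * f x * (q (x + (s - h) *\<^sub>R ?e) - q x)
            + (\<phi> (x - h *\<^sub>R ?e) - \<phi> x) * f x * q x" by (simp add: algebra_simps)
        also have "\<bar>\<dots>\<bar> \<le> \<bar>\<phi> (x - h *\<^sub>R ?e) * f x\<bar> * \<bar>q (x + (s - h) *\<^sub>R ?e) - q x\<bar>
            + \<bar>(\<phi> (x - h *\<^sub>R ?e) - \<phi> x) * f x\<bar> * \<bar>q x\<bar>"
          unfolding abs_mult[symmetric] by (rule abs_triangle_ineq)
        also have "\<dots> \<le> (C * M) * \<bar>q (x + (s - h) *\<^sub>R ?e) - q x\<bar> + (L * h * M) * \<bar>q x\<bar>"
          using L(1) L(2)[of x h] f(3)[of x] h M
          by (intro add_mono mult_right_mono CM) (auto simp: abs_mult intro!: mult_mono)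
        finally show ?thesis .
      qed
    qed (use i1 i2 d g(2) in auto)
    also have "\<dots> = C * M * \<omega> q (s - h) + L * h * M * Q"
      using d g(2) by (simp add: \<omega>_def Q_def)
    finally show ?thesis .
  qed
  have fg: "integrable lborel (\<lambda>x. f x * g x)"
    by (rule integrable_bounded_times[OF g(1) _ f(3)]) simp
  \<comment> \<open>The discrete product rule, integrated against \<phi>: both increments are
    replaced by segment integrals, valid almost everywhere on \<open>V'\<close>, while \<phi>
    vanishes off \<open>V'\<close>.\<close>
  have key: "(LINT x|lborel. (f x * g x) * (\<phi> (x - h *\<^sub>R ?e) - \<phi> x)) =
      (LINT s|lborel. indicat_real {0..h} s * A s) + (LINT s|lborel. indicat_real {0..h} s * B h s)"
    and iA: "integrable lborel (\<lambda>s. indicat_real {0..h} s * A s)"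
    and iB: "integrable lborel (\<lambda>s. indicat_real {0..h} s * B h s)"
    if h: "0 < h" "h \<le> r / 3" for h
  proof -
    define P where "P = (\<lambda>x. LINT s|lborel. indicat_real {0..h} s * p (x + s *\<^sub>R ?e))"
    define R where "R = (\<lambda>x. LINT s|lborel. indicat_real {0..h} s * q (x + s *\<^sub>R ?e))"
    have m1: "(\<lambda>x. \<phi> x * g x) \<in> borel_measurable borel"
      and m2: "(\<lambda>x. \<phi> x * f (x + h *\<^sub>R ?e)) \<in> borel_measurable borel" by simp_all
    note FA = translate_Fubini[OF f(2) m1 CM(1), of h ?e]
    note FB = translate_Fubini[OF g(2) m2 CM(2), of h ?e]
    show "integrable lborel (\<lambda>s. indicat_real {0..h} s * A s)"
      "integrable lborel (\<lambda>s. indicat_real {0..h} s * B h s)"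
      using FA(2) FB(2) by (simp_all add: A_def B_def)
    have bf: "integrable lborel (\<lambda>x. f (x + h *\<^sub>R ?e) * g (x + h *\<^sub>R ?e))"
      using lborel_translate(1)[OF fg] by simp
    have i1: "integrable lborel (\<lambda>x. \<phi> (x - h *\<^sub>R ?e) * (f x * g x))"
      by (rule integrable_bounded_times[OF fg _ C(2)]) simp
    have i2: "integrable lborel (\<lambda>x. \<phi> x * (f x * g x))"
      by (rule integrable_bounded_times[OF fg _ C(2)]) simp
    have i3: "integrable lborel (\<lambda>x. \<phi> x * (f (x + h *\<^sub>R ?e) * g (x + h *\<^sub>R ?e)))"
      by (rule integrable_bounded_times[OF bf _ C(2)]) simp
    have "(LINT x|lborel. (f x * g x) * (\<phi> (x - h *\<^sub>R ?e) - \<phi> x)) =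
        (LINT x|lborel. \<phi> (x - h *\<^sub>R ?e) * (f x * g x)) - (LINT x|lborel. \<phi> x * (f x * g x))"
      using i1 i2 by (simp add: algebra_simps flip: Bochner_Integration.integral_diff)
    also have "(LINT x|lborel. \<phi> (x - h *\<^sub>R ?e) * (f x * g x)) =
        (LINT x|lborel. \<phi> x * (f (x + h *\<^sub>R ?e) * g (x + h *\<^sub>R ?e)))"
      using lborel_translate(2)[OF i1, of "h *\<^sub>R ?e"] by simp
    also have "\<dots> - (LINT x|lborel. \<phi> x * (f x * g x)) =
        (LINT x|lborel. \<phi> x * (f (x + h *\<^sub>R ?e) * g (x + h *\<^sub>R ?e)) - \<phi> x * (f x * g x))"
      using i3 i2 by simp
    also have "\<dots> = (LINT x|lborel. \<phi> x * g x * P x + \<phi> x * f (x + h *\<^sub>R ?e) * R x)"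
    proof (rule integral_cong_AE)
      show "(\<lambda>x. \<phi> x * (f (x + h *\<^sub>R ?e) * g (x + h *\<^sub>R ?e)) - \<phi> x * (f x * g x)) \<in> borel_measurable lborel"
        using i2 i3 by auto
      show "(\<lambda>x. \<phi> x * g x * P x + \<phi> x * f (x + h *\<^sub>R ?e) * R x) \<in> borel_measurable lborel"
        using FA(1) FB(1) by (simp add: P_def R_def)
      have "AE x in lborel. x \<in> V' \<longrightarrow> f (x + h *\<^sub>R ?e) - f x = P x"
        unfolding P_def using h sub by (intro lweak_difference_eq_average[OF V'(1) f]) auto
      moreover have "AE x in lborel. x \<in> V' \<longrightarrow> g (x + h *\<^sub>R ?e) - g x = R x"
        unfolding R_def using h sub by (intro lweak_difference_eq_average[OF V'(1) g]) auto
      ultimately show "AE x in lborel. \<phi> x * (f (x + h *\<^sub>R ?e) * g (x + h *\<^sub>R ?e)) - \<phi> x * (f x * g x) =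
          \<phi> x * g x * P x + \<phi> x * f (x + h *\<^sub>R ?e) * R x"
      proof eventually_elim
        case (elim x)
        show ?case
        proof (cases "x \<in> V'")
          case True
          with elim have PR: "P x = f (x + h *\<^sub>R ?e) - f x" "R x = g (x + h *\<^sub>R ?e) - g x" by auto
          show ?thesis unfolding PR by (simp add: algebra_simps)
        next
          case False
          then have "\<phi> x = 0" using K(3) V'(2) by blast
          then show ?thesis by simp
        qed
      qed
    qed
    also have "\<dots> = (LINT s|lborel. indicat_real {0..h} s * A s) + (LINT s|lborel. indicat_real {0..h} s * B h s)"
      using FA FB by (simp add: A_def B_def P_def R_def)
    finally show "(LINT x|lborel. (f x * g x) * (\<phi> (x - h *\<^sub>R ?e) - \<phi> x)) =
      (LINT s|lborel. indicat_real {0..h} s * A s) + (LINT s|lborel. indicat_real {0..h} s * B h s)" .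
  qed
  define h where "h = (\<lambda>n. r / 3 * inverse (real (Suc n)))"
  have h: "h n > 0" "h n \<le> r / 3" for n
    using r(1) by (auto simp: h_def field_simps)
  have h0: "h \<longlonglongrightarrow> 0" unfolding h_def
    by (intro tendsto_mult_right_zero LIMSEQ_inverse_real_of_nat)
  have lim1: "(\<lambda>n. (LINT x|lborel. (f x * g x) * (\<phi> (x - h n *\<^sub>R ?e) - \<phi> x)) / h n) \<longlonglongrightarrow>
      - (LINT x|lborel. partial_deriv i \<phi> x * (f x * g x))"
    by (rule difference_quotient_LINT_tendsto[OF \<phi> fg h(1) h0])
  have lim2: "(\<lambda>n. (LINT x|lborel. (f x * g x) * (\<phi> (x - h n *\<^sub>R ?e) - \<phi> x)) / h n) \<longlonglongrightarrow> A0 + B0"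
  proof (rule LIMSEQ_I)
    fix \<epsilon> :: real assume "\<epsilon> > 0"
    \<comment> \<open>The summand 1 keeps the denominator positive when M = 0; the factor 4 leaves
      room for three errors of size \<epsilon>/4.\<close>
    define \<eta> where "\<eta> = \<epsilon> / (4 * (C * M + 1))"
    have CM0: "C * M \<ge> 0" using C(1) M by simp
    have \<eta>: "\<eta> > 0" "C * M * \<eta> \<le> \<epsilon> / 4" using \<open>\<epsilon> > 0\<close> CM0 by (auto simp: \<eta>_def field_simps add_nonneg_pos)
    have "\<forall>\<^sub>F s in at 0. \<omega> p s < \<eta>" "\<forall>\<^sub>F s in at 0. \<omega> q s < \<eta>"
      using order_tendstoD(2)[OF \<omega>[OF f(2)] \<eta>(1)] order_tendstoD(2)[OF \<omega>[OF g(2)] \<eta>(1)] by auto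
    then have "\<forall>\<^sub>F s in at 0. \<omega> p s < \<eta> \<and> \<omega> q s < \<eta>" by eventually_elim auto
    then obtain d where d: "d > 0" "\<And>s. s \<noteq> 0 \<Longrightarrow> dist s 0 < d \<Longrightarrow> \<omega> p s < \<eta> \<and> \<omega> q s < \<eta>"
      unfolding eventually_at by auto
    \<comment> \<open>The limit at 0 says nothing about s = 0 itself, where the modulus is
      zero.\<close>
    have d': "\<omega> p s \<le> \<eta>" "\<omega> q s \<le> \<eta>" if "\<bar>s\<bar> < d" for s
      using d(2)[of s] that \<eta>(1) by (cases "s = 0"; force simp: \<omega>_def)+
    have "(\<lambda>n. L * h n * M * Q) \<longlonglongrightarrow> L * 0 * M * Q" by (intro tendsto_intros h0)
    then have "\<forall>\<^sub>F n in sequentially. L * h n * M * Q < \<epsilon> / 4"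
      using \<open>\<epsilon> > 0\<close> by (intro order_tendstoD(2)[of _ 0]) auto
    moreover have "\<forall>\<^sub>F n in sequentially. h n < d" using h0 d(1) by (rule order_tendstoD)
    ultimately have "\<forall>\<^sub>F n in sequentially. L * h n * M * Q < \<epsilon> / 4 \<and> h n < d" by eventually_elim auto
    then obtain N where N: "\<And>n. n \<ge> N \<Longrightarrow> L * h n * M * Q < \<epsilon> / 4 \<and> h n < d"
      by (auto simp: eventually_sequentially)
    have "norm ((LINT x|lborel. (f x * g x) * (\<phi> (x - h n *\<^sub>R ?e) - \<phi> x)) / h n - (A0 + B0)) < \<epsilon>"
      if n: "n \<ge> N" for n
    proof -
      have a: "\<bar>(LINT s|lborel. indicat_real {0..h n} s * A s) / h n - A0\<bar> \<le> \<epsilon> / 4"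
      proof (rule LINT_interval_average_bound[OF h(1) iA[OF h]])
        fix s assume s: "0 \<le> s" "s \<le> h n"
        have "\<bar>A s - A0\<bar> \<le> C * M * \<omega> p s" by (rule A_bound)
        also have "\<dots> \<le> C * M * \<eta>" using s N[OF n] by (intro mult_left_mono d' CM0) auto
        finally show "\<bar>A s - A0\<bar> \<le> \<epsilon> / 4" using \<eta>(2) by linarith
      qed
      have b: "\<bar>(LINT s|lborel. indicat_real {0..h n} s * B (h n) s) / h n - B0\<bar> \<le> \<epsilon> / 4 + \<epsilon> / 4"
      proof (rule LINT_interval_average_bound[OF h(1) iB[OF h]])
        fix s assume s: "0 \<le> s" "s \<le> h n"
        have "\<bar>B (h n) s - B0\<bar> \<le> C * M * \<omega> q (s - h n) + L * h n * M * Q" by (rule B_bound[OF h(1)])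
        also have "C * M * \<omega> q (s - h n) \<le> C * M * \<eta>" using s N[OF n] by (intro mult_left_mono d' CM0) auto
        finally show "\<bar>B (h n) s - B0\<bar> \<le> \<epsilon> / 4 + \<epsilon> / 4" using \<eta>(2) N[OF n] by linarith
      qed
      from a b \<open>\<epsilon> > 0\<close> show ?thesis
        unfolding key[OF h] add_divide_distrib real_norm_def by linarith
    qed
    then show "\<exists>no. \<forall>n\<ge>no. norm ((LINT x|lborel. (f x * g x) * (\<phi> (x - h n *\<^sub>R ?e) - \<phi> x)) / h n - (A0 + B0)) < \<epsilon>"
      by blast
  qed
  have "- (LINT x|lborel. partial_deriv i \<phi> x * (f x * g x)) = A0 + B0"
    by (rule LIMSEQ_unique[OF lim1 lim2])
  moreover have "A0 + B0 = (LINT x|lborel. \<phi> x * (p x * g x + f x * q x))"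
  proof -
    have "integrable lborel (\<lambda>x. \<phi> x * g x * p x)" "integrable lborel (\<lambda>x. \<phi> x * f x * q x)"
      by (rule integrable_bounded_times[OF f(2) _ CM(1)], simp,
          rule integrable_bounded_times[OF g(2) _ CM(2)], simp)
    then show ?thesis unfolding A0_def B0_def
      by (subst Bochner_Integration.integral_add[symmetric]) (auto simp: algebra_simps)
  qed
  ultimately show "(LINT x|lborel. partial_deriv i \<phi> x * (f x * g x)) =
      - (LINT x|lborel. \<phi> x * (p x * g x + f x * q x))" by simp
qed

section \<open>Weak derivatives modulo null sets, and localisation of the product rule\<close>

lemma locally_L1_iff:
  "locally_L1 \<Omega> f \<longleftrightarrow> (\<forall>K. compact K \<and> K \<subseteq> \<Omega> \<longrightarrow> integrable (lebesgue_on K) f)"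
proof -
  have "f absolutely_integrable_on K \<longleftrightarrow> integrable (lebesgue_on K) f" if "compact K" for K
    using lmeasurable_compact[OF that] fmeasurableD[of K lebesgue]
    by (simp add: integrable_restrict_space set_integrable_def)
  then show ?thesis by (auto simp: locally_L1_def)
qed

lemma locally_L1_cong_AE:
  fixes f :: "real^'n \<Rightarrow> 'b::euclidean_space"
  assumes "open \<Omega>" "AE x in lebesgue_on \<Omega>. f x = g x" "locally_L1 \<Omega> f"
  shows "locally_L1 \<Omega> g"
  unfolding locally_L1_def
proof (intro allI impI)
  fix K assume K: "compact K \<and> K \<subseteq> \<Omega>"
  have N: "negligible {x \<in> \<Omega>. f x \<noteq> g x}"
    using assms(1,2) by (simp add: AE_lebesgue_on_iff)
  have "f absolutely_integrable_on K" using assms(3) K by (simp add: locally_L1_def)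
  then show "g absolutely_integrable_on K"
    by (rule absolutely_integrable_spike[OF _ N]) (use K in auto)
qed

lemma locally_L1_componentwise:
  fixes f :: "real^'n \<Rightarrow> real^'m"
  shows "locally_L1 \<Omega> f \<longleftrightarrow> (\<forall>k. locally_L1 \<Omega> (\<lambda>x. f x $ k))"
proof -
  have "f absolutely_integrable_on K \<longleftrightarrow> (\<forall>k. (\<lambda>x. f x $ k) absolutely_integrable_on K)" for K
    by (subst absolutely_integrable_componentwise_iff) (auto simp: Basis_vec_def inner_axis)
  then show ?thesis by (auto simp: locally_L1_def)
qed

lemma locally_L1_test_integrable:
  fixes f :: "real^'n \<Rightarrow> 'b::euclidean_space"
  assumes "open \<Omega>" "locally_L1 \<Omega> f" "test_function \<Omega> \<phi>"
  shows "integrable (lebesgue_on \<Omega>) (\<lambda>x. \<phi> x *\<^sub>R f x)"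
proof -
  let ?K = "closure {x. \<phi> x \<noteq> 0}"
  have K: "compact ?K" "?K \<subseteq> \<Omega>" using assms(3) by (auto simp: test_function_def)
  have Ks: "?K \<in> sets lebesgue" by auto
  obtain B where B: "\<And>x. \<bar>\<phi> x\<bar> \<le> B" using test_function_bounded[OF assms(3)] by blast
  have i: "integrable (lebesgue_on ?K) f" using assms(2) K by (simp add: locally_L1_iff)
  have [measurable]: "\<phi> \<in> borel_measurable (lebesgue_on ?K)"
    using test_function_continuous[OF assms(3)] Ks
    by (intro continuous_imp_measurable_on_sets_lebesgue) (auto intro: continuous_on_subset)
  have "integrable (lebesgue_on ?K) (\<lambda>x. \<phi> x *\<^sub>R f x)"
  proof (rule Bochner_Integration.integrable_bound[OF integrable_scaleR_right[OF i, of B]])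
    show "AE x in lebesgue_on ?K. norm (\<phi> x *\<^sub>R f x) \<le> norm (B *\<^sub>R f x)"
    proof (rule AE_I2)
      show "norm (\<phi> x *\<^sub>R f x) \<le> norm (B *\<^sub>R f x)" for x
        using B[of x] by (simp add: mult_right_mono)
    qed
  qed (use i in measurable)
  then have "integrable lebesgue (\<lambda>x. indicator ?K x *\<^sub>R (\<phi> x *\<^sub>R f x))"
    by (subst (asm) integrable_restrict_space) auto
  moreover have "indicator ?K x *\<^sub>R (\<phi> x *\<^sub>R f x) = indicator \<Omega> x *\<^sub>R (\<phi> x *\<^sub>R f x)" for x
    using K(2) closure_subset[of "{x. \<phi> x \<noteq> 0}"] by (auto simp: indicator_def)
  ultimately have "integrable lebesgue (\<lambda>x. indicator \<Omega> x *\<^sub>R (\<phi> x *\<^sub>R f x))"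
    by (simp only:)
  then show ?thesis
    using assms(1) by (subst integrable_restrict_space) auto
qed

lemma has_weak_partial_cong_AE:
  fixes f g :: "real^'n \<Rightarrow> 'b::euclidean_space"
  assumes "open \<Omega>" and ae: "AE x in lebesgue_on \<Omega>. f x = f' x" "AE x in lebesgue_on \<Omega>. g x = g' x"
    and w: "has_weak_partial \<Omega> i f g"
  shows "has_weak_partial \<Omega> i f' g'"
proof -
  have L: "locally_L1 \<Omega> f" "locally_L1 \<Omega> g" using w by (auto simp: has_weak_partial_def)
  note L' = locally_L1_cong_AE[OF assms(1) ae(1) L(1)] locally_L1_cong_AE[OF assms(1) ae(2) L(2)]
  have c: "(LINT x|lebesgue_on \<Omega>. \<phi> x *\<^sub>R u x) = (LINT x|lebesgue_on \<Omega>. \<phi> x *\<^sub>R v x)"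
    if "test_function \<Omega> \<phi>" "locally_L1 \<Omega> u" "locally_L1 \<Omega> v" "AE x in lebesgue_on \<Omega>. u x = v x"
    for \<phi> :: "real^'n \<Rightarrow> real" and u v :: "real^'n \<Rightarrow> 'b"
    using that(4) locally_L1_test_integrable[OF assms(1) that(2,1)] locally_L1_test_integrable[OF assms(1) that(3,1)]
    by (intro integral_cong_AE) auto
  show ?thesis
    unfolding has_weak_partial_def
  proof (intro conjI allI impI L')
    fix \<phi> assume \<phi>: "test_function \<Omega> \<phi>"
    have "(LINT x|lebesgue_on \<Omega>. partial_deriv i \<phi> x *\<^sub>R f x) = - (LINT x|lebesgue_on \<Omega>. \<phi> x *\<^sub>R g x)"
      using w \<phi> by (simp add: has_weak_partial_def)
    then show "(LINT x|lebesgue_on \<Omega>. partial_deriv i \<phi> x *\<^sub>R f' x) = - (LINT x|lebesgue_on \<Omega>. \<phi> x *\<^sub>R g' x)"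
      by (simp only: c[OF test_function_partial_deriv[OF \<phi>] L(1) L'(1) ae(1)] c[OF \<phi> L(2) L'(2) ae(2)])
  qed
qed

text \<open>Full equality of functions, because both sides are the Hilbert choice from one and the
  same predicate.\<close>

lemma weak_partial_cong_AE:
  fixes f :: "real^'n \<Rightarrow> 'b::euclidean_space"
  assumes "open \<Omega>" "AE x in lebesgue_on \<Omega>. f x = f' x"
  shows "weak_partial \<Omega> i f = weak_partial \<Omega> i f'"
proof -
  have "AE x in lebesgue_on \<Omega>. f' x = f x" using assms(2) by eventually_elim simp
  then have "has_weak_partial \<Omega> i f g \<longleftrightarrow> has_weak_partial \<Omega> i f' g" for g
    using has_weak_partial_cong_AE[OF assms(1) assms(2), of g g] has_weak_partial_cong_AE[OF assms(1), of f' f g g] by auto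
  then show ?thesis by (simp add: weak_partial_def)
qed

lemma has_weak_partial_componentwise:
  fixes f g :: "real^'n \<Rightarrow> real^'m"
  assumes "open \<Omega>"
  shows "has_weak_partial \<Omega> i f g \<longleftrightarrow> (\<forall>k. has_weak_partial \<Omega> i (\<lambda>x. f x $ k) (\<lambda>x. g x $ k))"
proof (cases "locally_L1 \<Omega> f \<and> locally_L1 \<Omega> g")
  case True
  have c: "(LINT x|lebesgue_on \<Omega>. \<phi> x *\<^sub>R u x) $ k = (LINT x|lebesgue_on \<Omega>. \<phi> x *\<^sub>R (u x $ k))"
    if "test_function \<Omega> \<phi>" "locally_L1 \<Omega> u" for \<phi> k and u :: "real^'n \<Rightarrow> real^'m"
    using integral_bounded_linear[OF bounded_linear_vec_nth locally_L1_test_integrable[OF assms that(2,1)], of k] by simp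
  have "(LINT x|lebesgue_on \<Omega>. partial_deriv i \<phi> x *\<^sub>R f x) = - (LINT x|lebesgue_on \<Omega>. \<phi> x *\<^sub>R g x) \<longleftrightarrow>
    (\<forall>k. (LINT x|lebesgue_on \<Omega>. partial_deriv i \<phi> x *\<^sub>R (f x $ k)) = - (LINT x|lebesgue_on \<Omega>. \<phi> x *\<^sub>R (g x $ k)))"
    if "test_function \<Omega> \<phi>" for \<phi>
    using c[OF that, of g] c[OF test_function_partial_deriv[OF that], of f] True by (simp add: vec_eq_iff)
  with True show ?thesis
    by (auto simp: has_weak_partial_def locally_L1_componentwise[of \<Omega> f] locally_L1_componentwise[of \<Omega> g])
next
  case False
  then show ?thesis
    by (auto simp: has_weak_partial_def locally_L1_componentwise[of \<Omega> f] locally_L1_componentwise[of \<Omega> g])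
qed

lemma locally_L1_diff:
  fixes f g :: "real^'n \<Rightarrow> 'b::euclidean_space"
  shows "locally_L1 \<Omega> f \<Longrightarrow> locally_L1 \<Omega> g \<Longrightarrow> locally_L1 \<Omega> (\<lambda>x. f x - g x)"
  by (auto simp: locally_L1_iff)

lemma locally_L1_add:
  fixes f g :: "real^'n \<Rightarrow> 'b::euclidean_space"
  shows "locally_L1 \<Omega> f \<Longrightarrow> locally_L1 \<Omega> g \<Longrightarrow> locally_L1 \<Omega> (\<lambda>x. f x + g x)"
  by (auto simp: locally_L1_iff)

lemma weak_test_eq_imp_AE_eq:
  fixes u v :: "real^'n \<Rightarrow> real"
  assumes "open \<Omega>" and L: "locally_L1 \<Omega> u" "locally_L1 \<Omega> v"
    and eq: "\<And>\<phi>. test_function \<Omega> \<phi> \<Longrightarrow> (LINT x|lebesgue_on \<Omega>. \<phi> x *\<^sub>R u x) = (LINT x|lebesgue_on \<Omega>. \<phi> x *\<^sub>R v x)"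
  shows "AE x in lebesgue_on \<Omega>. u x = v x"
proof -
  have "AE x in lebesgue_on \<Omega>. u x - v x = 0"
  proof (rule fundamental_lemma_cv[OF assms(1) locally_L1_diff[OF L]])
    fix \<phi> assume \<phi>: "test_function \<Omega> \<phi>"
    show "(LINT x|lebesgue_on \<Omega>. \<phi> x * (u x - v x)) = 0"
      using eq[OF \<phi>] locally_L1_test_integrable[OF assms(1) L(1) \<phi>] locally_L1_test_integrable[OF assms(1) L(2) \<phi>]
      by (simp add: right_diff_distrib)
  qed
  then show ?thesis by simp
qed

lemma has_weak_partial_unique_real:
  fixes f g h :: "real^'n \<Rightarrow> real"
  assumes "open \<Omega>" "has_weak_partial \<Omega> i f g" "has_weak_partial \<Omega> i f h"
  shows "AE x in lebesgue_on \<Omega>. g x = h x"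
  using assms by (intro weak_test_eq_imp_AE_eq) (auto simp: has_weak_partial_def)

lemma AE_vec_eqI:
  fixes g h :: "'a \<Rightarrow> real^'m"
  assumes "\<And>k. AE x in M. g x $ k = h x $ k" shows "AE x in M. g x = h x"
proof -
  have "AE x in M. \<forall>k\<in>UNIV. g x $ k = h x $ k" using assms by (intro AE_finite_allI) auto
  then show ?thesis by eventually_elim (simp add: vec_eq_iff)
qed

lemma has_weak_partial_unique:
  fixes f g h :: "real^'n \<Rightarrow> real^'m"
  assumes "open \<Omega>" "has_weak_partial \<Omega> i f g" "has_weak_partial \<Omega> i f h"
  shows "AE x in lebesgue_on \<Omega>. g x = h x"
proof (rule AE_vec_eqI)
  fix k
  show "AE x in lebesgue_on \<Omega>. g x $ k = h x $ k"
    using assms by (intro has_weak_partial_unique_real[OF assms(1), of i "\<lambda>x. f x $ k"])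
      (auto simp: has_weak_partial_componentwise)
qed

lemma has_weak_partial_weak_partial: "has_weak_partial \<Omega> i f g \<Longrightarrow> has_weak_partial \<Omega> i f (weak_partial \<Omega> i f)"
  unfolding weak_partial_def by (rule someI[of "has_weak_partial \<Omega> i f"])

lemma has_weak_partial_add:
  fixes f g p q :: "real^'n \<Rightarrow> real"
  assumes "open \<Omega>" "has_weak_partial \<Omega> i f p" "has_weak_partial \<Omega> i g q"
  shows "has_weak_partial \<Omega> i (\<lambda>x. f x + g x) (\<lambda>x. p x + q x)"
proof -
  have L: "locally_L1 \<Omega> f" "locally_L1 \<Omega> p" "locally_L1 \<Omega> g" "locally_L1 \<Omega> q"
    using assms by (auto simp: has_weak_partial_def)
  note I = locally_L1_test_integrable[OF assms(1)]
  show ?thesis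
    unfolding has_weak_partial_def
  proof (intro conjI allI impI locally_L1_add L)
    fix \<phi> assume \<phi>: "test_function \<Omega> \<phi>"
    note \<phi>' = test_function_partial_deriv[OF \<phi>, of i]
    show "(LINT x|lebesgue_on \<Omega>. partial_deriv i \<phi> x *\<^sub>R (f x + g x)) = - (LINT x|lebesgue_on \<Omega>. \<phi> x *\<^sub>R (p x + q x))"
      using assms(2,3) \<phi> I[OF L(1) \<phi>'] I[OF L(3) \<phi>'] I[OF L(2) \<phi>] I[OF L(4) \<phi>]
      by (simp add: has_weak_partial_def distrib_left)
  qed
qed

text \<open>Finitely many balls whose closed balls stay in \<Omega> cover \<open>S\<close>. The
  resulting \<open>V\<close> is where locally integrable functions become integrable.\<close>

lemma compact_subset_open_shrink:
  fixes S :: "'a::heine_borel set"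
  assumes "compact S" "open \<Omega>" "S \<subseteq> \<Omega>"
  obtains V where "open V" "compact (closure V)" "S \<subseteq> V" "closure V \<subseteq> \<Omega>"
proof -
  have "\<exists>r>0. cball x r \<subseteq> \<Omega>" if "x \<in> S" for x
    using assms that by (auto simp: open_contains_cball)
  then obtain r where r: "\<And>x. x \<in> S \<Longrightarrow> r x > 0 \<and> cball x (r x) \<subseteq> \<Omega>" by metis
  have "S \<subseteq> (\<Union>x\<in>S. ball x (r x))" using r by auto
  then obtain T where T: "T \<subseteq> S" "finite T" "S \<subseteq> (\<Union>x\<in>T. ball x (r x))"
    using compactE_image[OF assms(1), of S "\<lambda>x. ball x (r x)"] by (metis open_ball)
  have cl: "closure (\<Union>x\<in>T. ball x (r x)) \<subseteq> (\<Union>x\<in>T. cball x (r x))"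
    using T(2) by (intro closure_minimal closed_UN) (auto intro: less_imp_le)
  have "compact (\<Union>x\<in>T. cball x (r x))" using T(2) by (intro compact_UN) auto
  then have "compact (closure (\<Union>x\<in>T. ball x (r x)))"
    using cl by (metis closed_closure compact_Int_closed inf.absorb_iff2)
  moreover have "(\<Union>x\<in>T. cball x (r x)) \<subseteq> \<Omega>" using r T(1) by blast
  ultimately show ?thesis
    using T(3) cl by (intro that[of "\<Union>x\<in>T. ball x (r x)"]) auto
qed

text \<open>The bound ignores null sets because the tangent vectors are arbitrary representatives of
  weak derivatives. It is what keeps a product with a locally integrable function locally
  integrable.\<close>

definition AE_locally_bounded :: "(real^'n) set \<Rightarrow> (real^'n \<Rightarrow> real) \<Rightarrow> bool" where
  "AE_locally_bounded \<Omega> f \<longleftrightarrow>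
    (\<forall>K. compact K \<and> K \<subseteq> \<Omega> \<longrightarrow> (\<exists>M. AE x in lebesgue_on K. \<bar>f x\<bar> \<le> M))"

lemma locally_L1_mult:
  assumes "AE_locally_bounded \<Omega> f" "locally_L1 \<Omega> f" "locally_L1 \<Omega> g"
  shows "locally_L1 \<Omega> (\<lambda>x. f x * g x)"
  unfolding locally_L1_iff
proof (intro allI impI)
  fix K assume K: "compact K \<and> K \<subseteq> \<Omega>"
  then obtain M where M: "AE x in lebesgue_on K. \<bar>f x\<bar> \<le> M"
    using assms(1) by (auto simp: AE_locally_bounded_def)
  have i: "integrable (lebesgue_on K) f" "integrable (lebesgue_on K) g"
    using assms K by (auto simp: locally_L1_iff)
  show "integrable (lebesgue_on K) (\<lambda>x. f x * g x)"
  proof (rule Bochner_Integration.integrable_bound[OF integrable_mult_right[OF i(2), of M]])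
    show "AE x in lebesgue_on K. norm (f x * g x) \<le> norm (M * g x)"
      using M by eventually_elim (auto simp: abs_mult intro!: mult_right_mono)
  qed (use i in auto)
qed

text \<open>Translation and Fubini arguments live on \<open>lborel\<close>; this is the passage from
  Lebesgue-measurable data to that setting.\<close>

lemma locally_L1_borel_representative:
  fixes f :: "real^'n \<Rightarrow> real"
  assumes "locally_L1 \<Omega> f" "compact K" "K \<subseteq> \<Omega>"
  obtains g where "integrable lborel g" "AE x in lebesgue_on K. f x = g x"
proof -
  have "integrable (lebesgue_on K) f" using assms by (simp add: locally_L1_iff)
  then have i: "integrable lebesgue (\<lambda>x. indicator K x *\<^sub>R f x)"
    using lmeasurable_compact[OF assms(2)] fmeasurableD[of K lebesgue]
    by (subst (asm) integrable_restrict_space) auto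
  then obtain g where g: "g \<in> borel_measurable lborel" "AE x in lborel. indicator K x *\<^sub>R f x = g x"
    using completion_ex_borel_measurable_real[of "\<lambda>x. indicator K x *\<^sub>R f x" lborel] by auto
  have ae: "AE x in lebesgue. indicator K x *\<^sub>R f x = g x" using g(2) by (simp add: AE_completion)
  have "integrable lebesgue g"
    by (rule integrable_cong_AE_imp[OF i _ ae]) (use g(1) in \<open>auto intro: measurable_completion\<close>)
  then have "integrable lborel g" using g(1) by (simp add: integrable_completion)
  moreover have "AE x in lebesgue_on K. f x = g x"
    using ae lmeasurable_compact[OF assms(2)] fmeasurableD[of K lebesgue]
    by (subst AE_restrict_space_iff) (auto elim!: eventually_mono)
  ultimately show ?thesis using that by blast
qed

lemma LINT_test_borel_representative:
  fixes f g :: "real^'n \<Rightarrow> real"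
  assumes "open \<Omega>" "locally_L1 \<Omega> f" "compact K" "K \<subseteq> \<Omega>" "V \<subseteq> K"
    and g: "integrable lborel g" "AE x in lebesgue_on K. f x = g x" and \<phi>: "test_function V \<phi>"
  shows "(LINT x|lebesgue_on \<Omega>. \<phi> x * f x) = (LINT x|lborel. \<phi> x * g x)"
proof -
  have K: "K \<in> sets lebesgue" using lmeasurable_compact[OF assms(3)] fmeasurableD by blast
  note [measurable] = test_function_borel[OF \<phi>]
  have m: "integrable (lebesgue_on K) f" using assms by (simp add: locally_L1_iff)
  have \<phi>m[measurable]: "\<phi> \<in> borel_measurable (lebesgue_on K)"
    using test_function_continuous[OF \<phi>] K
    by (intro continuous_imp_measurable_on_sets_lebesgue) (auto intro: continuous_on_subset)
  have "g \<in> borel_measurable lebesgue" using g(1) by (auto intro: measurable_completion)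
  then have gm[measurable]: "g \<in> borel_measurable (lebesgue_on K)" by (rule measurable_restrict_space1)
  have "(LINT x|lebesgue_on \<Omega>. \<phi> x * f x) = (LINT x|lebesgue_on K. \<phi> x * f x)"
    using assms test_function_eq_0[OF \<phi>] K by (intro LINT_restrict_support) auto
  also have "\<dots> = (LINT x|lebesgue_on K. \<phi> x * g x)"
    using g(2) m by (intro integral_cong_AE) auto
  also have "\<dots> = (LINT x|lborel. \<phi> x * g x)"
    using g(1) K assms(5) test_function_eq_0[OF \<phi>] by (intro LINT_lborel_eq_restrict[symmetric]) auto
  finally show ?thesis .
qed

text \<open>Reduction to \<open>lweak_mult\<close>: near the support of a given test function all
  four functions are replaced by Borel functions integrable over the whole space, without changing
  any of the integrals involved.\<close>

lemma has_weak_partial_mult: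
  fixes f g p q :: "real^'n \<Rightarrow> real"
  assumes "open \<Omega>" and f: "AE_locally_bounded \<Omega> f" "has_weak_partial \<Omega> i f p"
    and g: "AE_locally_bounded \<Omega> g" "has_weak_partial \<Omega> i g q"
  shows "has_weak_partial \<Omega> i (\<lambda>x. f x * g x) (\<lambda>x. p x * g x + f x * q x)"
proof -
  have L: "locally_L1 \<Omega> f" "locally_L1 \<Omega> p" "locally_L1 \<Omega> g" "locally_L1 \<Omega> q"
    using f g by (auto simp: has_weak_partial_def)
  have Lfg: "locally_L1 \<Omega> (\<lambda>x. f x * g x)" by (intro locally_L1_mult f L)
  have Lpq: "locally_L1 \<Omega> (\<lambda>x. p x * g x + f x * q x)"
    using locally_L1_mult[OF g(1) L(3,2)] locally_L1_mult[OF f(1) L(1,4)]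
    by (intro locally_L1_add) (simp_all add: mult.commute)
  show ?thesis
    unfolding has_weak_partial_def
  proof (intro conjI allI impI Lfg Lpq)
    fix \<phi> assume \<phi>: "test_function \<Omega> \<phi>"
    let ?S = "closure {x. \<phi> x \<noteq> 0}"
    have S: "compact ?S" "?S \<subseteq> \<Omega>" using \<phi> by (auto simp: test_function_def)
    obtain V where V: "open V" "compact (closure V)" "?S \<subseteq> V" "closure V \<subseteq> \<Omega>"
      using compact_subset_open_shrink[OF S(1) assms(1) S(2)] by blast
    let ?K = "closure V"
    have \<phi>V: "test_function V \<phi>" using \<phi> V(3) by (auto simp: test_function_def)
    obtain M1 where M1: "AE x in lebesgue_on ?K. \<bar>f x\<bar> \<le> M1"
      using f(1)[unfolded AE_locally_bounded_def, rule_format, of ?K] V by auto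
    obtain M2 where M2: "AE x in lebesgue_on ?K. \<bar>g x\<bar> \<le> M2"
      using g(1)[unfolded AE_locally_bounded_def, rule_format, of ?K] V by auto
    define M where "M = max 0 (max M1 M2)"
    note rep = LINT_test_borel_representative[OF assms(1) _ V(2,4) closure_subset]
    obtain f0 where f0: "integrable lborel f0" "AE x in lebesgue_on ?K. f x = f0 x"
      by (rule locally_L1_borel_representative[OF L(1) V(2,4)])
    obtain p' where p': "integrable lborel p'" "AE x in lebesgue_on ?K. p x = p' x"
      by (rule locally_L1_borel_representative[OF L(2) V(2,4)])
    obtain g0 where g0: "integrable lborel g0" "AE x in lebesgue_on ?K. g x = g0 x"
      by (rule locally_L1_borel_representative[OF L(3) V(2,4)])
    obtain q' where q': "integrable lborel q'" "AE x in lebesgue_on ?K. q x = q' x"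
      by (rule locally_L1_borel_representative[OF L(4) V(2,4)])
    note r = p' q' f0 g0
    \<comment> \<open>\<open>lweak_mult\<close> needs bounds at every point; clamping at
      \<open>M\<close> provides them and alters the representative only on a null subset of the
      closure of \<open>V\<close>.\<close>
    define f' where "f' = (\<lambda>x. max (- M) (min M (f0 x)))"
    define g' where "g' = (\<lambda>x. max (- M) (min M (g0 x)))"
    have M0: "M \<ge> 0" "M \<ge> M1" "M \<ge> M2" by (auto simp: M_def)
    have b: "\<bar>f' x\<bar> \<le> M" "\<bar>g' x\<bar> \<le> M" for x using M0 by (auto simp: f'_def g'_def)
    have clamp: "integrable lborel (\<lambda>x. max (- M) (min M (u x)))" if "integrable lborel u" for u :: "real^'n \<Rightarrow> real"
      by (rule Bochner_Integration.integrable_bound[OF that]) (use that M0 in auto)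
    have i: "integrable lborel f'" "integrable lborel g'"
      unfolding f'_def g'_def by (intro clamp r)+
    have aef: "AE x in lebesgue_on ?K. f x = f' x"
      using f0(2) M1 by eventually_elim (use M0 in \<open>auto simp: f'_def\<close>)
    have aeg: "AE x in lebesgue_on ?K. g x = g' x"
      using g0(2) M2 by eventually_elim (use M0 in \<open>auto simp: g'_def\<close>)
    note ae = aef aeg
    have "lweak V i f' p'"
      unfolding lweak_def
    proof (intro allI impI)
      fix \<psi> assume \<psi>: "test_function V \<psi>"
      have "test_function \<Omega> \<psi>" using test_function_mono[OF \<psi>] V(4) closure_subset by blast
      then have "(LINT x|lebesgue_on \<Omega>. partial_deriv i \<psi> x * f x) = - (LINT x|lebesgue_on \<Omega>. \<psi> x * p x)"
        using f(2) by (simp add: has_weak_partial_def)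
      then show "(LINT x|lborel. partial_deriv i \<psi> x * f' x) = - (LINT x|lborel. \<psi> x * p' x)"
        by (simp only: rep[OF L(1) i(1) ae(1) test_function_partial_deriv[OF \<psi>]] rep[OF L(2) r(1,2) \<psi>])
    qed
    moreover have "lweak V i g' q'"
      unfolding lweak_def
    proof (intro allI impI)
      fix \<psi> assume \<psi>: "test_function V \<psi>"
      have "test_function \<Omega> \<psi>" using test_function_mono[OF \<psi>] V(4) closure_subset by blast
      then have "(LINT x|lebesgue_on \<Omega>. partial_deriv i \<psi> x * g x) = - (LINT x|lebesgue_on \<Omega>. \<psi> x * q x)"
        using g(2) by (simp add: has_weak_partial_def)
      then show "(LINT x|lborel. partial_deriv i \<psi> x * g' x) = - (LINT x|lborel. \<psi> x * q' x)"
        by (simp only: rep[OF L(3) i(2) ae(2) test_function_partial_deriv[OF \<psi>]] rep[OF L(4) r(3,4) \<psi>])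
    qed
    ultimately have "lweak V i (\<lambda>x. f' x * g' x) (\<lambda>x. p' x * g' x + f' x * q' x)"
      by (intro lweak_mult[OF V(1) i(1) r(1) b(1) _ i(2) r(3) b(2)])
    then have "(LINT x|lborel. partial_deriv i \<phi> x * (f' x * g' x)) = - (LINT x|lborel. \<phi> x * (p' x * g' x + f' x * q' x))"
      using \<phi>V by (simp add: lweak_def)
    moreover have "(LINT x|lebesgue_on \<Omega>. partial_deriv i \<phi> x * (f x * g x)) = (LINT x|lborel. partial_deriv i \<phi> x * (f' x * g' x))"
    proof (rule rep[OF Lfg _ _ test_function_partial_deriv[OF \<phi>V]])
      show "integrable lborel (\<lambda>x. f' x * g' x)"
        by (rule integrable_bounded_times[OF i(2) borel_measurable_integrable[OF i(1)] b(1)])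
      show "AE x in lebesgue_on ?K. f x * g x = f' x * g' x" using ae by eventually_elim simp
    qed
    moreover have "(LINT x|lebesgue_on \<Omega>. \<phi> x * (p x * g x + f x * q x)) = (LINT x|lborel. \<phi> x * (p' x * g' x + f' x * q' x))"
    proof (rule rep[OF Lpq _ _ \<phi>V])
      show "integrable lborel (\<lambda>x. p' x * g' x + f' x * q' x)"
        using integrable_bounded_times[OF r(1) borel_measurable_integrable[OF i(2)] b(2)]
          integrable_bounded_times[OF r(3) borel_measurable_integrable[OF i(1)] b(1)]
        by (simp add: mult.commute)
      show "AE x in lebesgue_on ?K. p x * g x + f x * q x = p' x * g' x + f' x * q' x"
        using ae r(2,4) by eventually_elim simp
    qed
    ultimately show "(LINT x|lebesgue_on \<Omega>. partial_deriv i \<phi> x *\<^sub>R (f x * g x)) =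
        - (LINT x|lebesgue_on \<Omega>. \<phi> x *\<^sub>R (p x * g x + f x * q x))" by simp
  qed
qed

section \<open>Weak second derivatives and weakly differentiable functions\<close>

text \<open>Two applications of the mean value theorem write the second difference over a square of
  side h as h^2 times a mixed derivative at an intermediate point. Continuity identifies the limit,
  and the second difference is symmetric in the two directions.\<close>

lemma partial_deriv_commute:
  assumes \<phi>: "test_function V \<phi>"
  shows "partial_deriv i (partial_deriv j \<phi>) x = partial_deriv j (partial_deriv i \<phi>) x"
proof -
  have \<Delta>: "\<exists>s t. 0 < s \<and> s < h \<and> 0 < t \<and> t < h \<and>
      \<phi> (x + h *\<^sub>R axis i 1 + h *\<^sub>R axis j 1) - \<phi> (x + h *\<^sub>R axis i 1) - (\<phi> (x + h *\<^sub>R axis j 1) - \<phi> x)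
      = h * (h * partial_deriv j (partial_deriv i \<phi>) (x + s *\<^sub>R axis i 1 + t *\<^sub>R axis j 1))"
    if h: "h > 0" for h i j
  proof -
    note \<phi>i = test_function_partial_deriv[OF \<phi>, of i]
    have D: "((\<lambda>s. \<phi> (x + h *\<^sub>R axis j 1 + s *\<^sub>R axis i 1) - \<phi> (x + s *\<^sub>R axis i 1)) has_real_derivative
       partial_deriv i \<phi> (x + h *\<^sub>R axis j 1 + s *\<^sub>R axis i 1) - partial_deriv i \<phi> (x + s *\<^sub>R axis i 1)) (at s)" for s
      by (intro DERIV_diff test_function_line_derivative[OF \<phi>])
    obtain s where s: "0 < s" "s < h" "\<phi> (x + h *\<^sub>R axis j 1 + h *\<^sub>R axis i 1) - \<phi> (x + h *\<^sub>R axis i 1)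
        - (\<phi> (x + h *\<^sub>R axis j 1) - \<phi> x) =
        h * (partial_deriv i \<phi> (x + h *\<^sub>R axis j 1 + s *\<^sub>R axis i 1) - partial_deriv i \<phi> (x + s *\<^sub>R axis i 1))"
      using MVT2[OF h D] by auto
    obtain t where t: "0 < t" "t < h" "partial_deriv i \<phi> (x + s *\<^sub>R axis i 1 + h *\<^sub>R axis j 1) - partial_deriv i \<phi> (x + s *\<^sub>R axis i 1)
        = h * partial_deriv j (partial_deriv i \<phi>) (x + s *\<^sub>R axis i 1 + t *\<^sub>R axis j 1)"
      using MVT2[OF h test_function_line_derivative[OF \<phi>i, of "x + s *\<^sub>R axis i 1" j]] by auto
    show ?thesis using s t by (intro exI[of _ s] exI[of _ t]) (simp add: add_ac)
  qed
  have lim: "((\<lambda>h. (\<phi> (x + h *\<^sub>R axis i 1 + h *\<^sub>R axis j 1) - \<phi> (x + h *\<^sub>R axis i 1) - (\<phi> (x + h *\<^sub>R axis j 1) - \<phi> x)) / (h * h))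
      \<longlongrightarrow> partial_deriv j (partial_deriv i \<phi>) x) (at_right 0)" for i j
  proof (rule tendstoI)
    fix \<epsilon> :: real assume "\<epsilon> > 0"
    let ?g = "partial_deriv j (partial_deriv i \<phi>)"
    have "isCont ?g x"
      using test_function_continuous[OF test_function_partial_deriv[OF test_function_partial_deriv[OF \<phi>]]]
      by (simp add: continuous_on_eq_continuous_at)
    then obtain d where d: "d > 0" "\<And>y. dist y x < d \<Longrightarrow> dist (?g y) (?g x) < \<epsilon>"
      using \<open>\<epsilon> > 0\<close> unfolding continuous_at_eps_delta by blast
    have "dist ((\<phi> (x + h *\<^sub>R axis i 1 + h *\<^sub>R axis j 1) - \<phi> (x + h *\<^sub>R axis i 1) - (\<phi> (x + h *\<^sub>R axis j 1) - \<phi> x)) / (h * h)) (?g x) < \<epsilon>"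
      if h: "0 < h" "h < d / 2" for h
    proof -
      obtain s t where st: "0 < s" "s < h" "0 < t" "t < h" and
        e: "\<phi> (x + h *\<^sub>R axis i 1 + h *\<^sub>R axis j 1) - \<phi> (x + h *\<^sub>R axis i 1) - (\<phi> (x + h *\<^sub>R axis j 1) - \<phi> x)
          = h * (h * ?g (x + s *\<^sub>R axis i 1 + t *\<^sub>R axis j 1))" using \<Delta>[OF h(1)] by metis
      have "dist (x + s *\<^sub>R axis i 1 + t *\<^sub>R axis j 1) x = norm (s *\<^sub>R axis i 1 + t *\<^sub>R axis j (1::real))"
        by (simp add: dist_norm)
      also have "\<dots> \<le> s + t" using st by (intro norm_triangle_le) simp
      finally have "dist (?g (x + s *\<^sub>R axis i 1 + t *\<^sub>R axis j 1)) (?g x) < \<epsilon>"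
        using st h by (intro d(2)) simp
      then show ?thesis unfolding e using h(1) by simp
    qed
    then show "\<forall>\<^sub>F h in at_right 0. dist ((\<phi> (x + h *\<^sub>R axis i 1 + h *\<^sub>R axis j 1) - \<phi> (x + h *\<^sub>R axis i 1) - (\<phi> (x + h *\<^sub>R axis j 1) - \<phi> x)) / (h * h)) (?g x) < \<epsilon>"
      using d(1) by (intro eventually_at_rightI[of 0 "d/2"]) auto
  qed
  \<comment> \<open>Exchanging the two directions leaves the second difference unchanged, so the
    same quotient has both mixed derivatives as limit.\<close>
  have "((\<lambda>h. (\<phi> (x + h *\<^sub>R axis i 1 + h *\<^sub>R axis j 1) - \<phi> (x + h *\<^sub>R axis i 1) - (\<phi> (x + h *\<^sub>R axis j 1) - \<phi> x)) / (h * h))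
      \<longlongrightarrow> partial_deriv i (partial_deriv j \<phi>) x) (at_right 0)"
    using lim[of j i] by (simp add: algebra_simps)
  from tendsto_unique[OF _ this lim[of i j]] show ?thesis by simp
qed

text \<open>Both derivatives are moved onto the test function, where they commute
  classically.\<close>

lemma weak_second_partial_commute:
  fixes y :: "real^'n \<Rightarrow> real^'m"
  assumes "open \<Omega>" "has_weak_partial \<Omega> i y u" "has_weak_partial \<Omega> j y v"
    "has_weak_partial \<Omega> j u p" "has_weak_partial \<Omega> i v q"
  shows "AE x in lebesgue_on \<Omega>. p x = q x"
proof (rule AE_vec_eqI)
  fix k
  have c: "has_weak_partial \<Omega> i (\<lambda>x. y x $ k) (\<lambda>x. u x $ k)" "has_weak_partial \<Omega> j (\<lambda>x. y x $ k) (\<lambda>x. v x $ k)"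
    "has_weak_partial \<Omega> j (\<lambda>x. u x $ k) (\<lambda>x. p x $ k)" "has_weak_partial \<Omega> i (\<lambda>x. v x $ k) (\<lambda>x. q x $ k)"
    using assms by (auto simp: has_weak_partial_componentwise)
  show "AE x in lebesgue_on \<Omega>. p x $ k = q x $ k"
  proof (rule weak_test_eq_imp_AE_eq[OF assms(1)])
    fix \<phi> assume \<phi>: "test_function \<Omega> \<phi>"
    note d = test_function_partial_deriv[OF \<phi>]
    have e: "partial_deriv i (partial_deriv j \<phi>) = partial_deriv j (partial_deriv i \<phi>)"
      using partial_deriv_commute[OF \<phi>] by blast
    have "(LINT x|lebesgue_on \<Omega>. partial_deriv i (partial_deriv j \<phi>) x *\<^sub>R (y x $ k))
        = - (LINT x|lebesgue_on \<Omega>. partial_deriv j \<phi> x *\<^sub>R (u x $ k))"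
      "(LINT x|lebesgue_on \<Omega>. partial_deriv j (partial_deriv i \<phi>) x *\<^sub>R (y x $ k))
        = - (LINT x|lebesgue_on \<Omega>. partial_deriv i \<phi> x *\<^sub>R (v x $ k))"
      "(LINT x|lebesgue_on \<Omega>. partial_deriv j \<phi> x *\<^sub>R (u x $ k)) = - (LINT x|lebesgue_on \<Omega>. \<phi> x *\<^sub>R (p x $ k))"
      "(LINT x|lebesgue_on \<Omega>. partial_deriv i \<phi> x *\<^sub>R (v x $ k)) = - (LINT x|lebesgue_on \<Omega>. \<phi> x *\<^sub>R (q x $ k))"
      using c d[of i] d[of j] \<phi> unfolding has_weak_partial_def by blast+
    then show "(LINT x|lebesgue_on \<Omega>. \<phi> x *\<^sub>R (p x $ k)) = (LINT x|lebesgue_on \<Omega>. \<phi> x *\<^sub>R (q x $ k))"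
      unfolding e by linarith
  qed (use c in \<open>auto simp: has_weak_partial_def\<close>)
qed

section \<open>Classical derivatives as weak derivatives\<close>

lemma continuous_on_imp_locally_L1:
  fixes f :: "real^'n \<Rightarrow> real"
  assumes "continuous_on \<Omega> f" shows "locally_L1 \<Omega> f"
  unfolding locally_L1_def
proof (intro allI impI)
  fix K assume K: "compact K \<and> K \<subseteq> \<Omega>"
  then have "continuous_on K f" using assms continuous_on_subset by blast
  with K have "integrable lborel (\<lambda>x. indicator K x *\<^sub>R f x)" by (intro borel_integrable_compact) auto
  then show "f absolutely_integrable_on K" unfolding set_integrable_def
    by (simp add: integrable_completion borel_measurable_integrable)
qed

text \<open>The increment u(x + e) - u(x) integrates to zero by translation invariance. It is also
  the integral of \<open>w\<close> over a unit segment, which Fubini and translation invariance turn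
  into the integral of \<open>w\<close>.\<close>

lemma LINT_line_derivative_eq_0:
  fixes u w :: "real^'n \<Rightarrow> real"
  assumes u: "integrable lborel u" and w: "continuous_on UNIV w" "integrable lborel w"
    and D: "\<And>x t. ((\<lambda>t. u (x + t *\<^sub>R e)) has_real_derivative w (x + t *\<^sub>R e)) (at t)"
  shows "(LINT x|lborel. w x) = 0"
proof -
  have ftc: "u (x + e) - u x = (LINT s|lborel. indicat_real {0..1} s * w (x + s *\<^sub>R e))" for x
  proof -
    have "(LINT s|lborel. w (x + s *\<^sub>R e) * indicat_real {0..1} s) = u (x + 1 *\<^sub>R e) - u (x + 0 *\<^sub>R e)"
    proof (rule integral_FTC_Icc_real)
      fix s :: real
      have 1: "isCont w (x + s *\<^sub>R e)" using w(1) by (simp add: continuous_on_eq_continuous_at)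
      have 2: "isCont (\<lambda>s. x + s *\<^sub>R e) s" by (intro continuous_intros)
      show "isCont (\<lambda>s. w (x + s *\<^sub>R e)) s" by (rule isCont_o2[OF 2 1])
    qed (use D in auto)
    then show ?thesis by (simp add: mult.commute)
  qed
  have "0 = (LINT x|lborel. u (x + e) - u x)"
    using lborel_translate[OF u, of e] u by simp
  also have "\<dots> = (LINT s|lborel. indicat_real {0..1} s * (LINT x|lborel. w (x + s *\<^sub>R e)))"
    unfolding ftc using translate_Fubini(3)[OF w(2), of "\<lambda>_. 1" 1 1 e] by simp
  also have "\<dots> = (LINT x|lborel. w x)"
    using lborel_translate(2)[OF w(2)] by simp
  finally show ?thesis by simp
qed

text \<open>Integration by parts is \<open>LINT_line_derivative_eq_0\<close> for u = \<phi> f and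
  its line derivative w. Both vanish off the compact support \<open>K\<close> of \<phi>, so they are
  controlled on the whole space although \<open>f\<close> is regular on \<Omega> only.\<close>

lemma C1_has_weak_partial:
  fixes f :: "real^'n \<Rightarrow> real"
  assumes "open \<Omega>" "Ck_on (Suc 0) \<Omega> f"
  shows "has_weak_partial \<Omega> i f (partial_deriv i f)"
proof -
  have fd: "f differentiable (at x)" if "x \<in> \<Omega>" for x using assms(2) that by simp
  have fc: "continuous_on \<Omega> f" using Ck_on_SucD[OF assms(2)] by simp
  have fc': "continuous_on \<Omega> (partial_deriv i f)"
    using assms(2) unfolding partial_deriv_def by simp
  show ?thesis
    unfolding has_weak_partial_def
  proof (intro conjI allI impI continuous_on_imp_locally_L1 fc fc')
    fix \<phi> assume \<phi>: "test_function \<Omega> \<phi>"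
    note \<phi>' = test_function_partial_deriv[OF \<phi>, of i]
    define K where "K = closure {x. \<phi> x \<noteq> 0}"
    have K: "compact K" "K \<subseteq> \<Omega>" "closed K" using \<phi> by (auto simp: test_function_def K_def)
    have z: "x \<notin> K \<Longrightarrow> \<phi> x = 0" for x using closure_subset[of "{x. \<phi> x \<noteq> 0}"] by (auto simp: K_def)
    have z': "x \<notin> K \<Longrightarrow> partial_deriv i \<phi> x = 0" for x
      using partial_deriv_eq_0_outside[of x \<phi>] by (simp add: K_def partial_deriv_def)
    define u where "u = (\<lambda>x. \<phi> x * f x)"
    define w where "w = (\<lambda>x. partial_deriv i \<phi> x * f x + \<phi> x * partial_deriv i f x)"
    have int: "integrable lborel v" if v: "continuous_on \<Omega> v" "\<And>x. x \<notin> K \<Longrightarrow> v x = 0" for v :: "real^'n \<Rightarrow> real"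
    proof -
      have "integrable lborel (\<lambda>x. indicator K x *\<^sub>R v x)"
        using K v by (intro borel_integrable_compact) (auto intro: continuous_on_subset)
      moreover have "(\<lambda>x. indicator K x *\<^sub>R v x) = v" using v(2) by (auto simp: indicator_def fun_eq_iff)
      ultimately show ?thesis by (simp only:)
    qed
    \<comment> \<open>\<Omega> and the complement of \<open>K\<close> are open and cover the
      space.\<close>
    have cont: "continuous_on UNIV v" if v: "continuous_on \<Omega> v" "\<And>x. x \<notin> K \<Longrightarrow> v x = 0" for v :: "real^'n \<Rightarrow> real"
    proof -
      have "continuous_on (- K) v" using v(2) by (subst continuous_on_cong[OF refl, of _ _ "\<lambda>_. 0"]) auto
      then have "continuous_on (\<Omega> \<union> - K) v"
        using v(1) assms(1) K(3) by (intro continuous_on_open_Un) auto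
      moreover have "\<Omega> \<union> - K = UNIV" using K(2) by auto
      ultimately show ?thesis by simp
    qed
    have c\<phi>: "continuous_on \<Omega> \<phi>" "continuous_on \<Omega> (partial_deriv i \<phi>)"
      using test_function_continuous[OF \<phi>] test_function_continuous[OF \<phi>'] by (auto intro: continuous_on_subset)
    have u: "continuous_on \<Omega> u" "\<And>x. x \<notin> K \<Longrightarrow> u x = 0"
      using fc c\<phi> z by (auto simp: u_def intro!: continuous_intros)
    have w: "continuous_on \<Omega> w" "\<And>x. x \<notin> K \<Longrightarrow> w x = 0"
      using fc fc' c\<phi> z z' by (auto simp: w_def intro!: continuous_intros)
    have D: "((\<lambda>t. u (x + t *\<^sub>R axis i 1)) has_real_derivative w (x + t *\<^sub>R axis i 1)) (at t)" for x t
    proof (cases "x + t *\<^sub>R axis i 1 \<in> \<Omega>")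
      case True
      show ?thesis unfolding u_def w_def
        using DERIV_mult[OF test_function_line_derivative[OF \<phi>, of x i t] has_line_derivative[OF fd[OF True]]]
        by (simp add: algebra_simps)
    next
      case False
      then have 0: "x + t *\<^sub>R axis i 1 \<notin> K" using K(2) by auto
      have "isCont (\<lambda>t. x + t *\<^sub>R axis i 1) t" by (intro continuous_intros)
      moreover have "open (- K)" using K(3) by auto
      \<comment> \<open>Beyond \<Omega> the line stays off the closed set \<open>K\<close> for
        nearby parameters, so \<open>u\<close> is locally constant zero there.\<close>
      ultimately have ev: "\<forall>\<^sub>F s in nhds t. x + s *\<^sub>R axis i 1 \<in> - K"
        using 0 unfolding continuous_at eventually_nhds_conv_at by (auto dest: topological_tendstoD)
      have "((\<lambda>t. u (x + t *\<^sub>R axis i 1)) has_real_derivative 0) (at t) \<longleftrightarrow> ((\<lambda>t. 0) has_real_derivative 0) (at t)"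
        by (rule DERIV_cong_ev[OF refl _ refl]) (use ev in eventually_elim, use u(2) in auto)
      then show ?thesis using w(2)[OF 0] by simp
    qed
    have "(LINT x|lborel. w x) = 0"
      by (rule LINT_line_derivative_eq_0[OF int[OF u] cont[OF w] int[OF w] D])
    moreover have "(LINT x|lborel. w x) = (LINT x|lebesgue_on \<Omega>. w x)"
      using int[OF w] w(2) K(2) assms(1) by (intro LINT_lborel_eq_restrict) auto
    moreover have "integrable (lebesgue_on \<Omega>) (\<lambda>x. partial_deriv i \<phi> x * f x)"
      "integrable (lebesgue_on \<Omega>) (\<lambda>x. \<phi> x * partial_deriv i f x)"
      using locally_L1_test_integrable[OF assms(1) continuous_on_imp_locally_L1[OF fc] \<phi>']
        locally_L1_test_integrable[OF assms(1) continuous_on_imp_locally_L1[OF fc'] \<phi>] by simp_all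
    ultimately show "(LINT x|lebesgue_on \<Omega>. partial_deriv i \<phi> x *\<^sub>R f x) =
       - (LINT x|lebesgue_on \<Omega>. \<phi> x *\<^sub>R partial_deriv i f x)"
      by (simp add: w_def)
  qed
qed

text \<open>Bundling the local bound with weak differentiability gives a class closed under sums and
  products. It contains the C^1 functions and, for an isometric immersion, the components of the
  tangent vectors, hence those of the normal and the Cosserat vector.\<close>

definition weakly_diff :: "(real^'n) set \<Rightarrow> (real^'n \<Rightarrow> real) \<Rightarrow> bool" where
  "weakly_diff \<Omega> f \<longleftrightarrow> AE_locally_bounded \<Omega> f \<and> (\<forall>i. \<exists>g. has_weak_partial \<Omega> i f g)"

lemma AE_locally_bounded_continuous:
  assumes "continuous_on \<Omega> f" shows "AE_locally_bounded \<Omega> f"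
  unfolding AE_locally_bounded_def
proof (intro allI impI)
  fix K assume K: "compact K \<and> K \<subseteq> \<Omega>"
  then have "bounded (f ` K)"
    using assms by (intro compact_imp_bounded compact_continuous_image) (auto intro: continuous_on_subset)
  then obtain M where "\<And>x. x \<in> K \<Longrightarrow> \<bar>f x\<bar> \<le> M" by (auto simp: bounded_iff)
  then show "\<exists>M. AE x in lebesgue_on K. \<bar>f x\<bar> \<le> M" by (intro exI[of _ M] AE_I2) simp
qed

lemma AE_locally_bounded_add:
  assumes "AE_locally_bounded \<Omega> f" "AE_locally_bounded \<Omega> g"
  shows "AE_locally_bounded \<Omega> (\<lambda>x. f x + g x)"
  unfolding AE_locally_bounded_def
proof (intro allI impI)
  fix K assume "compact K \<and> K \<subseteq> \<Omega>"
  then obtain M N where "AE x in lebesgue_on K. \<bar>f x\<bar> \<le> M" "AE x in lebesgue_on K. \<bar>g x\<bar> \<le> N"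
    using assms unfolding AE_locally_bounded_def by metis
  then have "AE x in lebesgue_on K. \<bar>f x + g x\<bar> \<le> M + N" by eventually_elim linarith
  then show "\<exists>M. AE x in lebesgue_on K. \<bar>f x + g x\<bar> \<le> M" by blast
qed

lemma AE_locally_bounded_mult:
  assumes "AE_locally_bounded \<Omega> f" "AE_locally_bounded \<Omega> g"
  shows "AE_locally_bounded \<Omega> (\<lambda>x. f x * g x)"
  unfolding AE_locally_bounded_def
proof (intro allI impI)
  fix K assume "compact K \<and> K \<subseteq> \<Omega>"
  then obtain M N where "AE x in lebesgue_on K. \<bar>f x\<bar> \<le> M" "AE x in lebesgue_on K. \<bar>g x\<bar> \<le> N"
    using assms unfolding AE_locally_bounded_def by metis
  then have "AE x in lebesgue_on K. \<bar>f x * g x\<bar> \<le> M * N"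
    by eventually_elim (auto simp: abs_mult intro!: mult_mono)
  then show "\<exists>M. AE x in lebesgue_on K. \<bar>f x * g x\<bar> \<le> M" by blast
qed

lemma weakly_diff_mult:
  assumes "open \<Omega>" "weakly_diff \<Omega> f" "weakly_diff \<Omega> g" shows "weakly_diff \<Omega> (\<lambda>x. f x * g x)"
  unfolding weakly_diff_def
proof (intro conjI allI)
  have b: "AE_locally_bounded \<Omega> f" "AE_locally_bounded \<Omega> g"
    using assms by (auto simp: weakly_diff_def)
  then show "AE_locally_bounded \<Omega> (\<lambda>x. f x * g x)" by (rule AE_locally_bounded_mult)
  fix i
  obtain p q where "has_weak_partial \<Omega> i f p" "has_weak_partial \<Omega> i g q"
    using assms unfolding weakly_diff_def by meson
  then show "\<exists>h. has_weak_partial \<Omega> i (\<lambda>x. f x * g x) h"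
    using has_weak_partial_mult[OF assms(1) b(1) _ b(2)] by blast
qed

lemma weakly_diff_add:
  assumes "open \<Omega>" "weakly_diff \<Omega> f" "weakly_diff \<Omega> g" shows "weakly_diff \<Omega> (\<lambda>x. f x + g x)"
  unfolding weakly_diff_def
proof (intro conjI allI)
  show "AE_locally_bounded \<Omega> (\<lambda>x. f x + g x)"
    using assms by (intro AE_locally_bounded_add) (auto simp: weakly_diff_def)
  fix i
  obtain p q where "has_weak_partial \<Omega> i f p" "has_weak_partial \<Omega> i g q"
    using assms unfolding weakly_diff_def by meson
  then show "\<exists>h. has_weak_partial \<Omega> i (\<lambda>x. f x + g x) h"
    using has_weak_partial_add[OF assms(1)] by blast
qed

lemma weakly_diff_C1:
  assumes "open \<Omega>" "Ck_on (Suc 0) \<Omega> f" shows "weakly_diff \<Omega> f"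
  unfolding weakly_diff_def
  using C1_has_weak_partial[OF assms] AE_locally_bounded_continuous[of \<Omega> f] Ck_on_SucD[OF assms(2)] by auto

section \<open>The rotation group and the Hessian of the energy density\<close>

lemma norm_matrix_power2:
  fixes A :: "real^'n^'m"
  shows "(norm A)\<^sup>2 = (\<Sum>i\<in>UNIV. \<Sum>j\<in>UNIV. (A $ i $ j)\<^sup>2)"
proof -
  have "(norm A)\<^sup>2 = A \<bullet> A" by (rule power2_norm_eq_inner)
  also have "\<dots> = (\<Sum>i\<in>UNIV. \<Sum>j\<in>UNIV. (A $ i $ j)\<^sup>2)"
    by (simp add: inner_vec_def power2_eq_square)
  finally show ?thesis .
qed

lemma matrix_add_rdistrib: "(A + B) ** C = A ** C + B ** (C :: real^'k^'n)"
  and matrix_diff_rdistrib: "(A - B) ** C = A ** C - B ** (C :: real^'k^'n)"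
  and matrix_diff_ldistrib: "D ** (A - B) = D ** A - D ** (B :: real^'n^'m)"
  and scaleR_matrix_assoc: "(r *\<^sub>R A) ** C = r *\<^sub>R (A ** C)"
  and matrix_scaleR_assoc: "A ** (r *\<^sub>R C) = r *\<^sub>R (A ** C)"
  by (simp_all add: matrix_matrix_mult_def vec_eq_iff distrib_left distrib_right left_diff_distrib right_diff_distrib
      sum.distrib sum_subtractf sum_distrib_left mult_ac)

lemma norm_transpose:
  fixes A :: "real^'n^'m" shows "norm (transpose A) = norm A"
proof -
  have "(norm (transpose A))\<^sup>2 = (norm A)\<^sup>2"
    unfolding norm_matrix_power2 by (subst sum.swap) (simp add: transpose_def)
  then show ?thesis by simp
qed

text \<open>\<open>norm\<close> on matrices is the Frobenius norm; Cauchy-Schwarz is applied to each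
  entry of the product.\<close>

lemma norm_matrix_mult_le:
  fixes A :: "real^'n^'m" and B :: "real^'k^'n"
  shows "norm (A ** B) \<le> norm A * norm B"
proof (rule power2_le_imp_le)
  have e: "(A ** B) $ i $ j = A $ i \<bullet> column j B" for i j
    by (simp add: matrix_matrix_mult_def inner_vec_def column_def)
  have "(norm (A ** B))\<^sup>2 \<le> (\<Sum>i\<in>UNIV. \<Sum>j\<in>UNIV. (norm (A $ i))\<^sup>2 * (norm (column j B))\<^sup>2)"
    unfolding norm_matrix_power2 e power_mult_distrib[symmetric]
    by (intro sum_mono) (metis Cauchy_Schwarz_ineq2 abs_le_square_iff abs_mult abs_norm_cancel)
  also have "\<dots> = (\<Sum>i\<in>UNIV. (norm (A $ i))\<^sup>2) * (\<Sum>j\<in>UNIV. (norm (column j B))\<^sup>2)"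
    by (simp add: sum_product)
  also have "(\<Sum>i\<in>UNIV. (norm (A $ i))\<^sup>2) = (norm A)\<^sup>2"
    by (simp add: power2_norm_eq_inner inner_vec_def)
  also have "(\<Sum>j\<in>UNIV. (norm (column j B))\<^sup>2) = (norm B)\<^sup>2"
    unfolding norm_matrix_power2 by (subst sum.swap) (simp only: power2_norm_eq_inner, simp add: inner_vec_def column_def power2_eq_square)
  finally show "(norm (A ** B))\<^sup>2 \<le> (norm A * norm B)\<^sup>2" by (simp add: power_mult_distrib)
qed simp

lemma norm_sym_part_le: "norm (sym_part F) \<le> norm F"
proof -
  have "norm (F + transpose F) \<le> norm F + norm F"
    using norm_triangle_ineq[of F "transpose F"] by (simp add: norm_transpose)
  then show ?thesis by (simp add: sym_part_def)
qed

lemma transpose_add: "transpose (A + B) = transpose A + transpose (B :: real^'n^'m)"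
  and transpose_diff: "transpose (A - B) = transpose A - transpose B"
  by (simp_all add: transpose_def vec_eq_iff)

lemma sym_part_symmetric: "transpose (sym_part F) = sym_part F"
  by (simp add: sym_part_def transpose_scalar transpose_add add.commute)

lemma sym_part_skew: "transpose (F - sym_part F) = - (F - sym_part F)"
  by (simp add: sym_part_def transpose_scalar transpose_add transpose_diff vec_eq_iff field_simps)

lemma sym_part_eq: "transpose F = F \<Longrightarrow> sym_part F = F"
  by (simp add: sym_part_def vec_eq_iff)

lemma sym_part_conjugate:
  assumes "transpose M = M" shows "sym_part (M ** F ** M) = M ** sym_part F ** M"
  using assms by (simp add: sym_part_def matrix_transpose_mul matrix_mul_assoc matrix_add_ldistrib
      matrix_add_rdistrib scaleR_matrix_assoc matrix_scaleR_assoc)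

definition skew :: "real^'n^'n \<Rightarrow> bool" where "skew K \<longleftrightarrow> transpose K = - K"

text \<open>The curve \<open>(1 + tK) (1 - tK)\<^sup>-\<^sup>1\<close> for skew \<open>K\<close>, written without inverse by means of
  \<open>K\<^sup>3 = - (|K|\<^sup>2 / 2) K\<close>.\<close>

definition cayley :: "real^3^3 \<Rightarrow> real \<Rightarrow> real^3^3" where
  "cayley K t = mat 1 + (2 * t / (1 + t\<^sup>2 * ((norm K)\<^sup>2 / 2))) *\<^sub>R K
     + (2 * t\<^sup>2 / (1 + t\<^sup>2 * ((norm K)\<^sup>2 / 2))) *\<^sub>R (K ** K)"

lemma skew_3:
  assumes "skew (K :: real^3^3)"
  obtains a b c where "K = vector [vector [0, a, b], vector [- a, 0, c], vector [- b, - c, 0]]"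
proof -
  have t: "transpose K $ i $ j = (- K) $ i $ j" for i j
    using assms by (simp only: skew_def)
  note neg = t[unfolded transpose_def vec_lambda_beta vector_uminus_component]
  have "K $ i $ i = 0" for i using neg[of i i] by linarith
  with neg[of 1 2] neg[of 1 3] neg[of 2 3]
  have "K = vector [vector [0, K$1$2, K$1$3], vector [- K$1$2, 0, K$2$3], vector [- K$1$3, - K$2$3, 0]]"
    by (simp add: vec_eq_iff forall_3)
  then show ?thesis using that by blast
qed

text \<open>Multiplying by the common denominator \<open>d\<close> reduces orthogonality and the
  determinant to polynomial identities in a, b, c and t.\<close>

lemma cayley_SO3:
  assumes "skew K" shows "cayley K t \<in> SO3"
proof -
  obtain a b c where K: "K = vector [vector [0, a, b], vector [- a, 0, c], vector [- b, - c, 0]]"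
    using skew_3[OF assms] by blast
  have n: "(norm K)\<^sup>2 / 2 = a\<^sup>2 + b\<^sup>2 + c\<^sup>2"
    unfolding norm_matrix_power2 by (simp add: K sum_3)
  define d where "d = 1 + t\<^sup>2 * (a\<^sup>2 + b\<^sup>2 + c\<^sup>2)"
  have "d > 0" unfolding d_def by (intro add_pos_nonneg) auto
  define P where "P = d *\<^sub>R cayley K t"
  have P: "P = d *\<^sub>R mat 1 + (2 * t) *\<^sub>R K + (2 * t\<^sup>2) *\<^sub>R (K ** K)"
    using \<open>d > 0\<close> by (simp add: P_def cayley_def n scaleR_right_distrib flip: d_def)
  have entries: "P$1$1 = d - 2 * t\<^sup>2 * (a\<^sup>2 + b\<^sup>2)" "P$1$2 = 2 * t * a - 2 * t\<^sup>2 * (b * c)"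
    "P$1$3 = 2 * t * b + 2 * t\<^sup>2 * (a * c)" "P$2$1 = - 2 * t * a - 2 * t\<^sup>2 * (b * c)"
    "P$2$2 = d - 2 * t\<^sup>2 * (a\<^sup>2 + c\<^sup>2)" "P$2$3 = 2 * t * c - 2 * t\<^sup>2 * (a * b)"
    "P$3$1 = - 2 * t * b + 2 * t\<^sup>2 * (a * c)" "P$3$2 = - 2 * t * c - 2 * t\<^sup>2 * (a * b)"
    "P$3$3 = d - 2 * t\<^sup>2 * (b\<^sup>2 + c\<^sup>2)"
    unfolding P by (simp_all add: K matrix_matrix_mult_def sum_3 mat_def power2_eq_square algebra_simps)
  have "transpose P ** P = (d * d) *\<^sub>R mat 1"
    by (simp add: vec_eq_iff forall_3 matrix_matrix_mult_def transpose_def sum_3 mat_def entries)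
      (simp add: d_def; algebra)
  then have "(d * d) *\<^sub>R (transpose (cayley K t) ** cayley K t) = (d * d) *\<^sub>R mat 1"
    by (simp add: P_def transpose_scalar scaleR_matrix_assoc matrix_scaleR_assoc)
  then have o: "orthogonal_matrix (cayley K t)"
    using \<open>d > 0\<close> by (simp add: orthogonal_matrix)
  have "det P = d ^ 3"
    unfolding det_3 entries d_def by algebra
  moreover have "det P = d ^ 3 * det (cayley K t)"
    unfolding P_def det_3 by (simp add: algebra_simps power3_eq_cube)
  ultimately have "det (cayley K t) = 1" using \<open>d > 0\<close> by simp
  with o show ?thesis by (simp add: SO3_def rotation_matrix_def)
qed

lemma cayley_0: "cayley K 0 = mat 1" by (simp add: cayley_def)

lemma cayley_has_derivative: "(cayley K has_vector_derivative 2 *\<^sub>R K) (at 0)"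
proof -
  define n where "n = (norm K)\<^sup>2 / 2"
  have 1: "((\<lambda>t. 2 * t / (1 + t\<^sup>2 * n)) has_real_derivative 2) (at 0)"
    and 2: "((\<lambda>t. 2 * t\<^sup>2 / (1 + t\<^sup>2 * n)) has_real_derivative 0) (at 0)"
    by (auto intro!: derivative_eq_intros)
  have "((\<lambda>t. mat 1 + (2 * t / (1 + t\<^sup>2 * n)) *\<^sub>R K + (2 * t\<^sup>2 / (1 + t\<^sup>2 * n)) *\<^sub>R (K ** K))
      has_vector_derivative 0 + ((2 * 0 / (1 + 0\<^sup>2 * n)) *\<^sub>R 0 + 2 *\<^sub>R K) +
        ((2 * 0\<^sup>2 / (1 + 0\<^sup>2 * n)) *\<^sub>R 0 + 0 *\<^sub>R (K ** K))) (at 0)"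
    by (intro has_vector_derivative_add has_vector_derivative_scaleR[OF 1]
        has_vector_derivative_scaleR[OF 2] has_vector_derivative_const)
  then show ?thesis by (simp add: n_def cayley_def[abs_def])
qed

text \<open>To first order the distance of 1 + tF from the rotations is t |sym F|: if R = 1 + E is
  orthogonal, then sym E = - E^T E / 2 is quadratic in E. The constant 2 is half the square of the
  factor in |E| \<le> 2t |F|.\<close>

lemma infdist_SO3_ge:
  assumes "t \<ge> 0"
  shows "infdist (mat 1 + t *\<^sub>R F) SO3 \<ge> t * norm (sym_part F) - 2 * t\<^sup>2 * (norm F)\<^sup>2"
proof -
  have ne: "mat 1 \<in> SO3" using cayley_SO3[of 0 0] by (simp add: cayley_def skew_def transpose_def vec_eq_iff)
  have "t * norm (sym_part F) - 2 * t\<^sup>2 * (norm F)\<^sup>2 \<le> dist (mat 1 + t *\<^sub>R F) R" if R: "R \<in> SO3" for R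
  proof -
    define D where "D = mat 1 + t *\<^sub>R F - R"
    define E where "E = t *\<^sub>R F - D"
    have RE: "R = mat 1 + E" by (simp add: E_def D_def)
    have d: "dist (mat 1 + t *\<^sub>R F) R = norm D" by (simp add: dist_norm D_def)
    show ?thesis
    \<comment> \<open>A rotation farther away than t |F| satisfies the bound trivially, since |sym
      F| \<le> |F|; a nearer one has small E.\<close>
    proof (cases "norm D \<le> t * norm F")
      case True
      have "transpose R ** R = mat 1" using R by (simp add: SO3_def rotation_matrix_def orthogonal_matrix)
      then have "E + transpose E + transpose E ** E = 0"
        by (simp add: RE transpose_add matrix_add_ldistrib matrix_add_rdistrib transpose_mat algebra_simps)
      then have "E + transpose E = - (transpose E ** E)"
        by (simp only: eq_neg_iff_add_eq_0)
      then have "sym_part E = - ((1/2) *\<^sub>R (transpose E ** E))"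
        by (simp add: sym_part_def)
      moreover have "sym_part E = t *\<^sub>R sym_part F - sym_part D"
        by (simp add: E_def sym_part_def transpose_diff transpose_scalar algebra_simps)
      ultimately have "t *\<^sub>R sym_part F = sym_part D - (1/2) *\<^sub>R (transpose E ** E)"
        by (simp add: algebra_simps)
      then have "t * norm (sym_part F) = norm (sym_part D - (1/2) *\<^sub>R (transpose E ** E))"
        using assms by (metis abs_of_nonneg norm_scaleR[of t "sym_part F"])
      also have "\<dots> \<le> norm (sym_part D) + norm ((1/2) *\<^sub>R (transpose E ** E))" by (rule norm_triangle_ineq4)
      also have "norm (sym_part D) \<le> norm D" by (rule norm_sym_part_le)
      also have "norm ((1/2) *\<^sub>R (transpose E ** E)) \<le> (1/2) * (norm E)\<^sup>2"
        using norm_matrix_mult_le[of "transpose E" E] by (simp add: norm_transpose power2_eq_square)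
      also have "(norm E)\<^sup>2 \<le> (2 * (t * norm F))\<^sup>2"
      proof (rule power_mono)
        show "norm E \<le> 2 * (t * norm F)"
          using norm_triangle_ineq4[of "t *\<^sub>R F" D] True assms by (simp add: E_def)
      qed simp
      finally show ?thesis unfolding d by (simp add: power_mult_distrib)
    next
      case False
      have "t * norm (sym_part F) \<le> t * norm F" using assms norm_sym_part_le by (intro mult_left_mono)
      then show ?thesis using False unfolding d by (smt (verit) mult_nonneg_nonneg zero_le_power2)
    qed
  qed
  then show ?thesis
    using ne unfolding infdist_def by (auto intro!: cINF_greatest)
qed

text \<open>If q were smaller, some m with q < m < 2 c s^2 would satisfy \<psi> u \<le> m u near 0,
  hence \<phi> t \<le> m t^2 / 2; dividing by t^2 and letting t tend to 0 contradicts the lower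
  bound. The positive part keeps the squared quantity monotone where s - C t is negative.\<close>

lemma second_derivative_ge:
  fixes \<phi> \<psi> :: "real \<Rightarrow> real"
  assumes \<delta>: "\<delta> > 0" and \<phi>: "\<And>t. \<bar>t\<bar> < \<delta> \<Longrightarrow> (\<phi> has_real_derivative \<psi> t) (at t)"
    and \<psi>: "(\<psi> has_real_derivative q) (at 0)" and 0: "\<phi> 0 = 0" "\<psi> 0 = 0"
    and lb: "\<And>t. 0 < t \<Longrightarrow> t < \<delta> \<Longrightarrow> \<phi> t \<ge> c * (t * max 0 (s - C * t))\<^sup>2"
  shows "q \<ge> 2 * c * (max 0 s)\<^sup>2"
proof (rule ccontr)
  assume "\<not> q \<ge> 2 * c * (max 0 s)\<^sup>2"
  then obtain m where m: "q < m" "m < 2 * c * (max 0 s)\<^sup>2" using dense not_le by blast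
  have "((\<lambda>t. \<psi> t / t) \<longlongrightarrow> q) (at_right 0)"
    using \<psi> 0(2) by (auto simp: DERIV_def intro: filterlim_mono at_le)
  then have "\<forall>\<^sub>F t in at_right 0. \<psi> t / t < m" using m(1) by (rule order_tendstoD)
  then obtain d where d: "d > 0" "\<And>t. 0 < t \<Longrightarrow> t < d \<Longrightarrow> \<psi> t / t < m"
    by (auto simp: eventually_at_right_field)
  have "c * (max 0 (s - C * t))\<^sup>2 \<le> m / 2" if t: "0 < t" "t < min d \<delta>" for t
  proof -
    have D: "((\<lambda>t. \<phi> t - m / 2 * t\<^sup>2) has_real_derivative \<psi> u - m * u) (at u)" if "0 \<le> u" "u \<le> t" for u
      using t that by (auto intro!: derivative_eq_intros \<phi> simp: power2_eq_square)
    have "\<phi> t - m / 2 * t\<^sup>2 \<le> \<phi> 0 - m / 2 * 0\<^sup>2"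
    proof (rule DERIV_nonpos_imp_nonincreasing[of 0 t "\<lambda>t. \<phi> t - m / 2 * t\<^sup>2"])
      show "\<exists>y. ((\<lambda>t. \<phi> t - m / 2 * t\<^sup>2) has_real_derivative y) (at u) \<and> y \<le> 0" if u: "0 \<le> u" "u \<le> t" for u
      proof (intro exI conjI)
        show "\<psi> u - m * u \<le> 0" using d(2)[of u] u t 0(2) by (cases "u = 0") (auto simp: field_simps)
      qed (rule D[OF u])
    qed (use t in simp)
    moreover have "\<phi> t \<ge> c * (t * max 0 (s - C * t))\<^sup>2" using lb t by simp
    ultimately have "t\<^sup>2 * (c * (max 0 (s - C * t))\<^sup>2) \<le> t\<^sup>2 * (m / 2)"
      using 0(1) by (simp add: power_mult_distrib mult_ac)
    then show ?thesis using t by simp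
  qed
  then have "\<forall>\<^sub>F t in at_right 0. c * (max 0 (s - C * t))\<^sup>2 \<le> m / 2"
    using d(1) \<delta> by (intro eventually_at_rightI[of 0 "min d \<delta>"]) auto
  moreover have "((\<lambda>t. c * (max 0 (s - C * t))\<^sup>2) \<longlongrightarrow> c * (max 0 (s - C * 0))\<^sup>2) (at_right 0)"
    by (intro tendsto_intros)
  ultimately have "c * (max 0 (s - C * 0))\<^sup>2 \<le> m / 2"
    by (intro tendsto_upperbound) auto
  with m(2) show False by simp
qed

section \<open>The Hessian of the stored energy at the identity\<close>

locale stored_energy =
  fixes W :: "real^3^3 \<Rightarrow> ennreal" and c :: real and U :: "(real^3^3) set"
  assumes U: "open U" "SO3 \<subseteq> U" and finite_W: "\<And>F. F \<in> U \<Longrightarrow> W F < \<infinity>"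
    and C2: "Ck_on 2 U (\<lambda>F. enn2real (W F))" and W_SO3: "\<And>R. R \<in> SO3 \<Longrightarrow> W R = 0"
    and c_pos: "c > 0" and W_ge: "\<And>F. W F \<ge> ennreal (c * (infdist F SO3)\<^sup>2)"
begin

definition "w F = enn2real (W F)"
definition "Dw u F = frechet_derivative w (at F) u"
text \<open>The first slot is differentiated first, the second slot last. Linearity and vanishing
  are established for each slot separately, without an appeal to symmetry of the Hessian.\<close>

definition "B u v = second_deriv w (mat 1) u v"

lemma w_ge: "F \<in> U \<Longrightarrow> w F \<ge> c * (infdist F SO3)\<^sup>2"
  using enn2real_mono[OF W_ge[of F]] finite_W[of F] c_pos by (simp add: w_def top.not_eq_extremum)

lemma mat_1_SO3: "mat 1 \<in> SO3"
  using cayley_SO3[of 0 0] by (simp add: cayley_def skew_def transpose_def vec_eq_iff)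

lemma w_differentiable: "F \<in> U \<Longrightarrow> w differentiable (at F)"
  and Dw_differentiable: "F \<in> U \<Longrightarrow> Dw u differentiable (at F)"
  using C2 by (auto simp: numeral_2_eq_2 w_def[abs_def] Dw_def[abs_def])

lemma w_has_derivative: "F \<in> U \<Longrightarrow> (w has_derivative (\<lambda>u. Dw u F)) (at F)"
  using w_differentiable frechet_derivative_works unfolding Dw_def by blast

lemma Dw_has_derivative: "(Dw u has_derivative B u) (at (mat 1))"
proof -
  have "Dw u differentiable (at (mat 1))" using Dw_differentiable mat_1_SO3 U by blast
  then show ?thesis
    unfolding B_def[abs_def] second_deriv_def Dw_def[abs_def] by (simp add: frechet_derivative_works)
qed

lemma w_SO3: "R \<in> SO3 \<Longrightarrow> w R = 0" by (simp add: w_def W_SO3)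

text \<open>\<open>w\<close> is nonnegative and attains its minimum 0 at every rotation.\<close>

lemma Dw_SO3: assumes "R \<in> SO3" shows "Dw u R = 0"
proof -
  have "(\<lambda>u. Dw u R) = (\<lambda>u. 0)"
    by (rule differential_zero_maxmin[OF _ U(1) w_has_derivative])
      (use assms U w_SO3 in \<open>auto simp: w_def\<close>)
  then show ?thesis by metis
qed

text \<open>In the second slot this is linearity of a derivative. In the first slot it is inherited
  from the linearity of the differential at all points of the open set \<open>U\<close>, followed by
  uniqueness of derivatives.\<close>

lemma B_linear: "linear (\<lambda>u. B u v)" "linear (B u)"
proof -
  show "linear (B u)" using Dw_has_derivative has_derivative_linear by blast
  have lin: "linear (\<lambda>u. Dw u F)" if "F \<in> U" for F
    using w_has_derivative[OF that] has_derivative_linear by blast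
  have 1: "mat 1 \<in> U" using mat_1_SO3 U by blast
  show "linear (\<lambda>u. B u v)"
  proof (rule linearI)
    fix a b
    have "(Dw (a + b) has_derivative (\<lambda>v. B a v + B b v)) (at (mat 1))"
      by (rule has_derivative_transform_within_open[OF has_derivative_add[OF Dw_has_derivative[of a] Dw_has_derivative[of b]] U(1) 1])
        (simp add: linear_add[OF lin])
    then show "B (a + b) v = B a v + B b v"
      using has_derivative_unique[OF Dw_has_derivative] by metis
  next
    fix r a
    have "(Dw (r *\<^sub>R a) has_derivative (\<lambda>v. r *\<^sub>R B a v)) (at (mat 1))"
      by (rule has_derivative_transform_within_open[OF has_derivative_scaleR_right[OF Dw_has_derivative[of a]] U(1) 1])
        (simp add: linear_scale[OF lin])
    then show "B (r *\<^sub>R a) v = r *\<^sub>R B a v"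
      using has_derivative_unique[OF Dw_has_derivative] by metis
  qed
qed

text \<open>Every skew matrix is tangent to the rotations at the identity through
  \<open>cayley\<close>, and the first differential vanishes along that curve.\<close>

lemma B_skew: assumes "skew K" shows "B u K = 0"
proof -
  have "(cayley K has_derivative (\<lambda>h. h *\<^sub>R (2 *\<^sub>R K))) (at 0)"
    using cayley_has_derivative by (simp add: has_vector_derivative_def)
  then have "((\<lambda>t. Dw u (cayley K t)) has_derivative (\<lambda>h. B u (h *\<^sub>R (2 *\<^sub>R K)))) (at 0)"
    by (rule has_derivative_compose) (simp add: cayley_0 Dw_has_derivative)
  moreover have "(\<lambda>t. Dw u (cayley K t)) = (\<lambda>t. 0)"
    using Dw_SO3[OF cayley_SO3[OF assms]] by auto
  ultimately have "(\<lambda>h. B u (h *\<^sub>R (2 *\<^sub>R K))) = (\<lambda>h. 0)"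
    using has_derivative_unique[OF _ has_derivative_const] by metis
  then have "B u ((1/2) *\<^sub>R (2 *\<^sub>R K)) = 0" by metis
  then show ?thesis by simp
qed

lemma B_ge: "B F F \<ge> 2 * c * (norm (sym_part F))\<^sup>2"
proof -
  have 1: "mat 1 \<in> U" using mat_1_SO3 U by blast
  have "((\<lambda>t. mat 1 + t *\<^sub>R F) \<longlongrightarrow> mat 1 + 0 *\<^sub>R F) (nhds 0)"
    by (intro tendsto_intros filterlim_ident)
  then have "\<forall>\<^sub>F t in nhds 0. mat 1 + t *\<^sub>R F \<in> U"
    using 1 U(1) by (auto dest: topological_tendstoD)
  then obtain \<delta> where \<delta>: "\<delta> > 0" "\<And>t. \<bar>t\<bar> < \<delta> \<Longrightarrow> mat 1 + t *\<^sub>R F \<in> U"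
    by (auto simp: eventually_nhds_metric dist_real_def)
  have line: "((\<lambda>t. mat 1 + t *\<^sub>R F) has_derivative (\<lambda>h. h *\<^sub>R F)) (at t)" for t
    by (auto intro!: derivative_eq_intros)
  have lin: "linear (\<lambda>u. Dw u F')" if "F' \<in> U" for F'
    using w_has_derivative[OF that] has_derivative_linear by blast
  have "B F F \<ge> 2 * c * (max 0 (norm (sym_part F)))\<^sup>2"
  proof (rule second_derivative_ge[OF \<delta>(1)])
    show "((\<lambda>t. w (mat 1 + t *\<^sub>R F)) has_real_derivative Dw F (mat 1 + t *\<^sub>R F)) (at t)" if "\<bar>t\<bar> < \<delta>" for t
      using has_derivative_compose[OF line w_has_derivative[OF \<delta>(2)[OF that]]] linear_scale[OF lin[OF \<delta>(2)[OF that]]]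
      by (simp add: has_field_derivative_def mult_commute_abs)
    have "(Dw F has_derivative B F) (at (mat 1 + 0 *\<^sub>R F))" using Dw_has_derivative by simp
    from has_derivative_compose[OF line this]
    show "((\<lambda>t. Dw F (mat 1 + t *\<^sub>R F)) has_real_derivative B F F) (at 0)"
      using linear_scale[OF B_linear(2)] by (simp add: has_field_derivative_def mult_commute_abs)
    show "w (mat 1 + 0 *\<^sub>R F) = 0" "Dw F (mat 1 + 0 *\<^sub>R F) = 0"
      using w_SO3[OF mat_1_SO3] Dw_SO3[OF mat_1_SO3] by simp_all
    fix t :: real assume t: "0 < t" "t < \<delta>"
    have "t * max 0 (norm (sym_part F) - 2 * (norm F)\<^sup>2 * t) \<le> infdist (mat 1 + t *\<^sub>R F) SO3"
      using infdist_SO3_ge[of t F] t infdist_nonneg[of "mat 1 + t *\<^sub>R F" SO3]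
      by (auto simp: max_def right_diff_distrib power2_eq_square mult_ac)
    then have "c * (t * max 0 (norm (sym_part F) - 2 * (norm F)\<^sup>2 * t))\<^sup>2 \<le> c * (infdist (mat 1 + t *\<^sub>R F) SO3)\<^sup>2"
      using t c_pos by (intro mult_left_mono power_mono) auto
    also have "\<dots> \<le> w (mat 1 + t *\<^sub>R F)" using t by (intro w_ge \<delta>(2)) auto
    finally show "c * (t * max 0 (norm (sym_part F) - 2 * (norm F)\<^sup>2 * t))\<^sup>2 \<le> w (mat 1 + t *\<^sub>R F)" .
  qed
  then show ?thesis by simp
qed

lemma Q3_eq: "Q3 W F = B F F"
  by (simp add: Q3_def B_def w_def[abs_def])

end

text \<open>The hypothesis kills a skew matrix in the second slot only. Along S + tK the form is
  therefore affine in t, and being nonnegative it must have slope \<open>B K S\<close> = 0.\<close>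

lemma quadratic_form_skew_invariant:
  fixes B :: "real^'n^'n \<Rightarrow> real^'n^'n \<Rightarrow> real"
  assumes B: "bilinear B" and sk: "\<And>u K. skew K \<Longrightarrow> B u K = 0" and nn: "\<And>F. B F F \<ge> 0"
    and K: "skew K"
  shows "B (S + K) (S + K) = B S S"
proof -
  have e: "B (S + t *\<^sub>R K) (S + t *\<^sub>R K) = B S S + t * B K S" for t
    using sk[OF K] by (simp add: bilinear_ladd[OF B] bilinear_radd[OF B] bilinear_lmul[OF B] bilinear_rmul[OF B])
  have "B K S = 0"
  proof (rule ccontr)
    assume "B K S \<noteq> 0"
    \<comment> \<open>This parameter is chosen so that the affine function takes the value
      -1.\<close>
    then have "B (S + (- (B S S + 1) / B K S) *\<^sub>R K) (S + (- (B S S + 1) / B K S) *\<^sub>R K) = -1"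
      unfolding e by simp
    then show False using nn by (metis not_one_le_zero neg_0_le_iff_le)
  qed
  then show ?thesis using e[of 1] by simp
qed

lemma block22_component: "block22 F $ 1 $ 1 = F $ 1 $ 1" "block22 F $ 1 $ 2 = F $ 1 $ 2"
  "block22 F $ 2 $ 1 = F $ 2 $ 1" "block22 F $ 2 $ 2 = F $ 2 $ 2"
  by (simp_all add: block22_def)

lemma block22_simps:
  "block22 (F + H) = block22 F + block22 H" "block22 (F - H) = block22 F - block22 H"
  "block22 (r *\<^sub>R F) = r *\<^sub>R block22 F" "block22 (transpose F) = transpose (block22 F)"
  by (simp_all add: vec_eq_iff forall_2 block22_component transpose_def)

lemma block22_sym_part: "block22 (sym_part F) = sym_part (block22 F)"
  by (simp add: sym_part_def block22_simps)

lemma norm_block22_le: "norm (block22 F) \<le> norm F"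
proof (rule power2_le_imp_le)
  show "(norm (block22 F))\<^sup>2 \<le> (norm F)\<^sup>2"
    unfolding norm_matrix_power2 by (simp add: sum_2 sum_3 block22_component)
qed simp

lemma obtain_skew_block22:
  assumes "skew K" obtains K' where "skew K'" "block22 K' = K"
proof -
  have t: "transpose K $ i $ j = (- K) $ i $ j" for i j
    using assms by (simp only: skew_def)
  note neg = t[unfolded transpose_def vec_lambda_beta vector_uminus_component]
  have "K $ i $ i = 0" for i using neg[of i i] by linarith
  with neg[of 1 2] show ?thesis
    by (intro that[of "vector [vector [0, K$1$2, 0], vector [- K$1$2, 0, 0], vector [0, 0, 0]]"])
      (simp_all add: skew_def vec_eq_iff forall_2 forall_3 transpose_def block22_component)
qed

text \<open>The form is degenerate along skew matrices, so compactness fails on the full set of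
  competitors. Replacing each by its symmetric part keeps the value and makes the form coercive; the
  skew part of the prescribed block is restored at the end by adding \<open>K\<close>.\<close>

lemma quadratic_form_block_min:
  fixes B :: "real^3^3 \<Rightarrow> real^3^3 \<Rightarrow> real"
  assumes B: "bilinear B" and sk: "\<And>u K. skew K \<Longrightarrow> B u K = 0"
    and \<kappa>: "\<kappa> > 0" "\<And>F. B F F \<ge> \<kappa> * (norm (sym_part F))\<^sup>2"
  obtains F' where "block22 F' = F" "\<And>H. block22 H = F \<Longrightarrow> B F' F' \<le> B H H"
proof -
  have nn: "B F F \<ge> 0" for F using \<kappa>(1) \<kappa>(2)[of F] by (meson mult_nonneg_nonneg less_imp_le order_trans zero_le_power2)
  have inv: "B H H = B (sym_part H) (sym_part H)" for H
    using quadratic_form_skew_invariant[OF B sk nn, of "H - sym_part H" "sym_part H"] sym_part_skew[of H]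
    by (simp add: skew_def)
  obtain K where K: "skew K" "block22 K = F - sym_part F"
    using obtain_skew_block22[of "F - sym_part F"] sym_part_skew[of F] by (auto simp: skew_def)
  define T where "T = {S. transpose S = S \<and> block22 S = sym_part F}"
  define S0 :: "real^3^3" where "S0 = vector [vector [F$1$1, sym_part F$1$2, 0], vector [sym_part F$1$2, F$2$2, 0], vector [0,0,0]]"
  have S0: "S0 \<in> T" 
    by (simp add: T_def S0_def vec_eq_iff forall_2 forall_3 transpose_def block22_component sym_part_def)
  \<comment> \<open>Outside this radius coercivity already forces values of at least
    \<open>B S0 S0\<close>, and \<open>S0\<close> itself lies inside.\<close>
  define R where "R = max (norm S0) (sqrt (B S0 S0 / \<kappa>))"
  have bb: "bounded_bilinear B" using B by (simp add: bilinear_conv_bounded_bilinear)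
  have "closed T"
  proof -
    have "linear (transpose :: real^3^3 \<Rightarrow> _)" "linear block22"
      by (rule linearI; simp add: transpose_add transpose_scalar block22_simps)+
    then have "bounded_linear (transpose :: real^3^3 \<Rightarrow> _)" "bounded_linear block22"
      by (simp_all add: linear_conv_bounded_linear)
    then show ?thesis unfolding T_def
      by (intro closed_Collect_conj closed_Collect_eq linear_continuous_on continuous_on_id continuous_on_const)
  qed
  then have "compact (T \<inter> cball 0 R)" by (simp add: closed_Int_compact)
  moreover have "S0 \<in> T \<inter> cball 0 R" using S0 by (simp add: R_def)
  moreover have "continuous_on (T \<inter> cball 0 R) (\<lambda>S. B S S)"
    by (intro bounded_bilinear.continuous_on[OF bb] continuous_on_id)
  ultimately have "\<exists>x\<in>T \<inter> cball 0 R. \<forall>y\<in>T \<inter> cball 0 R. B x x \<le> B y y"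
    by (intro continuous_attains_inf) blast+
  then obtain S where S: "S \<in> T" "\<And>S'. S' \<in> T \<Longrightarrow> norm S' \<le> R \<Longrightarrow> B S S \<le> B S' S'"
    by (metis IntE IntI mem_cball_0)
  have min: "B S S \<le> B S' S'" if S': "S' \<in> T" for S'
  proof (cases "norm S' \<le> R")
    case False
    then have "sqrt (B S0 S0 / \<kappa>) \<le> norm S'" by (simp add: R_def)
    then have "B S0 S0 / \<kappa> \<le> (norm S')\<^sup>2" by (metis norm_ge_zero real_le_lsqrt real_sqrt_le_iff real_sqrt_unique sqrt_le_D)
    then have "B S0 S0 \<le> \<kappa> * (norm S')\<^sup>2" using \<kappa>(1) by (simp add: field_simps)
    also have "\<dots> \<le> B S' S'" using \<kappa>(2)[of S'] S' by (simp add: T_def sym_part_eq)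
    finally show ?thesis using S(2)[OF S0] by (simp add: R_def)
  qed (use S(2) S' in auto)
  show ?thesis
  proof (rule that[of "S + K"])
    show "block22 (S + K) = F" using S(1) K(2) by (simp add: block22_simps T_def)
    fix H assume "block22 H = F"
    then have "sym_part H \<in> T" by (simp add: T_def sym_part_symmetric block22_sym_part)
    then have "B S S \<le> B H H" using min inv by metis
    then show "B (S + K) (S + K) \<le> B H H"
      using quadratic_form_skew_invariant[OF B sk nn K(1), of S] by simp
  qed
qed

section \<open>Square roots of positive definite matrices\<close>

lemma symmetric_inner:
  fixes G :: "real^'n^'n"
  assumes "transpose G = G" shows "(G *v u) \<bullet> v = u \<bullet> (G *v v)"
  using dot_lmul_matrix[of u G v] transpose_matrix_vector[of G u] assms by simp

text \<open>The constant is the minimum of the quadratic form on the unit sphere.\<close>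

lemma spd_lower_bound:
  fixes G :: "real^'n^'n"
  assumes "spd G"
  obtains m where "m > 0" "\<And>v. m * (v \<bullet> v) \<le> v \<bullet> (G *v v)"
proof -
  have "axis undefined 1 \<in> sphere (0 :: real^'n) 1" by simp
  then have "\<exists>x\<in>sphere (0::real^'n) 1. \<forall>y\<in>sphere 0 1. x \<bullet> (G *v x) \<le> y \<bullet> (G *v y)"
    by (intro continuous_attains_inf compact_sphere continuous_intros linear_continuous_on matrix_vector_mul_bounded_linear) blast+
  then obtain x :: "real^'n" where x: "norm x = 1" "\<And>y. norm y = 1 \<Longrightarrow> x \<bullet> (G *v x) \<le> y \<bullet> (G *v y)"
    by auto
  have "x \<noteq> 0" using x(1) by auto
  then have "x \<bullet> (G *v x) > 0" using assms by (simp add: spd_def)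
  moreover have "x \<bullet> (G *v x) * (v \<bullet> v) \<le> v \<bullet> (G *v v)" for v
  proof (cases "v = 0")
    case False
    have "x \<bullet> (G *v x) \<le> (v /\<^sub>R norm v) \<bullet> (G *v (v /\<^sub>R norm v))" using False by (intro x(2)) simp
    also have "\<dots> = (v \<bullet> (G *v v)) / (v \<bullet> v)"
      by (simp add: matrix_vector_mult_scaleR dot_square_norm power2_eq_square divide_inverse mult_ac)
    finally show ?thesis using False by (simp add: field_simps)
  qed simp
  ultimately show ?thesis using that by blast
qed

text \<open>Polarization gives u . X v \<le> r (|u|^2 + |v|^2) / 2; the choice of \<open>u\<close>
  as \<open>X v\<close> rescaled to the length of \<open>v\<close> turns this into the operator
  bound.\<close>

lemma symmetric_blinfun_norm_le:
  fixes X :: "'a::euclidean_space \<Rightarrow>\<^sub>L 'a"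
  assumes sym: "\<And>u v. X u \<bullet> v = u \<bullet> X v" and b: "\<And>v. \<bar>v \<bullet> X v\<bar> \<le> r * (v \<bullet> v)" and "r \<ge> 0"
  shows "norm X \<le> r"
proof (rule norm_blinfun_bound[OF \<open>r \<ge> 0\<close>])
  fix v
  have pol: "4 * (u \<bullet> X v) \<le> 2 * r * (u \<bullet> u + v \<bullet> v)" for u
  proof -
    have "4 * (u \<bullet> X v) = (u + v) \<bullet> X (u + v) - (u - v) \<bullet> X (u - v)"
      using sym[of u v] by (simp add: blinfun.add_right blinfun.diff_right inner_add_left inner_add_right
          inner_diff_left inner_diff_right inner_commute)
    also have "\<dots> \<le> r * ((u + v) \<bullet> (u + v)) + r * ((u - v) \<bullet> (u - v))"
      using b[of "u + v"] b[of "u - v"] by linarith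
    also have "\<dots> = 2 * r * (u \<bullet> u + v \<bullet> v)"
      by (simp add: inner_add_left inner_add_right inner_diff_left inner_diff_right inner_commute algebra_simps)
    finally show ?thesis .
  qed
  show "norm (X v) \<le> r * norm v"
  proof (cases "X v = 0 \<or> v = 0")
    case False
    define u where "u = (norm v / norm (X v)) *\<^sub>R X v"
    have "u \<bullet> u = (norm v)\<^sup>2"
      using False by (simp add: u_def dot_square_norm power2_eq_square)
    moreover have "u \<bullet> X v = norm v * norm (X v)"
      using False by (simp add: u_def dot_square_norm power2_eq_square)
    ultimately have "norm v * norm (X v) \<le> norm v * (r * norm v)"
      using pol[of u] by (simp add: dot_square_norm power2_eq_square algebra_simps)
    then show ?thesis using False by simp
  qed (use \<open>r \<ge> 0\<close> in auto)
qed

text \<open>With \<open>X = 1 - G/\<mu>\<close>, the matrix \<open>\<surd>\<mu> (1 - T)\<close> is a root of \<open>G\<close> iff \<open>T = (X + T\<^sup>2) / 2\<close>,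
  which is a contraction on the symmetric operators of norm at most \<open>|X| < 1\<close>.\<close>

lemma spd_sqrt_exists:
  fixes G :: "real^'n^'n"
  assumes "spd G" shows "\<exists>A. spd A \<and> A ** A = G"
proof -
  have Gs: "transpose G = G" using assms by (simp add: spd_def)
  obtain m where m: "m > 0" "\<And>v. m * (v \<bullet> v) \<le> v \<bullet> (G *v v)" using spd_lower_bound[OF assms] by blast
  obtain k where k: "k > 0" "\<And>v. norm (G *v v) \<le> norm v * k"
    using bounded_linear.pos_bounded[OF matrix_vector_mul_bounded_linear[of G]] by blast
  \<comment> \<open>With \<open>k\<close> below \<mu> the form of \<open>G\<close> is at most \<mu>
    times the identity, and with \<open>m\<close> below \<mu> the number r = 1 - m/\<mu> is
    nonnegative; so the quadratic form of \<open>X\<close> lies between 0 and r.\<close>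
  define \<mu> where "\<mu> = max k m"
  have \<mu>: "\<mu> > 0" "m \<le> \<mu>" using k(1) m(1) by (auto simp: \<mu>_def)
  have up: "v \<bullet> (G *v v) \<le> \<mu> * (v \<bullet> v)" for v
  proof -
    have "v \<bullet> (G *v v) \<le> norm v * norm (G *v v)" by (rule norm_cauchy_schwarz)
    also have "\<dots> \<le> norm v * (norm v * \<mu>)"
    proof (rule mult_left_mono)
      have "norm v * k \<le> norm v * \<mu>" by (intro mult_left_mono) (auto simp: \<mu>_def)
      then show "norm (G *v v) \<le> norm v * \<mu>" using k(2)[of v] by linarith
    qed simp
    finally show ?thesis by (simp add: dot_square_norm power2_eq_square mult_ac)
  qed
  define r where "r = 1 - m / \<mu>"
  have r: "0 \<le> r" "r < 1" using \<mu> m(1) by (auto simp: r_def)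
  define X where "X = Blinfun (\<lambda>v. v - (1 / \<mu>) *\<^sub>R (G *v v))"
  have X: "X v = v - (1 / \<mu>) *\<^sub>R (G *v v)" for v
    unfolding X_def by (subst bounded_linear_Blinfun_apply) (auto intro!: bounded_linear_intros)
  have Xs: "X u \<bullet> v = u \<bullet> X v" for u v
    using symmetric_inner[OF Gs, of u v] by (simp add: X inner_diff_left inner_diff_right)
  have Xb: "\<bar>v \<bullet> X v\<bar> \<le> r * (v \<bullet> v)" for v
  proof -
    have "v \<bullet> X v = v \<bullet> v - (v \<bullet> (G *v v)) / \<mu>" by (simp add: X inner_diff_right)
    moreover have "(v \<bullet> (G *v v)) / \<mu> \<le> v \<bullet> v" using up[of v] \<mu>(1) by (simp add: field_simps)
    moreover have "m / \<mu> * (v \<bullet> v) \<le> (v \<bullet> (G *v v)) / \<mu>" using m(2)[of v] \<mu>(1) by (simp add: field_simps)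
    ultimately show ?thesis by (simp add: r_def left_diff_distrib)
  qed
  have Xn: "norm X \<le> r" by (rule symmetric_blinfun_norm_le[OF Xs Xb r(1)])
  \<comment> \<open>Symmetry and the norm bound are closed conditions, so \<open>S\<close> is
    complete, and the fixed point inherits both.\<close>
  define S where "S = {T. norm T \<le> r \<and>
    (\<forall>u v. blinfun_apply T u \<bullet> v = u \<bullet> blinfun_apply T (v :: real^'n))}"
  define \<Phi> where "\<Phi> = (\<lambda>T :: (real^'n) \<Rightarrow>\<^sub>L (real^'n). (1/2) *\<^sub>R (X + (T o\<^sub>L T)))"
  have "\<exists>!T\<in>S. \<Phi> T = T"
  proof (rule Banach_fix[OF _ _ r])
    have "closed S" unfolding S_def
      by (intro closed_Collect_conj closed_Collect_all closed_Collect_le closed_Collect_eq continuous_intros)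
    then show "complete S" by (rule complete_eq_closed[THEN iffD2])
    show "S \<noteq> {}" using Xn Xs by (auto simp: S_def)
    show "\<Phi> ` S \<subseteq> S"
    proof (rule image_subsetI)
      fix T assume T: "T \<in> S"
      have "norm (\<Phi> T) \<le> (1/2) * (norm X + norm (T o\<^sub>L T))"
        using norm_triangle_ineq[of X "T o\<^sub>L T"] by (simp add: \<Phi>_def)
      also have "norm (T o\<^sub>L T) \<le> r * r"
      proof (rule order_trans[OF norm_blinfun_compose])
        show "norm T * norm T \<le> r * r" using T r(1) by (intro mult_mono) (auto simp: S_def)
      qed
      also have "r * r \<le> r" using r by (simp add: mult_left_le)
      finally have "norm (\<Phi> T) \<le> r" using Xn by simp
      moreover have "\<Phi> T u \<bullet> v = u \<bullet> \<Phi> T v" for u v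
        using T Xs by (simp add: \<Phi>_def S_def blinfun.scaleR_left blinfun.add_left inner_add_left inner_add_right)
      ultimately show "\<Phi> T \<in> S" by (simp add: S_def)
    qed
    show "dist (\<Phi> T) (\<Phi> T') \<le> r * dist T T'" if TT: "T \<in> S" "T' \<in> S" for T T'
    proof -
      \<comment> \<open>The factorization T^2 - T'^2 = T (T - T') + (T - T') T' avoids commutativity
        and yields the contraction factor r.\<close>
      have "\<Phi> T - \<Phi> T' = (1/2) *\<^sub>R ((T o\<^sub>L (T - T')) + ((T - T') o\<^sub>L T'))"
        by (rule blinfun_eqI) (simp add: \<Phi>_def blinfun.bilinear_simps algebra_simps)
      then have "norm (\<Phi> T - \<Phi> T') \<le> (1/2) * (norm (T o\<^sub>L (T - T')) + norm ((T - T') o\<^sub>L T'))"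
        using norm_triangle_ineq by simp
      also have "norm (T o\<^sub>L (T - T')) \<le> r * norm (T - T')"
        by (rule order_trans[OF norm_blinfun_compose]) (use TT in \<open>auto simp: S_def intro: mult_right_mono\<close>)
      also have "norm ((T - T') o\<^sub>L T') \<le> norm (T - T') * r"
        by (rule order_trans[OF norm_blinfun_compose]) (use TT in \<open>auto simp: S_def intro: mult_left_mono\<close>)
      finally show ?thesis by (simp add: dist_norm mult_ac)
    qed
  qed
  then obtain T :: "(real^'n) \<Rightarrow>\<^sub>L (real^'n)" where T: "norm T \<le> r" "\<And>u v. T u \<bullet> v = u \<bullet> T v" "\<Phi> T = T" by (auto simp: S_def)
  have fp: "2 *\<^sub>R T v = X v + T (T v)" for v
  proof -
    have "2 *\<^sub>R \<Phi> T v = X v + T (T v)" by (simp add: \<Phi>_def blinfun.scaleR_left blinfun.add_left)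
    then show ?thesis unfolding T(3) .
  qed
  define A where "A = matrix (\<lambda>v. sqrt \<mu> *\<^sub>R (v - T v))"
  have lin: "linear (\<lambda>v. sqrt \<mu> *\<^sub>R (v - T v))"
    by (rule linearI) (simp_all add: blinfun.bilinear_simps algebra_simps)
  have A: "A *v v = sqrt \<mu> *\<^sub>R (v - T v)" for v
    unfolding A_def using lin by (intro matrix_works) (simp add: linear_matrix_vector_mul_eq)
  have "(A ** A) *v v = G *v v" for v
  proof -
    \<comment> \<open>The fixed point equation says (1 - T)^2 = 1 - X, which is G/\<mu>.\<close>
    have "(A ** A) *v v = (sqrt \<mu> * sqrt \<mu>) *\<^sub>R (v - 2 *\<^sub>R T v + T (T v))"
      by (simp add: matrix_vector_mul_assoc[symmetric] A blinfun.bilinear_simps algebra_simps scaleR_2)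
    also have "\<dots> = \<mu> *\<^sub>R (v - X v)" unfolding fp using \<mu>(1) by simp
    also have "\<dots> = G *v v" using \<mu>(1) by (simp add: X)
    finally show ?thesis .
  qed
  then have "A ** A = G" by (simp add: matrix_eq)
  moreover have "spd A"
  proof -
    have "(A *v u) \<bullet> v = u \<bullet> (A *v v)" for u v
      using T(2)[of u v] by (simp add: A inner_diff_left inner_diff_right)
    then have "u \<bullet> (transpose A *v v) = u \<bullet> (A *v v)" for u v
      using dot_lmul_matrix[of v A u] transpose_matrix_vector[of A v] by (metis inner_commute)
    then have "transpose A *v v = A *v v" for v by (metis vector_eq_ldot)
    then have "transpose A = A" unfolding matrix_eq by (intro allI)
    moreover have "v \<bullet> (A *v v) > 0" if "v \<noteq> 0" for v
    proof -
      have "v \<bullet> T v \<le> norm v * (norm T * norm v)"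
        using norm_cauchy_schwarz[of v "T v"] norm_blinfun[of T v] by (meson mult_left_mono norm_ge_zero order_trans)
      also have "\<dots> \<le> norm v * (r * norm v)" using T(1) by (intro mult_left_mono mult_right_mono) auto
      also have "\<dots> < v \<bullet> v" using r(2) that by (simp add: dot_square_norm power2_eq_square)
      finally show ?thesis using \<mu>(1) by (simp add: A inner_diff_right)
    qed
    ultimately show ?thesis by (simp add: spd_def)
  qed
  ultimately show ?thesis by blast
qed

lemma trace_conjugate:
  fixes A D :: "real^'n^'n"
  assumes "transpose D = D"
  shows "trace (D ** A ** D) = (\<Sum>i\<in>UNIV. (D $ i) \<bullet> (A *v (D $ i)))"
proof -
  have s: "D $ i $ j = D $ j $ i" for i j using assms by (metis transpose_def vec_lambda_beta)
  have "(D ** A ** D) $ i $ i = (D $ i) \<bullet> (A *v (D $ i))" for i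
    unfolding matrix_mul_assoc[symmetric]
    by (simp add: matrix_matrix_mult_def matrix_vector_mult_def inner_vec_def s[of _ i])
  then show ?thesis by (simp add: trace_def)
qed

text \<open>For D = A - B, equality of the squares gives AD + DB = 0. Multiplying by D and taking
  traces makes the sum of tr(DAD) and tr(DBD) zero; both are sums of nonnegative quadratic forms in
  the rows of D.\<close>

lemma spd_sqrt_unique:
  fixes A B :: "real^'n^'n"
  assumes "spd A" "spd B" "A ** A = B ** B" shows "A = B"
proof -
  define D where "D = A - B"
  have D: "transpose D = D" using assms by (simp add: D_def spd_def transpose_diff)
  have z: "A ** D + D ** B = 0"
    using assms(3) by (simp add: D_def matrix_diff_ldistrib matrix_diff_rdistrib)
  have "trace (D ** (A ** D)) + trace (D ** (D ** B)) = trace (D ** (A ** D + D ** B))"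
    by (simp add: matrix_add_ldistrib trace_add)
  also have "\<dots> = 0" unfolding z by (simp add: trace_def matrix_matrix_mult_def)
  also have "trace (D ** (D ** B)) = trace (D ** B ** D)" by (rule trace_mul_sym)
  finally have sum0: "(\<Sum>i\<in>UNIV. (D $ i) \<bullet> (A *v (D $ i)) + (D $ i) \<bullet> (B *v (D $ i))) = 0"
    by (simp add: matrix_mul_assoc trace_conjugate[OF D] sum.distrib)
  have nn: "(D $ i) \<bullet> (A *v (D $ i)) \<ge> 0" "(D $ i) \<bullet> (B *v (D $ i)) \<ge> 0" for i
    using assms unfolding spd_def by (cases "D $ i = 0"; force intro: less_imp_le)+
  have "(D $ i) \<bullet> (A *v (D $ i)) = 0" for i
    using sum0 nn by (subst (asm) sum_nonneg_eq_0_iff) (auto simp: add_nonneg_eq_0_iff)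
  then have "D $ i = 0" for i using assms(1) unfolding spd_def by (metis less_irrefl)
  then show ?thesis by (simp add: D_def vec_eq_iff)
qed

lemma mat_sqrt:
  assumes "spd G" shows "spd (mat_sqrt G)" "mat_sqrt G ** mat_sqrt G = G"
proof -
  obtain A where "spd A \<and> A ** A = G" using spd_sqrt_exists[OF assms] by blast
  then have "\<exists>!A. spd A \<and> A ** A = G" using spd_sqrt_unique by metis
  from theI'[OF this] show "spd (mat_sqrt G)" "mat_sqrt G ** mat_sqrt G = G"
    by (simp_all add: mat_sqrt_def)
qed

lemma norm_spd_sqrt: 
  fixes A :: "real^'n^'n"
  assumes "spd A" shows "(norm A)\<^sup>2 = trace (A ** A)"
proof -
  have s: "A $ i $ j = A $ j $ i" for i j using assms unfolding spd_def by (metis transpose_def vec_lambda_beta)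
  show ?thesis unfolding norm_matrix_power2
    by (auto simp: trace_def matrix_matrix_mult_def power2_eq_square intro!: sum.cong arg_cong2[of _ _ _ _ "(*)"] s)
qed

lemma spd_inv:
  fixes A :: "real^'n^'n"
  assumes "spd A"
  shows "invertible A" "A ** matrix_inv A = mat 1" "matrix_inv A ** A = mat 1" "transpose (matrix_inv A) = matrix_inv A"
proof -
  have "A *v v = 0 \<Longrightarrow> v = 0" for v using assms unfolding spd_def by (metis inner_zero_right less_irrefl)
  then show inv: "invertible A" by (simp add: invertible_left_inverse matrix_left_invertible_ker)
  then obtain A' where "A ** A' = mat 1 \<and> A' ** A = mat 1" by (auto simp: invertible_def)
  then have i: "A ** matrix_inv A = mat 1 \<and> matrix_inv A ** A = mat 1"
    unfolding matrix_inv_def by (rule someI)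
  then show i1: "A ** matrix_inv A = mat 1" and i2: "matrix_inv A ** A = mat 1" by auto
  have "transpose (matrix_inv A) ** A = mat 1"
    using arg_cong[OF i1, of transpose] assms by (simp add: matrix_transpose_mul spd_def)
  then have "transpose (matrix_inv A) ** (A ** matrix_inv A) = matrix_inv A"
    by (simp add: matrix_mul_assoc)
  then show "transpose (matrix_inv A) = matrix_inv A" by (simp add: i1)
qed

section \<open>Coercivity and kernel of the reduced quadratic form\<close>

context stored_energy
begin

text \<open>With M = A^-1 one has sym F = A sym(M F M) A, so |sym F| \<le> |A|^2 |sym(M F M)|, and
  |A|^2 = trace G. Squaring this in the Hessian bound produces the constant; passing to the block
  only decreases the norm.\<close>

lemma Q2_properties:
  assumes "spd (G x)"
  shows "Q2 W G x F \<ge> 2 * c / (trace (G x))\<^sup>2 * (norm (sym_part F))\<^sup>2"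
    and "sym_part F = 0 \<Longrightarrow> Q2 W G x F = 0"
proof -
  define A where "A = mat_sqrt (G x)"
  define M where "M = matrix_inv A"
  have A: "spd A" "A ** A = G x" using mat_sqrt[OF assms] by (simp_all add: A_def)
  have M: "A ** M = mat 1" "M ** A = mat 1" "transpose M = M" using spd_inv[OF A(1)] by (simp_all add: M_def)
  define p where "p = (\<lambda>u v. B (M ** u ** M) (M ** v ** M))"
  have conj: "linear (\<lambda>u. M ** u ** M)"
    by (rule linearI) (simp_all add: matrix_add_ldistrib matrix_add_rdistrib scaleR_matrix_assoc matrix_scaleR_assoc)
  have p: "bilinear p"
    using linear_compose[OF conj B_linear(1)] linear_compose[OF conj B_linear(2)]
    by (simp add: p_def bilinear_def o_def)
  have pK: "p u K = 0" if "skew K" for u K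
    unfolding p_def using that M(3)
    using linear_neg[OF conj, of K]
    by (intro B_skew) (simp add: skew_def matrix_transpose_mul matrix_mul_assoc)
  have tr: "(norm A)\<^sup>2 = trace (G x)" using norm_spd_sqrt[OF A(1)] A(2) by simp
  have "A \<noteq> 0"
  proof
    assume "A = 0"
    then have "mat 1 = (0 :: real^3^3)" using M(1) by (simp add: matrix_matrix_mult_def vec_eq_iff)
    then have "(mat 1 :: real^3^3) $ 1 $ 1 = 0" by simp
    then show False by (simp add: mat_def)
  qed
  then have tr0: "trace (G x) > 0" using tr by (metis norm_eq_zero zero_less_power2)
  define \<kappa> where "\<kappa> = 2 * c / (trace (G x))\<^sup>2"
  have \<kappa>: "\<kappa> > 0" using tr0 c_pos by (simp add: \<kappa>_def)
  have pg: "p F F \<ge> \<kappa> * (norm (sym_part F))\<^sup>2" for F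
  proof -
    define S where "S = sym_part (M ** F ** M)"
    have "A ** S ** A = (A ** M) ** sym_part F ** (M ** A)"
      by (simp add: S_def sym_part_conjugate[OF M(3)] matrix_mul_assoc)
    then have "sym_part F = A ** S ** A" by (simp add: M)
    then have "norm (sym_part F) \<le> norm A * norm S * norm A"
      using order_trans[OF norm_matrix_mult_le[of "A ** S" A] mult_right_mono[OF norm_matrix_mult_le[of A S] norm_ge_zero]]
      by simp
    then have "norm (sym_part F) \<le> trace (G x) * norm S" unfolding tr[symmetric] power2_eq_square by (simp add: mult_ac)
    then have "(norm (sym_part F))\<^sup>2 \<le> (trace (G x) * norm S)\<^sup>2" by (intro power_mono) auto
    then have "\<kappa> * (norm (sym_part F))\<^sup>2 \<le> \<kappa> * (trace (G x) * norm S)\<^sup>2" using \<kappa> by (intro mult_left_mono) auto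
    also have "\<dots> = 2 * c * (norm S)\<^sup>2" using tr0 by (simp add: \<kappa>_def power_mult_distrib)
    also have "\<dots> \<le> p F F" using B_ge[of "M ** F ** M"] by (simp add: p_def S_def)
    finally show ?thesis .
  qed
  obtain F' where F': "block22 F' = F" "\<And>H. block22 H = F \<Longrightarrow> p F' F' \<le> p H H"
    using quadratic_form_block_min[OF p pK \<kappa> pg] by blast
  have Q2: "Q2 W G x F = (LEAST q. \<exists>F'. block22 F' = F \<and> q = p F' F')"
    by (simp add: Q2_def Q3_eq p_def A_def M_def)
  have Q2F: "Q2 W G x F = p F' F'"
    unfolding Q2 by (rule Least_equality) (use F' in auto)
  have "\<kappa> * (norm (sym_part F))\<^sup>2 \<le> \<kappa> * (norm (sym_part F'))\<^sup>2"
    using norm_block22_le[of "sym_part F'"] \<kappa> F'(1)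
    by (intro mult_left_mono power_mono) (auto simp: block22_sym_part)
  then show "Q2 W G x F \<ge> 2 * c / (trace (G x))\<^sup>2 * (norm (sym_part F))\<^sup>2"
    using pg[of F'] Q2F by (simp add: \<kappa>_def)
  show "Q2 W G x F = 0" if "sym_part F = 0"
  proof -
    \<comment> \<open>A skew block extends by zeros to a skew 3 by 3 matrix, which is a competitor
      of energy 0.\<close>
    have "skew F" using sym_part_skew[of F] that by (simp add: skew_def)
    then obtain K where K: "skew K" "block22 K = F" using obtain_skew_block22 by metis
    have "p F' F' \<le> 0" using F'(2)[OF K(2)] pK[OF K(1)] by simp
    moreover have "p F' F' \<ge> 0" using pg[of F'] \<kappa> order_trans[OF mult_nonneg_nonneg[OF less_imp_le zero_le_power2]] by blast
    ultimately show ?thesis using Q2F by simp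
  qed
qed

end

section \<open>Frames with a prescribed Gram matrix\<close>

lemma Ck_on_bounded_linear:
  assumes "open S" "bounded_linear L" "Ck_on k S f"
  shows "Ck_on k S (\<lambda>x. L (f x))"
  using assms(3)
proof (induction k arbitrary: f)
  case 0
  then show ?case using bounded_linear.continuous_on[OF assms(2)] by simp
next
  case (Suc k)
  have D: "((\<lambda>x. L (f x)) has_derivative (\<lambda>v. L (frechet_derivative f (at x) v))) (at x)" if "x \<in> S" for x
    using Suc.prems that frechet_derivative_works by (intro bounded_linear.has_derivative[OF assms(2)]) auto
  have "Ck_on k S (\<lambda>x. frechet_derivative (\<lambda>x. L (f x)) (at x) v)" for v
  proof (rule Ck_on_transform[OF assms(1) _ Suc.IH])
    show "Ck_on k S (\<lambda>x. frechet_derivative f (at x) v)" using Suc.prems by simp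
    show "L (frechet_derivative f (at x) v) = frechet_derivative (\<lambda>x. L (f x)) (at x) v" if "x \<in> S" for x
      using frechet_derivative_at[OF D[OF that]] by metis
  qed
  then show ?case using D by (auto simp: differentiable_def)
qed

text \<open>One continuous derivative suffices, since roots and reciprocals of expressions in the
  metric enter the weak calculus only through \<open>C1_has_weak_partial\<close>.\<close>

lemma C1_compose:
  fixes f :: "'a::euclidean_space \<Rightarrow> real" and h h' :: "real \<Rightarrow> real"
  assumes "open S" "Ck_on (Suc 0) S f"
    and h: "\<And>x. x \<in> S \<Longrightarrow> (h has_real_derivative h' (f x)) (at (f x))"
    and h': "continuous_on (f ` S) h'"
  shows "Ck_on (Suc 0) S (\<lambda>x. h (f x))"
proof -
  have D: "((\<lambda>x. h (f x)) has_derivative (\<lambda>v. h' (f x) * frechet_derivative f (at x) v)) (at x)" if "x \<in> S" for x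
    using has_derivative_compose[of f "frechet_derivative f (at x)" x UNIV h "(*) (h' (f x))"] h[OF that] assms(2) that
    by (simp add: has_field_derivative_def frechet_derivative_works)
  have fc: "continuous_on S f" using Ck_on_SucD[OF assms(2)] by simp
  have "continuous_on S (\<lambda>x. h' (f x) * frechet_derivative f (at x) v)" for v
    using assms(2) by (intro continuous_intros continuous_on_compose2[OF h' fc]) auto
  moreover have "frechet_derivative (\<lambda>x. h (f x)) (at x) = (\<lambda>v. h' (f x) * frechet_derivative f (at x) v)" if "x \<in> S" for x
    using frechet_derivative_at[OF D[OF that]] by simp
  ultimately have "continuous_on S (\<lambda>x. frechet_derivative (\<lambda>x. h (f x)) (at x) v)" for v
    by (simp cong: continuous_on_cong)
  then show ?thesis using D by (auto simp: differentiable_def)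
qed

lemma C1_inverse:
  assumes "open S" "Ck_on (Suc 0) S f" "\<And>x. x \<in> S \<Longrightarrow> f x \<noteq> (0::real)"
  shows "Ck_on (Suc 0) S (\<lambda>x. inverse (f x))"
  by (rule C1_compose[OF assms(1,2), of inverse "\<lambda>t. - (inverse t * inverse t)"])
    (use assms(3) in \<open>auto intro!: derivative_eq_intros continuous_intros\<close>)

lemma C1_sqrt:
  assumes "open S" "Ck_on (Suc 0) S f" "\<And>x. x \<in> S \<Longrightarrow> f x > (0::real)"
  shows "Ck_on (Suc 0) S (\<lambda>x. sqrt (f x))"
proof (rule C1_compose[OF assms(1,2), of sqrt "\<lambda>t. inverse (sqrt t) / 2"])
  show "(sqrt has_real_derivative inverse (sqrt (f x)) / 2) (at (f x))" if "x \<in> S" for x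
    by (rule DERIV_real_sqrt[OF assms(3)[OF that]])
  have "sqrt t \<noteq> 0" if "t \<in> f ` S" for t using assms(3) that by fastforce
  then show "continuous_on (f ` S) (\<lambda>t. inverse (sqrt t) / 2)"
    by (intro continuous_intros) auto
qed

lemma C1_diff:
  fixes f g :: "'a::euclidean_space \<Rightarrow> real"
  assumes "open S" "Ck_on k S f" "Ck_on k S g"
  shows "Ck_on k S (\<lambda>x. f x - g x)"
  using Ck_on_add[OF assms(1,2) Ck_on_mult[OF assms(1) Ck_on_const[of k S "-1"] assms(3)]] by simp

lemma det_block22: "det (block22 G) = G$1$1 * G$2$2 - G$1$2 * G$2$1"
  by (simp add: det_2 block22_component)

lemma spd_sym_components: "spd G \<Longrightarrow> G $ i $ j = G $ j $ i"
  unfolding spd_def by (metis transpose_def vec_lambda_beta)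

lemma spd_block22:
  assumes "spd G" shows "spd (block22 G)"
  unfolding spd_def
proof (intro conjI allI impI)
  show "transpose (block22 G) = block22 G"
    using assms by (simp add: spd_def flip: block22_simps(4))
  fix v :: "real^2" assume "v \<noteq> 0"
  define w :: "real^3" where "w = vector [v$1, v$2, 0]"
  have "w \<noteq> 0" using \<open>v \<noteq> 0\<close> by (auto simp: w_def vec_eq_iff forall_2 forall_3)
  then have "w \<bullet> (G *v w) > 0" using assms by (simp add: spd_def)
  also have "w \<bullet> (G *v w) = v \<bullet> (block22 G *v v)"
    by (simp add: inner_vec_def matrix_vector_mult_def sum_2 sum_3 w_def block22_component)
  finally show "v \<bullet> (block22 G *v v) > 0" .
qed

lemma spd_det_pos:
  fixes G :: "real^'n^'n"
  assumes "spd G" shows "det G > 0"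
proof -
  have "det G = (det (mat_sqrt G))\<^sup>2" using mat_sqrt(2)[OF assms] by (metis det_mul power2_eq_square)
  moreover have "det (mat_sqrt G) \<noteq> 0"
    using spd_inv(1)[OF mat_sqrt(1)[OF assms]] by (simp add: invertible_det_nz)
  ultimately show ?thesis by simp
qed

text \<open>The coordinates of the Cosserat vector with respect to \<open>\<partial>\<^sub>1y\<close>, \<open>\<partial>\<^sub>2y\<close> and the unit normal.\<close>

definition tcoef1 :: "real^3^3 \<Rightarrow> real" where
  "tcoef1 G = (G$2$2 * G$1$3 - G$1$2 * G$2$3) * inverse (det (block22 G))"
definition tcoef2 :: "real^3^3 \<Rightarrow> real" where
  "tcoef2 G = (G$1$1 * G$2$3 - G$1$2 * G$1$3) * inverse (det (block22 G))"
definition ncoef :: "real^3^3 \<Rightarrow> real" where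
  "ncoef G = sqrt (det G) * inverse (sqrt (det (block22 G)))"

lemma ncoef_pos: "spd G \<Longrightarrow> ncoef G > 0"
  using spd_det_pos[of G] spd_det_pos[OF spd_block22, of G] by (simp add: ncoef_def)

lemma ncoef_power2:
  assumes "spd G"
  shows "(ncoef G)\<^sup>2 = det G * inverse (det (block22 G))"
  using spd_det_pos[OF assms] spd_det_pos[OF spd_block22[OF assms]] by (simp add: ncoef_def power_mult_distrib power_inverse)

text \<open>Cramer's rule for the tangential coordinates; in the last identity (ncoef G)^2 = det G /
  det (block22 G) is the Schur complement of the block.\<close>

lemma tcoef_solves:
  assumes "spd G"
  shows "G$1$1 * tcoef1 G + G$1$2 * tcoef2 G = G$1$3" "G$1$2 * tcoef1 G + G$2$2 * tcoef2 G = G$2$3"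
    "tcoef1 G * G$1$3 + tcoef2 G * G$2$3 + (ncoef G)\<^sup>2 = G$3$3"
proof -
  note s = spd_sym_components[OF assms, of 2 1] spd_sym_components[OF assms, of 3 1] spd_sym_components[OF assms, of 3 2]
  have d: "det (block22 G) \<noteq> 0" using spd_det_pos[OF spd_block22[OF assms]] by simp
  show "G$1$1 * tcoef1 G + G$1$2 * tcoef2 G = G$1$3" "G$1$2 * tcoef1 G + G$2$2 * tcoef2 G = G$2$3"
    using d by (simp_all add: tcoef1_def tcoef2_def field_simps) (simp_all add: det_block22 s algebra_simps)
  show "tcoef1 G * G$1$3 + tcoef2 G * G$2$3 + (ncoef G)\<^sup>2 = G$3$3"
    unfolding ncoef_power2[OF assms]
    using d by (simp add: tcoef1_def tcoef2_def field_simps) (simp add: det_block22 det_3 s algebra_simps)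
qed

lemma matrix_inv_block22_mult:
  assumes "spd G"
  shows "matrix_inv (block22 G) *v vector [G$1$3, G$2$3] = vector [tcoef1 G, tcoef2 G]"
proof -
  have "block22 G *v vector [tcoef1 G, tcoef2 G] = vector [G$1$3, G$2$3]"
    using tcoef_solves(1,2)[OF assms] spd_sym_components[OF assms, of 2 1]
    by (simp add: vec_eq_iff forall_2 matrix_vector_mult_def sum_2 block22_component)
  then have "matrix_inv (block22 G) *v vector [G$1$3, G$2$3] = (matrix_inv (block22 G) ** block22 G) *v vector [tcoef1 G, tcoef2 G]"
    by (simp flip: matrix_vector_mul_assoc)
  then show ?thesis using spd_inv(3)[OF spd_block22[OF assms]] by simp
qed

text \<open>Block inversion through the Schur complement. The row \<open>r\<close> is written down
  and confirmed by multiplying it with \<open>G\<close>, which gives the third unit row.\<close>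

lemma matrix_inv_row3:
  assumes "spd G"
  shows "matrix_inv G $ 3 $ 3 = inverse ((ncoef G)\<^sup>2)"
    "matrix_inv G $ 3 $ 1 = - inverse ((ncoef G)\<^sup>2) * tcoef1 G"
    "matrix_inv G $ 3 $ 2 = - inverse ((ncoef G)\<^sup>2) * tcoef2 G"
proof -
  note s = spd_sym_components[OF assms, of 2 1] spd_sym_components[OF assms, of 3 1] spd_sym_components[OF assms, of 3 2]
  define q where "q = inverse ((ncoef G)\<^sup>2)"
  define r :: "real^3" where "r = vector [- q * tcoef1 G, - q * tcoef2 G, q]"
  have q: "q * (ncoef G)\<^sup>2 = 1" using ncoef_pos[OF assms] by (simp add: q_def)
  have e1: "r v* G = axis 3 1"
  proof -
    have "(r v* G) $ 1 = q * (G$1$3 - (G$1$1 * tcoef1 G + G$1$2 * tcoef2 G))"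
      "(r v* G) $ 2 = q * (G$2$3 - (G$1$2 * tcoef1 G + G$2$2 * tcoef2 G))"
      "(r v* G) $ 3 = q * (G$3$3 - (tcoef1 G * G$1$3 + tcoef2 G * G$2$3))"
      by (simp_all add: vector_matrix_mult_def r_def sum_3 s algebra_simps)
    moreover have "G$3$3 - (tcoef1 G * G$1$3 + tcoef2 G * G$2$3) = (ncoef G)\<^sup>2"
      using tcoef_solves(3)[OF assms] by linarith
    ultimately have "(r v* G) $ 1 = 0" "(r v* G) $ 2 = 0" "(r v* G) $ 3 = 1"
      using tcoef_solves(1,2)[OF assms] q by simp_all
    then show ?thesis by (simp add: vec_eq_iff forall_3 axis_def)
  qed
  have "r = r v* (G ** matrix_inv G)" using spd_inv(2)[OF assms] by simp
  also have "\<dots> = (r v* G) v* matrix_inv G" by (simp add: vector_matrix_mul_assoc)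
  also have "\<dots> = axis 3 1 v* matrix_inv G" by (simp only: e1)
  also have "\<dots> = matrix_inv G $ 3" by (simp add: vec_eq_iff vector_matrix_mult_def axis_def sum_3)
  finally have r: "matrix_inv G $ 3 = r" by simp
  show "matrix_inv G $ 3 $ 3 = inverse ((ncoef G)\<^sup>2)"
    "matrix_inv G $ 3 $ 1 = - inverse ((ncoef G)\<^sup>2) * tcoef1 G"
    "matrix_inv G $ 3 $ 2 = - inverse ((ncoef G)\<^sup>2) * tcoef2 G"
    unfolding r by (simp_all add: r_def q_def)
qed

text \<open>Lagrange's identity for the cross product.\<close>

lemma norm_cross_gram:
  assumes "spd G" "u \<bullet> u = G$1$1" "u \<bullet> v = G$1$2" "v \<bullet> v = G$2$2"
  shows "norm (cross3 u v) = sqrt (det (block22 G))"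
proof -
  have "(norm (cross3 u v))\<^sup>2 = (u \<bullet> u) * (v \<bullet> v) - (u \<bullet> v)\<^sup>2"
    unfolding power2_norm_eq_inner by (simp add: cross3_simps power2_eq_square)
  also have "\<dots> = det (block22 G)"
    using assms spd_sym_components[OF assms(1), of 2 1] by (simp add: det_block22 power2_eq_square)
  finally show ?thesis by (metis norm_ge_zero real_sqrt_unique)
qed

lemma cols3_component: "cols3 a b c $ i $ 1 = a $ i" "cols3 a b c $ i $ 2 = b $ i" "cols3 a b c $ i $ 3 = c $ i"
  by (simp_all add: cols3_def transpose_def)

text \<open>A competitor has the same products with \<open>u\<close> and \<open>v\<close> as
  \<open>b0\<close>, and the determinant forces the same product with their cross product. The
  difference is then orthogonal to \<open>b0\<close>, and equal lengths make it zero.\<close>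

lemma frame_vector_unique:
  assumes G: "spd G" and uv: "u \<bullet> u = G$1$1" "u \<bullet> v = G$1$2" "v \<bullet> v = G$2$2"
  defines "b0 \<equiv> tcoef1 G *\<^sub>R u + tcoef2 G *\<^sub>R v + ncoef G *\<^sub>R (cross3 u v /\<^sub>R norm (cross3 u v))"
  shows "b0 \<bullet> u = G$1$3" "b0 \<bullet> v = G$2$3"
    and "(THE b. let Q = cols3 u v b in det Q > 0 \<and> transpose Q ** Q = G) = b0"
proof -
  note s = spd_sym_components[OF G, of 2 1] spd_sym_components[OF G, of 3 1] spd_sym_components[OF G, of 3 2]
  define N where "N = cross3 u v /\<^sub>R norm (cross3 u v)"
  have nc: "norm (cross3 u v) > 0"
    using norm_cross_gram[OF G uv] spd_det_pos[OF spd_block22[OF G]] by simp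
  have N: "N \<bullet> u = 0" "N \<bullet> v = 0" "N \<bullet> N = 1" "N \<bullet> cross3 u v = norm (cross3 u v)"
    using nc by (simp_all add: N_def dot_cross_self dot_square_norm power2_eq_square)
  have N': "u \<bullet> N = 0" "v \<bullet> N = 0" "cross3 u v \<bullet> N = norm (cross3 u v)"
    using N by (simp_all only: inner_commute[of u] inner_commute[of v] inner_commute[of "cross3 u v"])
  have b0: "b0 = tcoef1 G *\<^sub>R u + tcoef2 G *\<^sub>R v + ncoef G *\<^sub>R N" by (simp add: b0_def N_def)
  have vu: "v \<bullet> u = G$1$2" using uv(2) by (simp add: inner_commute)
  show b0u: "b0 \<bullet> u = G$1$3" and b0v: "b0 \<bullet> v = G$2$3"
    using tcoef_solves(1,2)[OF G] uv vu N by (simp_all add: b0 inner_add_left mult_ac)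
  have "b0 \<bullet> N = ncoef G" using N N' by (simp add: b0 inner_add_left)
  then have b0b0: "b0 \<bullet> b0 = G$3$3"
    using tcoef_solves(3)[OF G] b0u b0v
    by (subst (2) b0) (simp add: inner_add_right power2_eq_square)
  have det: "det (cols3 u v b) = cross3 u v \<bullet> b" for b
    unfolding det_3 cols3_component by (simp add: cross3_simps)
  have gram: "transpose (cols3 u v b) ** cols3 u v b = G \<longleftrightarrow> b \<bullet> u = G$1$3 \<and> b \<bullet> v = G$2$3 \<and> b \<bullet> b = G$3$3" for b
    using uv by (simp add: vec_eq_iff forall_3 matrix_matrix_mult_def transpose_def cols3_component sum_3 inner_vec_def s mult_ac) blast
  show "(THE b. let Q = cols3 u v b in det Q > 0 \<and> transpose Q ** Q = G) = b0"
  proof (rule the_equality)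
    show "let Q = cols3 u v b0 in det Q > 0 \<and> transpose Q ** Q = G"
    proof -
      have "cross3 u v \<bullet> b0 = ncoef G * norm (cross3 u v)"
        using N N' by (simp add: b0 inner_add_right dot_cross_self)
      then show ?thesis using nc ncoef_pos[OF G] b0u b0v b0b0 by (simp add: Let_def det gram)
    qed
    fix b assume "let Q = cols3 u v b in det Q > 0 \<and> transpose Q ** Q = G"
    then have b: "cross3 u v \<bullet> b > 0" "transpose (cols3 u v b) ** cols3 u v b = G" by (simp_all add: Let_def det)
    then have bb: "b \<bullet> u = G$1$3" "b \<bullet> v = G$2$3" "b \<bullet> b = G$3$3" using gram by auto
    \<comment> \<open>The determinant of the Gram equation fixes the triple product up to sign;
      positivity of det Q fixes the sign.\<close>
    have sq: "(cross3 u v \<bullet> b')\<^sup>2 = det G" if "transpose (cols3 u v b') ** cols3 u v b' = G" for b'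
      using arg_cong[OF that, of det] by (simp add: det_mul det power2_eq_square)
    have g0: "transpose (cols3 u v b0) ** cols3 u v b0 = G" using gram b0u b0v b0b0 by simp
    have "cross3 u v \<bullet> b0 > 0"
      using N N' nc ncoef_pos[OF G] by (simp add: b0 inner_add_right dot_cross_self)
    then have "cross3 u v \<bullet> b = cross3 u v \<bullet> b0"
      using sq[OF b(2)] sq[OF g0] b(1) by (metis less_imp_le power2_eq_iff_nonneg)
    then have "(b - b0) \<bullet> cross3 u v = 0" by (simp add: inner_diff_left inner_commute[of b] inner_commute[of b0])
    then have "(b - b0) \<bullet> N = 0" by (simp add: N_def)
    moreover have "(b - b0) \<bullet> u = 0" "(b - b0) \<bullet> v = 0"
      using bb b0u b0v by (simp_all add: inner_diff_left)
    ultimately have 0: "(b - b0) \<bullet> b0 = 0" by (subst (2) b0) (simp add: inner_add_right)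
    have "(b - b0) \<bullet> (b - b0) = b \<bullet> b - b0 \<bullet> b0 - 2 * ((b - b0) \<bullet> b0)"
      by (simp add: inner_diff_left inner_diff_right inner_commute)
    then have "(b - b0) \<bullet> (b - b0) = 0" using 0 bb(3) b0b0 by simp
    then show "b = b0" by simp
  qed
qed

section \<open>Geometry of an isometric immersion\<close>

lemma weakly_diff_cong_AE:
  assumes "open \<Omega>" "AE x in lebesgue_on \<Omega>. f x = g x" "weakly_diff \<Omega> f"
  shows "weakly_diff \<Omega> g"
  unfolding weakly_diff_def
proof (intro conjI allI)
  show "AE_locally_bounded \<Omega> g"
    unfolding AE_locally_bounded_def
  proof (intro allI impI)
    fix K assume K: "compact K \<and> K \<subseteq> \<Omega>"
    then have Ks: "K \<in> sets lebesgue" using lmeasurable_compact fmeasurableD by blast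
    obtain M where M: "AE x in lebesgue_on K. \<bar>f x\<bar> \<le> M"
      using assms(3) K unfolding weakly_diff_def AE_locally_bounded_def by meson
    have "AE x in lebesgue. x \<in> \<Omega> \<longrightarrow> f x = g x"
      using assms(1,2) by (subst (asm) AE_restrict_space_iff) auto
    then have "AE x in lebesgue_on K. f x = g x"
      using Ks K by (subst AE_restrict_space_iff) (auto elim!: eventually_mono)
    with M have "AE x in lebesgue_on K. \<bar>g x\<bar> \<le> M" by eventually_elim simp
    then show "\<exists>M. AE x in lebesgue_on K. \<bar>g x\<bar> \<le> M" by blast
  qed
  fix i
  obtain h where h: "has_weak_partial \<Omega> i f h" using assms(3) unfolding weakly_diff_def by meson
  have "has_weak_partial \<Omega> i g h"
    by (rule has_weak_partial_cong_AE[OF assms(1,2) _ h]) simp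
  then show "\<exists>h. has_weak_partial \<Omega> i g h" by blast
qed

text \<open>Weak derivatives of the components, chosen one by one, show that the choice in
  \<open>weak_partial\<close> is not made from an empty set.\<close>

lemma weakly_diff_vec:
  fixes F :: "real^'n \<Rightarrow> real^'m"
  assumes "open \<Omega>" "\<And>k. weakly_diff \<Omega> (\<lambda>x. F x $ k)"
  shows "has_weak_partial \<Omega> j F (weak_partial \<Omega> j F)"
proof -
  have "\<forall>k. \<exists>g. has_weak_partial \<Omega> j (\<lambda>x. F x $ k) g"
    using assms(2) by (simp add: weakly_diff_def)
  from choice[OF this] obtain g where g: "\<forall>k. has_weak_partial \<Omega> j (\<lambda>x. F x $ k) (g k)" ..
  have "has_weak_partial \<Omega> j F (\<lambda>x. \<chi> k. g k x)"
    using g by (simp add: has_weak_partial_componentwise[OF assms(1)])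
  then show ?thesis by (rule has_weak_partial_weak_partial)
qed

lemma has_weak_partial_inner:
  fixes F H :: "real^'n \<Rightarrow> real^3"
  assumes "open \<Omega>" and F: "\<And>k. weakly_diff \<Omega> (\<lambda>x. F x $ k)" "has_weak_partial \<Omega> j F F'"
    and H: "\<And>k. weakly_diff \<Omega> (\<lambda>x. H x $ k)" "has_weak_partial \<Omega> j H H'"
  shows "has_weak_partial \<Omega> j (\<lambda>x. F x \<bullet> H x) (\<lambda>x. F' x \<bullet> H x + F x \<bullet> H' x)"
proof -
  have k: "has_weak_partial \<Omega> j (\<lambda>x. F x $ k * H x $ k) (\<lambda>x. F' x $ k * H x $ k + F x $ k * H' x $ k)" for k
    using F H by (intro has_weak_partial_mult assms(1)) (auto simp: weakly_diff_def has_weak_partial_componentwise[OF assms(1)])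
  have "has_weak_partial \<Omega> j (\<lambda>x. F x $ 1 * H x $ 1 + F x $ 2 * H x $ 2 + F x $ 3 * H x $ 3)
    (\<lambda>x. (F' x $ 1 * H x $ 1 + F x $ 1 * H' x $ 1) + (F' x $ 2 * H x $ 2 + F x $ 2 * H' x $ 2)
      + (F' x $ 3 * H x $ 3 + F x $ 3 * H' x $ 3))"
    by (intro has_weak_partial_add assms(1) k)
  moreover have "(\<lambda>x. F x \<bullet> H x) = (\<lambda>x. F x $ 1 * H x $ 1 + F x $ 2 * H x $ 2 + F x $ 3 * H x $ 3)"
    by (simp add: inner_vec_def sum_3)
  moreover have "(\<lambda>x. F' x \<bullet> H x + F x \<bullet> H' x) = (\<lambda>x. (F' x $ 1 * H x $ 1 + F x $ 1 * H' x $ 1)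
      + (F' x $ 2 * H x $ 2 + F x $ 2 * H' x $ 2) + (F' x $ 3 * H x $ 3 + F x $ 3 * H' x $ 3))"
    by (simp add: inner_vec_def sum_3 add_ac)
  ultimately show ?thesis by (simp only:)
qed

text \<open>The product rule and the classical derivative of \<open>g\<close> are two weak
  derivatives of the same function, hence agree almost everywhere.\<close>

lemma weak_inner_constraint:
  fixes F H :: "real^'n \<Rightarrow> real^3"
  assumes "open \<Omega>" and F: "\<And>k. weakly_diff \<Omega> (\<lambda>x. F x $ k)" and H: "\<And>k. weakly_diff \<Omega> (\<lambda>x. H x $ k)"
    and ae: "AE x in lebesgue_on \<Omega>. F x \<bullet> H x = g x" and g: "Ck_on (Suc 0) \<Omega> g"
  shows "AE x in lebesgue_on \<Omega>. weak_partial \<Omega> j F x \<bullet> H x + F x \<bullet> weak_partial \<Omega> j H x = partial_deriv j g x"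
proof -
  have ae': "AE x in lebesgue_on \<Omega>. g x = F x \<bullet> H x" using ae by eventually_elim simp
  have "has_weak_partial \<Omega> j (\<lambda>x. F x \<bullet> H x) (partial_deriv j g)"
    by (rule has_weak_partial_cong_AE[OF assms(1) ae' _ C1_has_weak_partial[OF assms(1) g]]) simp
  then show ?thesis
    using has_weak_partial_inner[OF assms(1) F weakly_diff_vec[OF assms(1) F] H weakly_diff_vec[OF assms(1) H]]
    by (intro has_weak_partial_unique_real[OF assms(1)])
qed

text \<open>Pointwise linear algebra: \<open>d11\<close>, \<open>d12\<close>, \<open>d22\<close>
  stand for the second derivatives of the immersion, \<open>n1\<close>, \<open>n2\<close> and
  \<open>b1\<close>, \<open>b2\<close> for the derivatives of the normal and the Cosserat vector,
  and \<open>gkij\<close> for the k-th derivative of the entry ij of the metric. The first two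
  groups determine the products p_k . d_ij, the Christoffel symbols of the first kind; the others
  express everything through them and p_i . n_j.\<close>

lemma gauss_weingarten_algebra:
  fixes p1 p2 N b d11 d12 d22 n1 n2 b1 b2 :: "'a::real_inner"
  assumes b: "b = a1 *\<^sub>R p1 + a2 *\<^sub>R p2 + \<beta> *\<^sub>R N"
    and G1: "d11 \<bullet> p1 + p1 \<bullet> d11 = g111" "d11 \<bullet> p2 + p1 \<bullet> d12 = g112" "d12 \<bullet> p2 + p2 \<bullet> d12 = g122"
    and G2: "d12 \<bullet> p1 + p1 \<bullet> d12 = g211" "d12 \<bullet> p2 + p1 \<bullet> d22 = g212" "d22 \<bullet> p2 + p2 \<bullet> d22 = g222"
    and N1: "n1 \<bullet> p1 + N \<bullet> d11 = 0" "n1 \<bullet> p2 + N \<bullet> d12 = 0"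
    and N2: "n2 \<bullet> p1 + N \<bullet> d12 = 0" "n2 \<bullet> p2 + N \<bullet> d22 = 0"
    and B1: "b1 \<bullet> p1 + b \<bullet> d11 = g113" "b1 \<bullet> p2 + b \<bullet> d12 = g123"
    and B2: "b2 \<bullet> p1 + b \<bullet> d12 = g213" "b2 \<bullet> p2 + b \<bullet> d22 = g223"
  shows "p1 \<bullet> b1 = g113 - a1 * (g111 / 2) - a2 * (g112 - g211 / 2) + \<beta> * (p1 \<bullet> n1)"
    and "p2 \<bullet> b2 = g223 - a1 * (g212 - g122 / 2) - a2 * (g222 / 2) + \<beta> * (p2 \<bullet> n2)"
    and "p1 \<bullet> b2 + p2 \<bullet> b1 = g123 + g213 - a1 * g211 - a2 * g122 + 2 * (\<beta> * (p1 \<bullet> n2))"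
proof -
  have e: "p1 \<bullet> d11 = g111 / 2" "p2 \<bullet> d11 = g112 - g211 / 2" "p1 \<bullet> d12 = g211 / 2" "p2 \<bullet> d12 = g122 / 2"
    "p1 \<bullet> d22 = g212 - g122 / 2" "p2 \<bullet> d22 = g222 / 2"
    using G1 G2 inner_commute[of p1] inner_commute[of p2] by (simp_all add: field_simps)
  have bd: "b \<bullet> w = a1 * (p1 \<bullet> w) + a2 * (p2 \<bullet> w) + \<beta> * (N \<bullet> w)" for w
    by (simp add: b inner_add_left)
  have n: "N \<bullet> d11 = - (p1 \<bullet> n1)" "N \<bullet> d12 = - (p1 \<bullet> n2)" "N \<bullet> d22 = - (p2 \<bullet> n2)"
    using N1 N2 inner_commute[of p1] inner_commute[of p2] by (simp_all add: field_simps)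
  have B: "p1 \<bullet> b1 = g113 - b \<bullet> d11" "p2 \<bullet> b1 = g123 - b \<bullet> d12" "p1 \<bullet> b2 = g213 - b \<bullet> d12" "p2 \<bullet> b2 = g223 - b \<bullet> d22"
    using B1 B2 inner_commute[of p1] inner_commute[of p2] by (simp_all add: field_simps)
  show "p1 \<bullet> b1 = g113 - a1 * (g111 / 2) - a2 * (g112 - g211 / 2) + \<beta> * (p1 \<bullet> n1)"
    "p2 \<bullet> b2 = g223 - a1 * (g212 - g122 / 2) - a2 * (g222 / 2) + \<beta> * (p2 \<bullet> n2)"
    "p1 \<bullet> b2 + p2 \<bullet> b1 = g123 + g213 - a1 * g211 - a2 * g122 + 2 * (\<beta> * (p1 \<bullet> n2))"
    unfolding B bd e n by (simp_all add: algebra_simps)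
qed

section \<open>Weak differentiability of the frame along an isometric immersion\<close>

locale metric_immersion =
  fixes \<Omega> :: "(real^2) set" and G :: "real^2 \<Rightarrow> real^3^3" and y :: "real^2 \<Rightarrow> real^3"
  assumes open_\<Omega>: "open \<Omega>" and G_smooth: "smooth_on_set (closure \<Omega>) G"
    and G_spd: "\<And>x. x \<in> closure \<Omega> \<Longrightarrow> spd (G x)" and iso: "isometric_immersion \<Omega> G y"
begin

abbreviation "dy i \<equiv> weak_partial \<Omega> i y"
abbreviation "N \<equiv> unit_normal \<Omega> y"
abbreviation "b \<equiv> cosserat \<Omega> G y"

lemma spd: "x \<in> \<Omega> \<Longrightarrow> spd (G x)"
  using G_spd closure_subset by blast

lemma AE_in: "(\<And>x. x \<in> \<Omega> \<Longrightarrow> P x) \<Longrightarrow> AE x in lebesgue_on \<Omega>. P x"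
  by (rule AE_I2) simp

lemma AE_\<Omega>: "AE x in lebesgue_on \<Omega>. x \<in> \<Omega>"
  by (rule AE_in)

lemma G_C1: "Ck_on (Suc 0) \<Omega> (\<lambda>x. G x $ i $ j)"
proof -
  obtain U g where U: "closure \<Omega> \<subseteq> U" "smooth_on_open U g" "\<And>x. x \<in> closure \<Omega> \<Longrightarrow> g x = G x"
    using G_smooth unfolding smooth_on_set_def by blast
  have "Ck_on (Suc 0) U g" "open U" using U(2) unfolding smooth_on_open_def by blast+
  then have "Ck_on (Suc 0) U (\<lambda>x. g x $ i $ j)"
    by (intro Ck_on_bounded_linear[of U "\<lambda>M. M $ i $ j"] bounded_linear_compose[OF bounded_linear_vec_nth bounded_linear_vec_nth])
  then have "Ck_on (Suc 0) \<Omega> (\<lambda>x. g x $ i $ j)"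
    by (rule Ck_on_subset) (use U(1) closure_subset in blast)
  then show ?thesis
    by (rule Ck_on_transform[OF open_\<Omega>, rotated]) (use U(3) closure_subset[of \<Omega>] in auto)
qed

lemma coef_C1: "Ck_on (Suc 0) \<Omega> (\<lambda>x. inverse (sqrt (det (block22 (G x)))))"
  "Ck_on (Suc 0) \<Omega> (\<lambda>x. tcoef1 (G x))" "Ck_on (Suc 0) \<Omega> (\<lambda>x. tcoef2 (G x))"
  "Ck_on (Suc 0) \<Omega> (\<lambda>x. ncoef (G x))"
proof -
  note arith = Ck_on_mult[OF open_\<Omega>] Ck_on_add[OF open_\<Omega>] C1_diff[OF open_\<Omega>] G_C1
  have d: "Ck_on (Suc 0) \<Omega> (\<lambda>x. det (block22 (G x)))"
    unfolding det_block22 by (intro arith)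
  have dp: "det (block22 (G x)) > 0" if "x \<in> \<Omega>" for x using spd_det_pos[OF spd_block22[OF spd[OF that]]] .
  have s: "Ck_on (Suc 0) \<Omega> (\<lambda>x. sqrt (det (block22 (G x))))" by (rule C1_sqrt[OF open_\<Omega> d dp])
  show si: "Ck_on (Suc 0) \<Omega> (\<lambda>x. inverse (sqrt (det (block22 (G x)))))"
    by (rule C1_inverse[OF open_\<Omega> s]) (use dp in fastforce)
  have di: "Ck_on (Suc 0) \<Omega> (\<lambda>x. inverse (det (block22 (G x))))"
    by (rule C1_inverse[OF open_\<Omega> d]) (use dp in fastforce)
  show "Ck_on (Suc 0) \<Omega> (\<lambda>x. tcoef1 (G x))" "Ck_on (Suc 0) \<Omega> (\<lambda>x. tcoef2 (G x))"
    unfolding tcoef1_def tcoef2_def by (intro arith di)+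
  have "Ck_on (Suc 0) \<Omega> (\<lambda>x. det (G x))" unfolding det_3 by (intro arith)
  then have "Ck_on (Suc 0) \<Omega> (\<lambda>x. sqrt (det (G x)))"
    by (rule C1_sqrt[OF open_\<Omega>]) (rule spd_det_pos[OF spd])
  then show "Ck_on (Suc 0) \<Omega> (\<lambda>x. ncoef (G x))"
    unfolding ncoef_def by (intro arith si)
qed

text \<open>The Sobolev condition speaks of some weak derivative, \<open>dy\<close> of a chosen one.
  They differ on a null set only, so second derivatives carry over.\<close>

lemma dy_weak: "has_weak_partial \<Omega> i y (dy i)"
  and dy_weak2: "has_weak_partial \<Omega> j (dy i) (weak_partial \<Omega> j (dy i))"
proof -
  have "sobolev2 (Suc (Suc 0)) \<Omega> y" using iso by (simp add: isometric_immersion_def numeral_2_eq_2)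
  then obtain g where g: "has_weak_partial \<Omega> i y g" "\<And>j. \<exists>k. has_weak_partial \<Omega> j g k"
    by (simp only: sobolev2.simps) blast
  show dy: "has_weak_partial \<Omega> i y (dy i)" by (rule has_weak_partial_weak_partial[OF g(1)])
  obtain k where k: "has_weak_partial \<Omega> j g k" using g(2) by blast
  have "AE x in lebesgue_on \<Omega>. g x = dy i x" by (rule has_weak_partial_unique[OF open_\<Omega> g(1) dy])
  then have "has_weak_partial \<Omega> j (dy i) k"
    by (rule has_weak_partial_cong_AE[OF open_\<Omega> _ _ k]) simp
  then show "has_weak_partial \<Omega> j (dy i) (weak_partial \<Omega> j (dy i))" by (rule has_weak_partial_weak_partial)
qed

lemma dy_commute: "AE x in lebesgue_on \<Omega>. weak_partial \<Omega> 2 (dy 1) x = weak_partial \<Omega> 1 (dy 2) x"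
  by (rule weak_second_partial_commute[OF open_\<Omega> dy_weak dy_weak dy_weak2 dy_weak2])

lemma weak_grad_mult_component:
  "(transpose (weak_grad \<Omega> y x) ** weak_grad \<Omega> f x) $ i $ j = dy i x \<bullet> weak_partial \<Omega> j f x"
  by (simp add: matrix_matrix_mult_def transpose_def weak_grad_def inner_vec_def)

lemma gram: "AE x in lebesgue_on \<Omega>. dy i x \<bullet> dy j x = block22 (G x) $ i $ j"
proof -
  have "AE x in lebesgue_on \<Omega>. transpose (weak_grad \<Omega> y x) ** weak_grad \<Omega> y x = block22 (G x)"
    using iso by (simp add: isometric_immersion_def)
  then show ?thesis by eventually_elim (simp flip: weak_grad_mult_component)
qed

lemma gram_entries:
  "AE x in lebesgue_on \<Omega>. dy 1 x \<bullet> dy 1 x = G x $ 1 $ 1"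
  "AE x in lebesgue_on \<Omega>. dy 1 x \<bullet> dy 2 x = G x $ 1 $ 2"
  "AE x in lebesgue_on \<Omega>. dy 2 x \<bullet> dy 2 x = G x $ 2 $ 2"
  using gram[of 1 1] gram[of 1 2] gram[of 2 2] by (simp_all add: block22_component)

text \<open>The isometry equation gives |dy i|^2 = G_ii almost everywhere, and the right-hand side
  is continuous, hence bounded on compact sets.\<close>

lemma dy_weakly_diff: "weakly_diff \<Omega> (\<lambda>x. dy i x $ k)"
  unfolding weakly_diff_def
proof (intro conjI allI)
  have c: "continuous_on \<Omega> (\<lambda>x. block22 (G x) $ i $ i)"
    using Ck_on_SucD[OF G_C1] exhaust_2[of i] by (auto simp: block22_component)
  show "AE_locally_bounded \<Omega> (\<lambda>x. dy i x $ k)"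
    unfolding AE_locally_bounded_def
  proof (intro allI impI)
    fix K assume K: "compact K \<and> K \<subseteq> \<Omega>"
    then have Ks: "K \<in> sets lebesgue" using lmeasurable_compact fmeasurableD by blast
    have "bounded ((\<lambda>x. block22 (G x) $ i $ i) ` K)"
      using K by (intro compact_imp_bounded compact_continuous_image continuous_on_subset[OF c]) auto
    then obtain M where M: "\<And>x. x \<in> K \<Longrightarrow> \<bar>block22 (G x) $ i $ i\<bar> \<le> M" by (auto simp: bounded_iff)
    have "AE x in lebesgue. x \<in> \<Omega> \<longrightarrow> dy i x \<bullet> dy i x = block22 (G x) $ i $ i"
      using gram[of i i] open_\<Omega> by (subst (asm) AE_restrict_space_iff) auto
    then have "AE x in lebesgue. x \<in> K \<longrightarrow> \<bar>dy i x $ k\<bar> \<le> sqrt M"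
    proof eventually_elim
      case (elim x)
      show ?case
      proof
        assume x: "x \<in> K"
        have "\<bar>dy i x $ k\<bar> \<le> norm (dy i x)" by (rule component_le_norm_cart)
        also have "\<dots> = sqrt (dy i x \<bullet> dy i x)" by (rule norm_eq_sqrt_inner)
        also have "\<dots> \<le> sqrt M" using elim K x M[OF x] by auto
        finally show "\<bar>dy i x $ k\<bar> \<le> sqrt M" .
      qed
    qed
    then have "AE x in lebesgue_on K. \<bar>dy i x $ k\<bar> \<le> sqrt M"
      using Ks by (subst AE_restrict_space_iff) auto
    then show "\<exists>M. AE x in lebesgue_on K. \<bar>dy i x $ k\<bar> \<le> M" by blast
  qed
  show "\<exists>g. has_weak_partial \<Omega> j (\<lambda>x. dy i x $ k) g" for j
    using dy_weak2[of j i] by (auto simp: has_weak_partial_componentwise[OF open_\<Omega>])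
qed

lemma N_eq: "N x = cross3 (dy 1 x) (dy 2 x) /\<^sub>R norm (cross3 (dy 1 x) (dy 2 x))"
  by (simp add: unit_normal_def Let_def)

text \<open>The metric determines the length of the cross product, so normalisation amounts to a C^1
  factor, and the product rule alone makes the normal weakly differentiable.\<close>

lemma N_AE: "AE x in lebesgue_on \<Omega>. N x = inverse (sqrt (det (block22 (G x)))) *\<^sub>R cross3 (dy 1 x) (dy 2 x)"
  using gram_entries AE_\<Omega> by eventually_elim (simp add: N_eq norm_cross_gram[OF spd])

lemma N_weakly_diff: "weakly_diff \<Omega> (\<lambda>x. N x $ k)"
proof -
  have ae: "AE x in lebesgue_on \<Omega>. (inverse (sqrt (det (block22 (G x)))) *\<^sub>R cross3 (dy 1 x) (dy 2 x)) $ k = N x $ k"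
    using N_AE by eventually_elim simp
  have c: "weakly_diff \<Omega> (\<lambda>x. dy 1 x $ m * dy 2 x $ l + (- 1) * (dy 1 x $ l * dy 2 x $ m))" for l m
    by (intro weakly_diff_add weakly_diff_mult open_\<Omega> dy_weakly_diff weakly_diff_C1 Ck_on_const)
  have "weakly_diff \<Omega> (\<lambda>x. cross3 (dy 1 x) (dy 2 x) $ k)"
    using exhaust_3[of k] c[of 2 3] c[of 3 1] c[of 1 2] by (auto simp: cross3_def)
  then have "weakly_diff \<Omega> (\<lambda>x. inverse (sqrt (det (block22 (G x)))) * cross3 (dy 1 x) (dy 2 x) $ k)"
    by (rule weakly_diff_mult[OF open_\<Omega> weakly_diff_C1[OF open_\<Omega> coef_C1(1)]])
  then show ?thesis by (intro weakly_diff_cong_AE[OF open_\<Omega> ae]) simp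
qed

lemma b_eq: "x \<in> \<Omega> \<Longrightarrow> b x = tcoef1 (G x) *\<^sub>R dy 1 x + tcoef2 (G x) *\<^sub>R dy 2 x + ncoef (G x) *\<^sub>R N x"
proof -
  assume "x \<in> \<Omega>"
  have "weak_grad \<Omega> y x *v vector [r, s] = r *\<^sub>R dy 1 x + s *\<^sub>R dy 2 x" for r s
    by (simp add: vec_eq_iff matrix_vector_mult_def sum_2 weak_grad_def)
  then show ?thesis
    using matrix_inv_block22_mult[OF spd[OF \<open>x \<in> \<Omega>\<close>]] by (simp add: cosserat_def ncoef_def divide_inverse)
qed

lemma b_weakly_diff: "weakly_diff \<Omega> (\<lambda>x. b x $ k)"
proof -
  have ae: "AE x in lebesgue_on \<Omega>.
    tcoef1 (G x) * dy 1 x $ k + tcoef2 (G x) * dy 2 x $ k + ncoef (G x) * N x $ k = b x $ k"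
    by (rule AE_in) (simp add: b_eq)
  show ?thesis
    by (rule weakly_diff_cong_AE[OF open_\<Omega> ae])
      (intro weakly_diff_add weakly_diff_mult open_\<Omega> dy_weakly_diff N_weakly_diff weakly_diff_C1 coef_C1)
qed

lemma b_frame: "AE x in lebesgue_on \<Omega>. b x \<bullet> dy 1 x = G x $ 1 $ 3"
  "AE x in lebesgue_on \<Omega>. b x \<bullet> dy 2 x = G x $ 2 $ 3"
  "AE x in lebesgue_on \<Omega>. frame_vector \<Omega> G y x = b x"
proof -
  have "AE x in lebesgue_on \<Omega>. b x \<bullet> dy 1 x = G x $ 1 $ 3 \<and> b x \<bullet> dy 2 x = G x $ 2 $ 3 \<and> frame_vector \<Omega> G y x = b x"
    using gram_entries AE_\<Omega>
  proof eventually_elim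
    case (elim x)
    then show ?case using frame_vector_unique[OF spd elim(1-3)] by (simp add: b_eq N_eq frame_vector_def)
  qed
  then show "AE x in lebesgue_on \<Omega>. b x \<bullet> dy 1 x = G x $ 1 $ 3"
    "AE x in lebesgue_on \<Omega>. b x \<bullet> dy 2 x = G x $ 2 $ 3" "AE x in lebesgue_on \<Omega>. frame_vector \<Omega> G y x = b x"
    by (auto elim: eventually_mono)
qed

lemma N_orthogonal: "AE x in lebesgue_on \<Omega>. N x \<bullet> dy 1 x = 0" "AE x in lebesgue_on \<Omega>. N x \<bullet> dy 2 x = 0"
  by (auto simp: N_eq dot_cross_self)

lemma dG_symmetric:
  assumes "x \<in> \<Omega>"
  shows "partial_deriv l (\<lambda>z. G z $ i $ j) x = partial_deriv l (\<lambda>z. G z $ j $ i) x"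
  unfolding partial_deriv_def
  using frechet_derivative_transform_within_open[of "\<lambda>z. G z $ i $ j" x \<Omega> "\<lambda>z. G z $ j $ i"]
    G_C1[of i j] open_\<Omega> assms spd_sym_components[OF spd] by simp

text \<open>The third row of the inverse metric contributes the common factor 1/\<beta>^2. What
  remains is the right-hand side of \<open>gauss_weingarten_algebra\<close> without its normal
  term.\<close>

lemma christoffel_eq:
  assumes x: "x \<in> \<Omega>"
  defines "dG \<equiv> \<lambda>l i j. partial_deriv l (\<lambda>z. G z $ i $ j) x"
  shows "christoffel G 3 1 1 x = inverse ((ncoef (G x))\<^sup>2) *
      (dG 1 1 3 - tcoef1 (G x) * (dG 1 1 1 / 2) - tcoef2 (G x) * (dG 1 1 2 - dG 2 1 1 / 2))"
    and "christoffel G 3 2 2 x = inverse ((ncoef (G x))\<^sup>2) *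
      (dG 2 2 3 - tcoef1 (G x) * (dG 2 1 2 - dG 1 2 2 / 2) - tcoef2 (G x) * (dG 2 2 2 / 2))"
    and "2 * christoffel G 3 1 2 x = inverse ((ncoef (G x))\<^sup>2) *
      (dG 1 2 3 + dG 2 1 3 - tcoef1 (G x) * dG 2 1 1 - tcoef2 (G x) * dG 1 2 2)"
proof -
  note s = dG_symmetric[OF x, of _ 2 1] dG_symmetric[OF x, of _ 3 1] dG_symmetric[OF x, of _ 3 2]
  show "christoffel G 3 1 1 x = inverse ((ncoef (G x))\<^sup>2) *
      (dG 1 1 3 - tcoef1 (G x) * (dG 1 1 1 / 2) - tcoef2 (G x) * (dG 1 1 2 - dG 2 1 1 / 2))"
    "christoffel G 3 2 2 x = inverse ((ncoef (G x))\<^sup>2) *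
      (dG 2 2 3 - tcoef1 (G x) * (dG 2 1 2 - dG 1 2 2 / 2) - tcoef2 (G x) * (dG 2 2 2 / 2))"
    "2 * christoffel G 3 1 2 x = inverse ((ncoef (G x))\<^sup>2) *
      (dG 1 2 3 + dG 2 1 3 - tcoef1 (G x) * dG 2 1 1 - tcoef2 (G x) * dG 1 2 2)"
    unfolding christoffel_def dG_def sum_3 matrix_inv_row3[OF spd[OF x]]
    by (simp_all add: metric_deriv_def s algebra_simps)
qed

end

section \<open>Comparison of strain, second fundamental form and energy\<close>

lemma sym_part_eq_0_iff:
  fixes M :: "real^2^2"
  shows "sym_part M = 0 \<longleftrightarrow> M$1$1 = 0 \<and> M$2$2 = 0 \<and> M$1$2 + M$2$1 = 0"
  by (auto simp: sym_part_def vec_eq_iff forall_2 transpose_def)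

text \<open>Here \<open>P\<close> is an entry of the second fundamental form and L/\<beta>^2 the
  Christoffel symbol; since G^33 = 1/\<beta>^2, the prescribed formula is a linear equation.\<close>

lemma second_form_solve:
  assumes "(\<beta>::real) > 0"
  shows "P = - (1 / sqrt (inverse (\<beta>\<^sup>2))) * (inverse (\<beta>\<^sup>2) * L) \<longleftrightarrow> L + \<beta> * P = 0"
proof -
  have e: "sqrt (inverse (\<beta>\<^sup>2)) = inverse \<beta>" using assms by (simp add: real_sqrt_inverse)
  have "- (1 / sqrt (inverse (\<beta>\<^sup>2))) * (inverse (\<beta>\<^sup>2) * L) = - L / \<beta>"
    unfolding e using assms by (simp add: power2_eq_square field_simps)
  then show ?thesis using assms by (auto simp: field_simps)
qed

context metric_immersion
begin

text \<open>Each entry of the strain is a positive multiple of L + \<beta> P in the notation of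
  \<open>second_form_solve\<close>. The off-diagonal sum is twice such an expression because the
  second fundamental form is symmetric, which rests on commuting second derivatives.\<close>

lemma strain_zero_iff:
  "AE x in lebesgue_on \<Omega>. sym_part (transpose (weak_grad \<Omega> y x) ** weak_grad \<Omega> b x) = 0 \<longleftrightarrow>
     second_form \<Omega> y x $ 1 $ 1 = - (1 / sqrt (matrix_inv (G x) $ 3 $ 3)) * christoffel G 3 1 1 x \<and>
     second_form \<Omega> y x $ 2 $ 2 = - (1 / sqrt (matrix_inv (G x) $ 3 $ 3)) * christoffel G 3 2 2 x \<and>
     second_form \<Omega> y x $ 1 $ 2 = - (1 / sqrt (matrix_inv (G x) $ 3 $ 3)) * christoffel G 3 1 2 x"
proof -
  note gg = weak_inner_constraint[OF open_\<Omega> dy_weakly_diff dy_weakly_diff _ G_C1]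
  note nn = weak_inner_constraint[OF open_\<Omega> N_weakly_diff dy_weakly_diff _ Ck_on_const]
  note bb = weak_inner_constraint[OF open_\<Omega> b_weakly_diff dy_weakly_diff _ G_C1]
  show ?thesis
    using AE_\<Omega> dy_commute
      gg[OF gram_entries(1), of 1] gg[OF gram_entries(2), of 1] gg[OF gram_entries(3), of 1]
      gg[OF gram_entries(1), of 2] gg[OF gram_entries(2), of 2] gg[OF gram_entries(3), of 2]
      nn[OF N_orthogonal(1), of 1] nn[OF N_orthogonal(2), of 1]
      nn[OF N_orthogonal(1), of 2] nn[OF N_orthogonal(2), of 2]
      bb[OF b_frame(1), of 1] bb[OF b_frame(2), of 1]
      bb[OF b_frame(1), of 2] bb[OF b_frame(2), of 2]
  proof eventually_elim
    case (elim x)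
    let ?q = "inverse ((ncoef (G x))\<^sup>2)"
    have pos: "ncoef (G x) > 0" by (rule ncoef_pos[OF spd[OF elim(1)]])
    have z: "partial_deriv j (\<lambda>_. 0 :: real) x = 0" for j :: 2
      by (simp add: partial_deriv_def frechet_derivative_const)
    \<comment> \<open>Rewriting with \<open>elim(2)\<close> identifies the two mixed second
      derivatives, so that a single \<open>d12\<close> serves in all equations.\<close>
    note alg = gauss_weingarten_algebra[OF b_eq[OF elim(1)] elim(3) elim(4)[folded elim(2)] elim(5)[folded elim(2)]
        elim(6,7,8) elim(9)[unfolded z] elim(10)[unfolded z, folded elim(2)] elim(11,12)[unfolded z]
        elim(13) elim(14)[folded elim(2)] elim(15,16)]
    note chr = christoffel_eq[OF elim(1)]
    let ?L12 = "(partial_deriv 1 (\<lambda>z. G z $ 2 $ 3) x + partial_deriv 2 (\<lambda>z. G z $ 1 $ 3) x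
      - tcoef1 (G x) * partial_deriv 2 (\<lambda>z. G z $ 1 $ 1) x - tcoef2 (G x) * partial_deriv 1 (\<lambda>z. G z $ 2 $ 2) x) / 2"
    have c12: "christoffel G 3 1 2 x = ?q * ?L12"
      using chr(3) by simp
    have alg3: "dy 1 x \<bullet> weak_partial \<Omega> 2 b x + dy 2 x \<bullet> weak_partial \<Omega> 1 b x =
        2 * (?L12 + ncoef (G x) * (dy 1 x \<bullet> weak_partial \<Omega> 2 N x))"
      unfolding alg(3) by (simp add: field_simps)
    have i33: "matrix_inv (G x) $ 3 $ 3 = ?q" by (rule matrix_inv_row3(1)[OF spd[OF elim(1)]])
    have two: "2 * t = 0 \<longleftrightarrow> t = 0" for t :: real by simp
    show ?case
      unfolding sym_part_eq_0_iff weak_grad_mult_component second_form_def alg(1,2) alg3 i33 c12 chr(1,2)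
        second_form_solve[OF pos] two
      by (rule refl)
  qed
qed

text \<open>The two descriptions of the Cosserat vector agree almost everywhere, so the choices of
  their weak derivatives coincide.\<close>

lemma frame_vector_strain:
  "weak_grad \<Omega> (frame_vector \<Omega> G y) = weak_grad \<Omega> b"
  unfolding weak_grad_def using weak_partial_cong_AE[OF open_\<Omega> b_frame(3)] by simp

text \<open>One direction is pointwise vanishing of \<open>Q2\<close>. For the other, a bound
  \<open>T\<close> for the trace of \<open>G\<close> on a box makes the integrand at least a fixed
  positive multiple of |sym F|^2 there.\<close>

lemma energy_zero_iff:
  assumes "stored_energy W c U"
  shows "bending_energy \<Omega> W G y = 0 \<longleftrightarrow>
    (AE x in lebesgue_on \<Omega>. sym_part (transpose (weak_grad \<Omega> y x) ** weak_grad \<Omega> b x) = 0)"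
proof -
  interpret stored_energy W c U by fact
  define F where "F = (\<lambda>x. transpose (weak_grad \<Omega> y x) ** weak_grad \<Omega> b x)"
  define I where "I = (\<integral>\<^sup>+ x. ennreal (Q2 W G x (F x)) \<partial>lebesgue_on \<Omega>)"
  have E: "bending_energy \<Omega> W G y = 0 \<longleftrightarrow> I = 0"
    by (simp add: bending_energy_def I_def F_def ennreal_divide_eq_0_iff)
  have "I = 0" if ae: "AE x in lebesgue_on \<Omega>. sym_part (F x) = 0"
  proof -
    have "AE x in lebesgue_on \<Omega>. ennreal (Q2 W G x (F x)) = 0"
      using ae AE_\<Omega> by eventually_elim (simp add: Q2_properties(2)[where G=G, OF spd])
    then have "I = (\<integral>\<^sup>+ x. 0 \<partial>lebesgue_on \<Omega>)" unfolding I_def by (rule nn_integral_cong_AE)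
    then show ?thesis by simp
  qed
  moreover have "AE x in lebesgue_on \<Omega>. sym_part (F x) = 0" if "I = 0"
  proof (rule AE_on_cboxes_imp_AE[OF open_\<Omega>])
    fix p q assume K: "cbox p q \<subseteq> \<Omega>"
    let ?M = "lebesgue_on (cbox p q)"
    have "continuous_on \<Omega> (\<lambda>x. G x $ i $ i)" for i
      using Ck_on_SucD[OF G_C1] by simp
    then have "continuous_on \<Omega> (\<lambda>x. trace (G x))"
      unfolding trace_def sum_3 by (intro continuous_on_add)
    then have "bounded ((\<lambda>x. trace (G x)) ` cbox p q)"
      using K by (intro compact_imp_bounded compact_continuous_image) (auto intro: continuous_on_subset)
    then obtain T where T: "T > 0" "\<And>x. x \<in> cbox p q \<Longrightarrow> \<bar>trace (G x)\<bar> \<le> T" by (auto simp: bounded_pos)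
    have tr: "trace (G x) > 0" if "x \<in> \<Omega>" for x
    proof -
      have "G x $ i $ i > 0" for i
      proof -
        have "axis i 1 \<bullet> (G x *v axis i 1) > 0" using spd[OF that] unfolding spd_def by (metis axis_eq_0_iff zero_neq_one)
        then show ?thesis by (simp add: matrix_vector_mult_basis column_def inner_axis' )
      qed
      then show ?thesis unfolding trace_def by (intro sum_pos) auto
    qed
    have int: "integrable ?M (dy i)" "integrable ?M (weak_partial \<Omega> j b)" for i j
      using dy_weak[of i] weakly_diff_vec[OF open_\<Omega> b_weakly_diff, of j] K
      by (auto simp: has_weak_partial_def locally_L1_iff)
    have Fm: "(\<lambda>x. F x $ i $ j) \<in> borel_measurable ?M" for i j
      unfolding F_def weak_grad_mult_component using int by (intro borel_measurable_inner) auto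
    have "(\<lambda>x. (norm (sym_part (F x)))\<^sup>2) \<in> borel_measurable ?M"
      unfolding norm_matrix_power2 sym_part_def transpose_def using Fm by simp
    \<comment> \<open>A vanishing integral forces a zero integrand only for measurable functions;
      the conclusion is therefore drawn from this minorant, while \<open>Q2\<close> enters through
      monotonicity.\<close>
    then have m: "(\<lambda>x. ennreal (2 * c / T\<^sup>2 * (norm (sym_part (F x)))\<^sup>2)) \<in> borel_measurable ?M"
      by simp
    have "(\<integral>\<^sup>+ x. ennreal (2 * c / T\<^sup>2 * (norm (sym_part (F x)))\<^sup>2) \<partial>?M) \<le> (\<integral>\<^sup>+ x. ennreal (Q2 W G x (F x)) \<partial>?M)"
    proof (rule nn_integral_mono)
      fix x assume "x \<in> space ?M"
      then have x: "x \<in> cbox p q" "x \<in> \<Omega>" using K by auto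
      have "2 * c / T\<^sup>2 \<le> 2 * c / (trace (G x))\<^sup>2"
        using T tr[OF x(2)] T(2)[OF x(1)] c_pos by (intro divide_left_mono power_mono) auto
      then have "2 * c / T\<^sup>2 * (norm (sym_part (F x)))\<^sup>2 \<le> 2 * c / (trace (G x))\<^sup>2 * (norm (sym_part (F x)))\<^sup>2"
        by (intro mult_right_mono) auto
      also have "\<dots> \<le> Q2 W G x (F x)" by (rule Q2_properties(1)[where G=G and x=x, OF spd[OF x(2)]])
      finally show "ennreal (2 * c / T\<^sup>2 * (norm (sym_part (F x)))\<^sup>2) \<le> ennreal (Q2 W G x (F x))"
        by (rule ennreal_leI)
    qed
    also have "\<dots> = (\<integral>\<^sup>+ x. ennreal (Q2 W G x (F x)) * indicator (cbox p q) x \<partial>lebesgue)"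
      by (subst nn_integral_restrict_space) auto
    also have "\<dots> \<le> (\<integral>\<^sup>+ x. ennreal (Q2 W G x (F x)) * indicator \<Omega> x \<partial>lebesgue)"
      using K by (intro nn_integral_mono) (auto simp: indicator_def)
    also have "\<dots> = I" unfolding I_def using open_\<Omega> by (subst nn_integral_restrict_space) auto
    finally have "(\<integral>\<^sup>+ x. ennreal (2 * c / T\<^sup>2 * (norm (sym_part (F x)))\<^sup>2) \<partial>?M) = 0" using that by simp
    then have "AE x in ?M. ennreal (2 * c / T\<^sup>2 * (norm (sym_part (F x)))\<^sup>2) = 0"
      using nn_integral_0_iff_AE[OF m] by simp
    then show "AE x in ?M. sym_part (F x) = 0"
    proof eventually_elim
      case (elim x)
      then have "2 * c / T\<^sup>2 * (norm (sym_part (F x)))\<^sup>2 \<le> 0" by (simp add: ennreal_eq_0_iff)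
      then have "(norm (sym_part (F x)))\<^sup>2 \<le> 0"
        using c_pos T(1) by (simp add: mult_le_0_iff divide_le_0_iff)
      then show ?case by simp
    qed
  qed
  ultimately show ?thesis unfolding E F_def by blast
qed

lemmas frame_strain_zero_iff = strain_zero_iff[folded frame_vector_strain]
  and frame_energy_zero_iff = energy_zero_iff[folded frame_vector_strain]

end

theorem theorem5p3:
  fixes \<Omega> :: "(real^2) set"
    and G :: "real^2 \<Rightarrow> real^3^3"
    and W :: "real^3^3 \<Rightarrow> ennreal"
    and c :: real
  assumes "open \<Omega>" and "bounded \<Omega>" and "smooth_boundary \<Omega>" and "simply_connected \<Omega>"
    and "smooth_on_set (closure \<Omega>) G"
    and "\<And>x. x \<in> closure \<Omega> \<Longrightarrow> spd (G x)"
    and "\<exists>U. open U \<and> SO3 \<subseteq> U \<and> (\<forall>F\<in>U. W F < \<infinity>) \<and> Ck_on 2 U (\<lambda>F. enn2real (W F))"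
    and "\<And>R. R \<in> SO3 \<Longrightarrow> W R = 0"
    and "\<And>R F. R \<in> SO3 \<Longrightarrow> W (R ** F) = W F"
    and "c > 0"
    and "\<And>F. W F \<ge> ennreal (c * (infdist F SO3)\<^sup>2)"
  defines "condition_i \<equiv>
      \<exists>y. is_arg_min (bending_energy \<Omega> W G) (isometric_immersion \<Omega> G) y \<and> bending_energy \<Omega> W G y = 0"
    and "condition_ii \<equiv>
      \<exists>y. isometric_immersion \<Omega> G y \<and>
        (AE x in lebesgue_on \<Omega>.
           sym_part (transpose (weak_grad \<Omega> y x) ** weak_grad \<Omega> (frame_vector \<Omega> G y) x) = 0)"
    and "condition_iii \<equiv>
      \<exists>y. isometric_immersion \<Omega> G y \<and>
        (AE x in lebesgue_on \<Omega>.
           second_form \<Omega> y x $ 1 $ 1 = - (1 / sqrt (matrix_inv (G x) $ 3 $ 3)) * christoffel G 3 1 1 x \<and>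
           second_form \<Omega> y x $ 2 $ 2 = - (1 / sqrt (matrix_inv (G x) $ 3 $ 3)) * christoffel G 3 2 2 x \<and>
           second_form \<Omega> y x $ 1 $ 2 = - (1 / sqrt (matrix_inv (G x) $ 3 $ 3)) * christoffel G 3 1 2 x)"
  shows "(condition_i \<longleftrightarrow> condition_ii) \<and> (condition_ii \<longleftrightarrow> condition_iii)"
proof -
  obtain U where "open U" "SO3 \<subseteq> U" "\<forall>F\<in>U. W F < \<infinity>" "Ck_on 2 U (\<lambda>F. enn2real (W F))"
    using assms(7) by auto
  with assms(8,10,11) have W: "stored_energy W c U" by unfold_locales auto
  have M: "metric_immersion \<Omega> G y" if "isometric_immersion \<Omega> G y" for y
    using assms(1,5,6) that by unfold_locales
  \<comment> \<open>Energies lie in [0, \<infinity>], so the value 0 is automatically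
    minimal.\<close>
  have min: "is_arg_min (bending_energy \<Omega> W G) (isometric_immersion \<Omega> G) y \<and> bending_energy \<Omega> W G y = 0 \<longleftrightarrow>
      isometric_immersion \<Omega> G y \<and> bending_energy \<Omega> W G y = 0" for y
    by (auto simp: is_arg_min_def)
  show ?thesis
    unfolding condition_i_def condition_ii_def condition_iii_def min
    by (intro conjI ex_cong1 conj_cong refl metric_immersion.frame_energy_zero_iff[OF M W]
        eventually_cong[OF metric_immersion.frame_strain_zero_iff[OF M]])
qed

end
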